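(* Let $f$ be a $\mathbb{C}^{m\times n}$-valued DA function on $V(\Lambda)$. Then $f$ is rational if, and only if, there exists a $\mathbb{C}$-valued DA polynomial $p\not\equiv 0$ such that $(pI_m)\odot f$ is a DA polynomial as well (with values in $\mathbb{C}^{m\times n}$).
   Context: **Lattice.** $\Lambda$ is a rhombic lattice in the complex plane $\mathbb{C}$: a monohedral (all tiles congruent), edge-to-edge tessellation of $\mathbb{C}$ with rhombi of side length $1$. $V(\Lambda)$, $E(\Lambda)$, $F(\Lambda)$ denote its sets of vertices, edges and faces; $(a,b)\in E(\Lambda)$ means that $a,b\in V(\Lambda)$ are adjacent, and edges are taken in both orientations, so $(a,b)\in E(\Lambda)$ iff $(b,a)\in E(\Lambda)$. A path in $\Lambda$ from $a$ to $b$ is a finite sequence $(z_0,\dots,z_N)$ of vertices with $z_0=a$, $z_N=b$ and $z_{n-1},z_n$ adjacent for $n=1,\dots,N$; it is closed if $a=b$. Standing assumptions on $\Lambda$: (i) $0\in V(\Lambda)$; (ii) for every $z\in V(\Lambda)$ there are $N\in\mathbb{N}$ and a path $(z_0,\dots,z_N)$ with $z_0=z$, $z_n-z_{n-1}\neq\pm1$ for $n=1,\dots,N-1$, and $z_N-z_{N-1}=1$. **Discrete analyticity.** For $f:V(\Lambda)\to\mathbb{C}$ and a path $\gamma=(z_0,\dots,z_N)$, $\int_\gamma f\,\delta z=\sum_{n=1}^N\frac{f(z_{n-1})+f(z_n)}{2}(z_n-z_{n-1})$. $f$ is discrete analytic (DA) if $\int_\gamma f\,\delta z=0$ for every closed path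 $\gamma$; then $\int_a^b f\,\delta z$ denotes $\int_\gamma f\,\delta z$ for any path $\gamma$ from $a$ to $b$. $\mathcal{H}(\Lambda)$ is the complex vector space of DA functions. **Shift operators.** $Z_+:\mathcal{H}(\Lambda)\to\mathcal{H}(\Lambda)$ is $(Z_+f)(z)=\frac{f(0)-f(z)}{2}+\int_0^z f\,\delta z$. It is injective with range $\{g\in\mathcal{H}(\Lambda):g(0)=0\}$, so one may define $Z_-:\mathcal{H}(\Lambda)\to\mathcal{H}(\Lambda)$ by letting $Z_-f$ be the unique element of $\mathcal{H}(\Lambda)$ with $(Z_+Z_-f)(z)=f(z)-f(0)$. **The set $S(\Lambda)$.** $S(\Lambda)=\{t\in\mathbb{C}: t(1+b-a)=-2\text{ for some }(a,b)\in E(\Lambda)\}$. Standing assumption: no element of $S(\Lambda)$ is an eigenvalue of $Z_-$ on $\mathcal{H}(\Lambda)$. **DA polynomials.** $z^{(0)}=1$ and $z^{(n)}=Z_+z^{(n-1)}$ for $n\ge1$ (so $z^{(1)}=z$). DA polynomials are finite linear combinations of the functions $z^{(n)}$. **Matrix-valued functions.** $\mathcal{H}(\Lambda)^{m\times n}$ is the space of $\mathbb{C}^{m\times n}$-valued functions on $V(\Lambda)$ with DA entries; integrals and $Z_\pm$ act entrywise. $\mathbb{C}^{m\times n}$-valued DA polynomials are sums $\sum_{n=0}^N A_nz^{(n)}$ with matrix coefficients. For such a polynomial $p=\sum_{n=0}^N A_nz^{(n)}$ and DA matrix-valued functions $f,g$ of suitable sizes, the convolution product is $(p\odot f)(z)=\sum_{n=0}^N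 A_n(Z_+^nf)(z)$ and $(g\odot p)(z)=\sum_{n=0}^N(Z_+^ng)(z)A_n$. **Rational DA functions.** For $A\in\mathbb{C}^{\ell\times\ell}$ with spectrum $\sigma(A)$ satisfying $S(\Lambda)\cap\sigma(A)=\emptyset$, the DA polynomial $I-zA$ has a unique two-sided $\odot$-inverse in $\mathcal{H}(\Lambda)^{\ell\times\ell}$, denoted $(I-zA)^{-\odot}$. A matrix-valued DA function $f$ is called rational if it can be written as $f(z)=D+C(I-zA)^{-\odot}\odot(zB)$, i.e. $f(z)=D+C\big(Z_+(I-zA)^{-\odot}\big)(z)B$, with complex matrices $A,B,C,D$ of suitable dimensions and $S(\Lambda)\cap\sigma(A)=\emptyset$; such a representation is called a realization of $f$. *)

theory Defs
  imports "HOL-Analysis.Polytope" "Jordan_Normal_Form.Spectral_Radius"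
begin

(* Rhombic lattices. A lattice is given by its set of (closed) faces; vertices and edges are
   the 0- and 1-dimensional faces (in the sense of convex geometry) of the tiles. *)

definition unit_rhombus :: "complex set \<Rightarrow> bool" where
  "unit_rhombus T \<longleftrightarrow> (\<exists>a u v. norm u = 1 \<and> norm v = 1 \<and> v \<noteq> u \<and> v \<noteq> - u \<and>
     T = convex hull {a, a + u, a + u + v, a + v})"

definition congruent_tiles :: "complex set \<Rightarrow> complex set \<Rightarrow> bool" where
  "congruent_tiles T T' \<longleftrightarrow> (\<exists>h. (\<forall>x y. dist (h x) (h y) = dist x y) \<and> h ` T = T')"

definition rhombic_lattice :: "complex set set \<Rightarrow> bool" where
  "rhombic_lattice \<Lambda> \<longleftrightarrow>
     (\<forall>T\<in>\<Lambda>. unit_rhombus T) \<and>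
     (\<forall>T\<in>\<Lambda>. \<forall>T'\<in>\<Lambda>. congruent_tiles T T') \<and>
     \<Union>\<Lambda> = UNIV \<and>
     (\<forall>T\<in>\<Lambda>. \<forall>T'\<in>\<Lambda>. T \<noteq> T' \<longrightarrow> interior T \<inter> interior T' = {}) \<and>
     (\<forall>T\<in>\<Lambda>. \<forall>T'\<in>\<Lambda>. T \<inter> T' face_of T \<and> T \<inter> T' face_of T')"

definition lattice_vertices :: "complex set set \<Rightarrow> complex set" where
  "lattice_vertices \<Lambda> = {z. \<exists>T\<in>\<Lambda>. z extreme_point_of T}"

definition lattice_edges :: "complex set set \<Rightarrow> (complex \<times> complex) set" where
  "lattice_edges \<Lambda> = {(a, b). \<exists>T\<in>\<Lambda>. closed_segment a b edge_of T}"

definition lattice_path :: "complex set set \<Rightarrow> complex \<Rightarrow> complex \<Rightarrow> complex list \<Rightarrow> bool" where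
  "lattice_path \<Lambda> a b zs \<longleftrightarrow>
     zs \<noteq> [] \<and> set zs \<subseteq> lattice_vertices \<Lambda> \<and> hd zs = a \<and> last zs = b \<and>
     (\<forall>n\<in>{1..<length zs}. (zs ! (n - 1), zs ! n) \<in> lattice_edges \<Lambda>)"

definition admissible_lattice :: "complex set set \<Rightarrow> bool" where
  "admissible_lattice \<Lambda> \<longleftrightarrow>
     rhombic_lattice \<Lambda> \<and> 0 \<in> lattice_vertices \<Lambda> \<and>
     (\<forall>z\<in>lattice_vertices \<Lambda>. \<exists>N\<ge>1. \<exists>w zs. lattice_path \<Lambda> z w zs \<and> length zs = Suc N \<and>
        (\<forall>n\<in>{1..N - 1}. zs ! n - zs ! (n - 1) \<noteq> 1 \<and> zs ! n - zs ! (n - 1) \<noteq> - 1) \<and>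
        zs ! N - zs ! (N - 1) = 1)"

(* Discrete analytic functions. A function on the vertex set is represented by its extension
   by 0 to the whole plane, so that equality of functions is HOL equality and the
   definite descriptions below are unambiguous. *)

definition path_int :: "(complex \<Rightarrow> complex) \<Rightarrow> complex list \<Rightarrow> complex" where
  "path_int f zs = (\<Sum>n\<in>{1..<length zs}. (f (zs ! (n - 1)) + f (zs ! n)) / 2 * (zs ! n - zs ! (n - 1)))"

definition DA :: "complex set set \<Rightarrow> (complex \<Rightarrow> complex) set" where
  "DA \<Lambda> = {f. (\<forall>a zs. lattice_path \<Lambda> a a zs \<longrightarrow> path_int f zs = 0) \<and>
              (\<forall>z. z \<notin> lattice_vertices \<Lambda> \<longrightarrow> f z = 0)}"

(* For discrete analytic f the choice of the path is immaterial. *)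
definition vertex_int :: "complex set set \<Rightarrow> complex \<Rightarrow> complex \<Rightarrow> (complex \<Rightarrow> complex) \<Rightarrow> complex" where
  "vertex_int \<Lambda> a b f = path_int f (SOME zs. lattice_path \<Lambda> a b zs)"

definition Zplus :: "complex set set \<Rightarrow> (complex \<Rightarrow> complex) \<Rightarrow> complex \<Rightarrow> complex" where
  "Zplus \<Lambda> f z =
     (if z \<in> lattice_vertices \<Lambda> then (f 0 - f z) / 2 + vertex_int \<Lambda> 0 z f else 0)"

definition Zminus :: "complex set set \<Rightarrow> (complex \<Rightarrow> complex) \<Rightarrow> complex \<Rightarrow> complex" where
  "Zminus \<Lambda> f = (THE g. g \<in> DA \<Lambda> \<and> (\<forall>z\<in>lattice_vertices \<Lambda>. Zplus \<Lambda> g z = f z - f 0))"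

definition Zminus_eigenvalue :: "complex set set \<Rightarrow> complex \<Rightarrow> bool" where
  "Zminus_eigenvalue \<Lambda> t \<longleftrightarrow>
     (\<exists>f\<in>DA \<Lambda>. (\<exists>z\<in>lattice_vertices \<Lambda>. f z \<noteq> 0) \<and>
        (\<forall>z\<in>lattice_vertices \<Lambda>. Zminus \<Lambda> f z = t * f z))"

definition exceptional_set :: "complex set set \<Rightarrow> complex set" where
  "exceptional_set \<Lambda> = {t. \<exists>(a, b)\<in>lattice_edges \<Lambda>. t * (1 + b - a) = - 2}"

definition DA_power :: "complex set set \<Rightarrow> nat \<Rightarrow> complex \<Rightarrow> complex" where
  "DA_power \<Lambda> n = (Zplus \<Lambda> ^^ n) (\<lambda>z. if z \<in> lattice_vertices \<Lambda> then 1 else 0)"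

definition DA_poly :: "complex set set \<Rightarrow> nat \<Rightarrow> (nat \<Rightarrow> complex) \<Rightarrow> complex \<Rightarrow> complex" where
  "DA_poly \<Lambda> N c z = (\<Sum>k\<le>N. c k * DA_power \<Lambda> k z)"

(* Matrix-valued functions. Matrix-valued polynomials are given by a degree bound N and
   coefficients A 0, ..., A N; sums of matrices are written entrywise since matrices with
   explicit dimensions do not form a commutative monoid in the sense of type classes. *)

definition DA_mat :: "complex set set \<Rightarrow> nat \<Rightarrow> nat \<Rightarrow> (complex \<Rightarrow> complex Matrix.mat) set" where
  "DA_mat \<Lambda> m n = {f. (\<forall>z. f z \<in> carrier_mat m n) \<and>
                       (\<forall>i<m. \<forall>j<n. (\<lambda>z. f z $$ (i, j)) \<in> DA \<Lambda>)}"

definition Zplus_mat ::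
  "complex set set \<Rightarrow> (complex \<Rightarrow> complex Matrix.mat) \<Rightarrow> complex \<Rightarrow> complex Matrix.mat" where
  "Zplus_mat \<Lambda> f z =
     Matrix.mat (dim_row (f z)) (dim_col (f z)) (\<lambda>(i, j). Zplus \<Lambda> (\<lambda>w. f w $$ (i, j)) z)"

definition DA_mat_poly ::
  "complex set set \<Rightarrow> nat \<Rightarrow> nat \<Rightarrow> nat \<Rightarrow> (nat \<Rightarrow> complex Matrix.mat) \<Rightarrow> complex \<Rightarrow> complex Matrix.mat" where
  "DA_mat_poly \<Lambda> m n N A z =
     Matrix.mat m n (\<lambda>(i, j). \<Sum>k\<le>N. A k $$ (i, j) * DA_power \<Lambda> k z)"

definition is_DA_mat_poly ::
  "complex set set \<Rightarrow> nat \<Rightarrow> nat \<Rightarrow> (complex \<Rightarrow> complex Matrix.mat) \<Rightarrow> bool" where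
  "is_DA_mat_poly \<Lambda> m n g \<longleftrightarrow>
     (\<exists>N A. (\<forall>k\<le>N. A k \<in> carrier_mat m n) \<and> g = DA_mat_poly \<Lambda> m n N A)"

(* The convolution products (A 0 + ... + A N z^(N)) * f and g * (A 0 + ... + A N z^(N));
   m and n are the dimensions of the values of the product. *)

definition conv_poly_left ::
  "complex set set \<Rightarrow> nat \<Rightarrow> nat \<Rightarrow> nat \<Rightarrow> (nat \<Rightarrow> complex Matrix.mat) \<Rightarrow>
     (complex \<Rightarrow> complex Matrix.mat) \<Rightarrow> complex \<Rightarrow> complex Matrix.mat" where
  "conv_poly_left \<Lambda> m n N A f z =
     Matrix.mat m n (\<lambda>ij. \<Sum>k\<le>N. (A k * (Zplus_mat \<Lambda> ^^ k) f z) $$ ij)"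

definition conv_poly_right ::
  "complex set set \<Rightarrow> nat \<Rightarrow> nat \<Rightarrow> nat \<Rightarrow> (complex \<Rightarrow> complex Matrix.mat) \<Rightarrow>
     (nat \<Rightarrow> complex Matrix.mat) \<Rightarrow> complex \<Rightarrow> complex Matrix.mat" where
  "conv_poly_right \<Lambda> m n N g A z =
     Matrix.mat m n (\<lambda>ij. \<Sum>k\<le>N. ((Zplus_mat \<Lambda> ^^ k) g z * A k) $$ ij)"

(* Coefficients of the polynomial I - z A of degree at most 1. *)
definition pencil :: "nat \<Rightarrow> complex Matrix.mat \<Rightarrow> nat \<Rightarrow> complex Matrix.mat" where
  "pencil l A k = (if k = 0 then 1\<^sub>m l else if k = 1 then - A else 0\<^sub>m l l)"

(* The two-sided convolution inverse of I - z A; the unit is the constant polynomial I. *)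
definition DA_resolvent ::
  "complex set set \<Rightarrow> nat \<Rightarrow> complex Matrix.mat \<Rightarrow> complex \<Rightarrow> complex Matrix.mat" where
  "DA_resolvent \<Lambda> l A = (THE R. R \<in> DA_mat \<Lambda> l l \<and>
     conv_poly_left \<Lambda> l l 1 (pencil l A) R = DA_mat_poly \<Lambda> l l 0 (\<lambda>_. 1\<^sub>m l) \<and>
     conv_poly_right \<Lambda> l l 1 R (pencil l A) = DA_mat_poly \<Lambda> l l 0 (\<lambda>_. 1\<^sub>m l))"

definition DA_rational ::
  "complex set set \<Rightarrow> nat \<Rightarrow> nat \<Rightarrow> (complex \<Rightarrow> complex Matrix.mat) \<Rightarrow> bool" where
  "DA_rational \<Lambda> m n f \<longleftrightarrow> f \<in> DA_mat \<Lambda> m n \<and>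
     (\<exists>l A B C D. A \<in> carrier_mat l l \<and> B \<in> carrier_mat l n \<and>
        C \<in> carrier_mat m l \<and> D \<in> carrier_mat m n \<and>
        exceptional_set \<Lambda> \<inter> spectrum A = {} \<and>
        (\<forall>z\<in>lattice_vertices \<Lambda>. f z = D + C * Zplus_mat \<Lambda> (DA_resolvent \<Lambda> l A) z * B))"

end

theory Submission
  imports Defs "HOL-Analysis.Analysis" "HOL-Computational_Algebra.Fundamental_Theorem_Algebra"
begin

text \<open>
  Write \<open>H\<close> for the space of DA functions. Since \<open>Z_+\<close> acts linearly on \<open>H\<close>, so does \<open>p(Z_+)\<close> for
  every complex polynomial \<open>p\<close>; convolution with a DA polynomial is such an action, and DA
  polynomials are the functions \<open>q(Z_+) 1\<close>. The theorem thereby becomes a statement about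
  \<open>H\<close> as a module over the polynomial ring, resting on three facts about \<open>Z_+\<close>:

  \<^item> \<open>Z_+\<close> maps \<open>H\<close> injectively into the functions of \<open>H\<close> vanishing at 0
    (\<open>Zplus_DA\<close>, \<open>Zplus_at_0\<close>, \<open>Zplus_inj_zero\<close>);
  \<^item> \<open>I - t Z_+\<close> is bijective on \<open>H\<close> for \<open>t\<close> outside the exceptional set
    (\<open>resolvent_inj\<close>, \<open>resolvent_surj\<close>);
  \<^item> for \<open>t\<close> in the exceptional set, where \<open>t\<close> is by assumption no eigenvalue of \<open>Z_-\<close>, the operator
    \<open>I - t Z_+\<close> is injective and no nonzero constant function is in its range
    (\<open>cancel_irregular_factor\<close>).

  If \<open>f\<close> has a realization with matrix \<open>A\<close>, then \<open>p(s) = det(I - s A)\<close> is a product of factors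
  \<open>1 - t s\<close> with \<open>t\<close> outside the exceptional set, so \<open>p(Z_+)\<close> is bijective, the resolvent is
  \<open>p(Z_+)\<close> inverted on \<open>adj(I - Z_+ A) 1\<close>, and \<open>p(Z_+) f\<close> is a polynomial. Conversely, let \<open>p(Z_+) f\<close>
  be a polynomial. By the first and third fact the factors \<open>s\<close> of \<open>p\<close> and the factors \<open>1 - t s\<close> with
  exceptional \<open>t\<close> also divide the right-hand side and cancel (\<open>reduce_to_regular\<close>). What remains is a
  regular \<open>p\<close>, and the companion matrix of \<open>p\<close> yields a realization
  (\<open>poly_multiple_imp_rational\<close>).

  The facts about \<open>Z_+\<close> need a discrete Poincare lemma for an arbitrary rhombic tiling: discrete
  analyticity can be checked tile by tile, and so can the solvability of the edge equations of
  \<open>g - t Z_+ g = h\<close>. Both are instances of \<open>global_section\<close>, that a transport along edges without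
  holonomy around single tiles has a global section. Near each point all tiles have a common vertex,
  so sections exist locally and extend uniquely along connected sets; bisection of rectangles and
  exhaustion of the plane by squares make them global.
\<close>

section \<open>Unit rhombi\<close>

text \<open>
  The closed parallelogram at the corner \<open>p\<close> spanned by \<open>d\<close> and \<open>e\<close>, in coordinates.
\<close>
definition parallelogram :: "complex \<Rightarrow> complex \<Rightarrow> complex \<Rightarrow> complex set" where
  "parallelogram p d e = {p + s *\<^sub>R d + t *\<^sub>R e | s t. 0 \<le> s \<and> s \<le> 1 \<and> 0 \<le> t \<and> t \<le> 1}"

text \<open>
  \<open>T\<close> is the unit rhombus at the corner \<open>p\<close> with sides \<open>d\<close> and \<open>e\<close>. Each of the four corners
  may serve as \<open>p\<close>, which reduces statements about corners and sides to the corner \<open>p\<close>.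
\<close>
definition rhombus_at :: "complex set \<Rightarrow> complex \<Rightarrow> complex \<Rightarrow> complex \<Rightarrow> bool" where
  "rhombus_at T p d e \<longleftrightarrow> T = parallelogram p d e \<and> norm d = 1 \<and> norm e = 1 \<and> d \<noteq> e \<and> d \<noteq> - e"

lemma unit_coords_unique:
  fixes d e :: complex
  assumes "norm d = 1" "norm e = 1" "d \<noteq> e" "d \<noteq> - e"
    and eq: "s *\<^sub>R d + t *\<^sub>R e = s' *\<^sub>R d + t' *\<^sub>R e"
  shows "s = s' \<and> t = t'"
proof -
  have *: "(s - s') *\<^sub>R d = (t' - t) *\<^sub>R e"
    using eq by (simp add: algebra_simps)
  then have "\<bar>s - s'\<bar> = \<bar>t' - t\<bar>"
    by (metis assms(1,2) mult.right_neutral norm_scaleR)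
  then consider "s - s' = t' - t" | "s - s' = - (t' - t)" by linarith
  then have "s - s' = 0"
  proof cases
    case 1
    then show ?thesis using * assms(3) by force
  next
    case 2
    then have "(s - s') *\<^sub>R d = (s - s') *\<^sub>R (- e)"
      using * by (metis minus_minus scaleR_minus_left scaleR_minus_right)
    then show ?thesis using assms(4) by (metis scaleR_cancel_left eq_iff_diff_eq_0)
  qed
  moreover from this have "t' - t = 0"
    using * assms(2) by auto
  ultimately show ?thesis by simp
qed

lemma convex_parallelogram: "convex (parallelogram p d e)"
proof (rule convexI)
  fix x y u v assume x: "x \<in> parallelogram p d e" and y: "y \<in> parallelogram p d e"
    and uv: "0 \<le> (u::real)" "0 \<le> v" "u + v = 1"
  from x obtain s t where st: "x = p + s *\<^sub>R d + t *\<^sub>R e" "0 \<le> s" "s \<le> 1" "0 \<le> t" "t \<le> 1"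
    unfolding parallelogram_def by blast
  from y obtain s' t' where st': "y = p + s' *\<^sub>R d + t' *\<^sub>R e" "0 \<le> s'" "s' \<le> 1" "0 \<le> t'" "t' \<le> 1"
    unfolding parallelogram_def by blast
  have u: "u = 1 - v" using uv by simp
  have "u *\<^sub>R x + v *\<^sub>R y = p + (u * s + v * s') *\<^sub>R d + (u * t + v * t') *\<^sub>R e"
    unfolding st st' u by (simp add: algebra_simps)
  moreover have "u * s + v * s' \<le> 1" "u * t + v * t' \<le> 1"
    using uv st st' by (auto intro!: convex_bound_le)
  ultimately show "u *\<^sub>R x + v *\<^sub>R y \<in> parallelogram p d e"
    unfolding parallelogram_def using uv st st' by fastforce
qed

lemma parallelogram_corners: "p \<in> parallelogram p d e" "p + d \<in> parallelogram p d e" "p + e \<in> parallelogram p d e" "p + d + e \<in> parallelogram p d e"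
proof -
  have "p + a *\<^sub>R d + b *\<^sub>R e \<in> parallelogram p d e" if "a \<in> {0, 1}" "b \<in> {0, 1}" for a b
    unfolding parallelogram_def using that by fastforce
  from this[of 0 0] this[of 1 0] this[of 0 1] this[of 1 1]
  show "p \<in> parallelogram p d e" "p + d \<in> parallelogram p d e" "p + e \<in> parallelogram p d e" "p + d + e \<in> parallelogram p d e"
    by simp_all
qed

lemma convex_hull_eq_parallelogram: "convex hull {p, p + d, p + d + e, p + e} = parallelogram p d e"
proof
  show "convex hull {p, p + d, p + d + e, p + e} \<subseteq> parallelogram p d e"
    by (rule hull_minimal) (use parallelogram_corners convex_parallelogram in auto)
  show "parallelogram p d e \<subseteq> convex hull {p, p + d, p + d + e, p + e}" (is "_ \<subseteq> ?H")
  proof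
    fix z assume "z \<in> parallelogram p d e"
    then obtain s t where st: "z = p + s *\<^sub>R d + t *\<^sub>R e" "0 \<le> s" "s \<le> 1" "0 \<le> t" "t \<le> 1"
      unfolding parallelogram_def by blast
    have c: "convex ?H" by (rule convex_convex_hull)
    have "(1 - s) *\<^sub>R p + s *\<^sub>R (p + d) \<in> ?H"
      by (rule convexD_alt[OF c]) (use st in \<open>auto intro: hull_inc\<close>)
    moreover have "(1 - s) *\<^sub>R (p + e) + s *\<^sub>R (p + d + e) \<in> ?H"
      by (rule convexD_alt[OF c]) (use st in \<open>auto intro: hull_inc\<close>)
    ultimately have "(1 - t) *\<^sub>R ((1 - s) *\<^sub>R p + s *\<^sub>R (p + d)) + t *\<^sub>R ((1 - s) *\<^sub>R (p + e) + s *\<^sub>R (p + d + e)) \<in> ?H"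
      by (rule convexD_alt[OF c]) (use st in auto)
    then show "z \<in> ?H" by (simp add: st algebra_simps)
  qed
qed

lemma unit_rhombus_rhombus_at: "unit_rhombus T \<longleftrightarrow> (\<exists>p d e. rhombus_at T p d e)"
proof -
  have "norm d = 1 \<and> norm e = 1 \<and> e \<noteq> d \<and> e \<noteq> - d \<and> T = parallelogram p d e \<longleftrightarrow> rhombus_at T p d e" for p d e
    unfolding rhombus_at_def using minus_equation_iff[of d e] by auto
  then show ?thesis unfolding unit_rhombus_def convex_hull_eq_parallelogram by blast
qed

lemma parallelogram_commute: "parallelogram p d e = parallelogram p e d"
proof -
  have sub: "parallelogram p d e \<subseteq> parallelogram p e d" for d e
  proof
    fix z assume "z \<in> parallelogram p d e"
    then obtain s t where "z = p + s *\<^sub>R d + t *\<^sub>R e" "0 \<le> s" "s \<le> 1" "0 \<le> t" "t \<le> 1"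
      unfolding parallelogram_def by blast
    moreover from this have "z = p + t *\<^sub>R e + s *\<^sub>R d" by (simp add: algebra_simps)
    ultimately show "z \<in> parallelogram p e d" unfolding parallelogram_def by blast
  qed
  from sub[of d e] sub[of e d] show ?thesis by auto
qed

lemma parallelogram_flip: "parallelogram (p + d) (- d) e = parallelogram p d e"
proof -
  have sub: "parallelogram (p + d) (- d) e \<subseteq> parallelogram p d e" for p d
  proof
    fix z assume "z \<in> parallelogram (p + d) (- d) e"
    then obtain s t where st: "z = p + d + s *\<^sub>R (- d) + t *\<^sub>R e" "0 \<le> s" "s \<le> 1" "0 \<le> t" "t \<le> 1"
      unfolding parallelogram_def by blast
    then have "z = p + (1 - s) *\<^sub>R d + t *\<^sub>R e" by (simp add: algebra_simps)
    then show "z \<in> parallelogram p d e" unfolding parallelogram_def using st by fastforce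
  qed
  from sub[of p d] sub[of "p + d" "- d"] show ?thesis by auto
qed

lemma rhombus_at_commute: "rhombus_at T p d e \<Longrightarrow> rhombus_at T p e d"
  unfolding rhombus_at_def by (subst parallelogram_commute) auto

lemma rhombus_at_flip: "rhombus_at T p d e \<Longrightarrow> rhombus_at T (p + d) (- d) e"
  unfolding rhombus_at_def parallelogram_flip using minus_equation_iff[of d e] by auto

lemma rhombus_at_flip2: "rhombus_at T p d e \<Longrightarrow> rhombus_at T (p + e) d (- e)"
  by (rule rhombus_at_commute[OF rhombus_at_flip[OF rhombus_at_commute]])

lemma rhombus_at_flip3: "rhombus_at T p d e \<Longrightarrow> rhombus_at T (p + d + e) (- d) (- e)"
  using rhombus_at_flip2[OF rhombus_at_flip] by simp

lemma rhombus_at_convex: "rhombus_at T p d e \<Longrightarrow> convex T"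
  by (simp add: rhombus_at_def convex_parallelogram)

lemma rhombus_at_compact: "rhombus_at T p d e \<Longrightarrow> compact T"
  unfolding rhombus_at_def by (metis convex_hull_eq_parallelogram compact_convex_hull finite.emptyI finite_imp_compact finite_insert)

lemma rhombus_at_side_face:
  assumes "rhombus_at T p d e"
  shows "closed_segment p (p + d) face_of T"
  unfolding face_of_def
proof (intro conjI ballI impI)
  note r = assms[unfolded rhombus_at_def]
  have seg: "z \<in> closed_segment p (p + d) \<longleftrightarrow> (\<exists>s. 0 \<le> s \<and> s \<le> 1 \<and> z = p + s *\<^sub>R d)" for z
    unfolding closed_segment_def by (auto simp: algebra_simps)
  show "closed_segment p (p + d) \<subseteq> T"
    by (intro closed_segment_subset) (use r parallelogram_corners convex_parallelogram in auto)
  fix a b x assume a: "a \<in> T" and b: "b \<in> T" and x: "x \<in> closed_segment p (p + d)"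
    and xab: "x \<in> open_segment a b"
  from a r obtain s t where st: "a = p + s *\<^sub>R d + t *\<^sub>R e" "0 \<le> s" "s \<le> 1" "0 \<le> t" "t \<le> 1"
    unfolding parallelogram_def by blast
  from b r obtain s' t' where st': "b = p + s' *\<^sub>R d + t' *\<^sub>R e" "0 \<le> s'" "s' \<le> 1" "0 \<le> t'" "t' \<le> 1"
    unfolding parallelogram_def by blast
  obtain s0 where s0: "x = p + s0 *\<^sub>R d" using x seg by blast
  obtain u where u: "0 < u" "u < 1" "x = (1 - u) *\<^sub>R a + u *\<^sub>R b"
    using xab by (auto simp: in_segment)
  have "s0 *\<^sub>R d + 0 *\<^sub>R e = ((1 - u) * s + u * s') *\<^sub>R d + ((1 - u) * t + u * t') *\<^sub>R e"
    using s0 u(3) unfolding st st' by (simp add: algebra_simps)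
  from unit_coords_unique[OF _ _ _ _ this] r
  have z: "(1 - u) * t + u * t' = 0" by simp
  have "(1 - u) * t \<ge> 0" "u * t' \<ge> 0" using u st st' by auto
  with z have "(1 - u) * t = 0" "u * t' = 0" by linarith+
  then have "t = 0" "t' = 0" using u by auto
  then show "a \<in> closed_segment p (p + d)" "b \<in> closed_segment p (p + d)"
    unfolding seg using st st' by auto
qed auto

lemma rhombus_at_corner_extreme:
  assumes "rhombus_at T p d e"
  shows "p extreme_point_of T"
proof -
  have "p extreme_point_of closed_segment p (p + d)" by (simp add: extreme_point_of_segment)
  then show ?thesis using extreme_point_of_face[OF rhombus_at_side_face[OF assms]] by blast
qed

lemma rhombus_at_extreme_iff:
  assumes "rhombus_at T p d e"
  shows "x extreme_point_of T \<longleftrightarrow> x \<in> {p, p + d, p + e, p + d + e}"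
proof
  assume "x extreme_point_of T"
  then have "x extreme_point_of (convex hull {p, p + d, p + d + e, p + e})"
    using assms by (simp add: rhombus_at_def convex_hull_eq_parallelogram)
  then show "x \<in> {p, p + d, p + e, p + d + e}"
    using extreme_point_of_convex_hull by blast
next
  assume "x \<in> {p, p + d, p + e, p + d + e}"
  then show "x extreme_point_of T"
    using rhombus_at_corner_extreme[OF assms] rhombus_at_corner_extreme[OF rhombus_at_flip[OF assms]]
      rhombus_at_corner_extreme[OF rhombus_at_flip2[OF assms]]
      rhombus_at_corner_extreme[OF rhombus_at_flip3[OF assms]]
    by auto
qed

lemma rhombus_at_any_corner:
  assumes "unit_rhombus T" "x extreme_point_of T"
  obtains d e where "rhombus_at T x d e"
proof -
  obtain p d e where r: "rhombus_at T p d e" using assms(1) unit_rhombus_rhombus_at by blast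
  with assms(2) consider "x = p" | "x = p + d" | "x = p + e" | "x = p + d + e"
    using rhombus_at_extreme_iff by blast
  then show ?thesis
    by cases (use that r rhombus_at_flip rhombus_at_flip2 rhombus_at_flip3 in blast)+
qed

lemma rhombus_at_centre_interior:
  assumes "rhombus_at T p d e"
  shows "p + (1/2) *\<^sub>R d + (1/2) *\<^sub>R e \<in> interior T"
proof -
  note r = assms[unfolded rhombus_at_def]
  define h where "h = (\<lambda>x::complex. Re x *\<^sub>R d + Im x *\<^sub>R e)"
  have lin: "linear h"
    unfolding h_def by (rule linearI) (auto simp: algebra_simps)
  have "inj h"
  proof (rule injI)
    fix x y assume "h x = h y"
    then have "Re x *\<^sub>R d + Im x *\<^sub>R e = Re y *\<^sub>R d + Im y *\<^sub>R e" by (simp add: h_def)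
    from unit_coords_unique[OF _ _ _ _ this] r show "x = y" by (simp add: complex_eq_iff)
  qed
  with lin have "open (h ` box 0 (Complex 1 1))"
    by (intro open_surjective_linear_image linear_injective_imp_surjective) auto
  then have op: "open ((+) p ` h ` box 0 (Complex 1 1))" by (rule open_translation)
  have "(+) p ` h ` box 0 (Complex 1 1) \<subseteq> T"
  proof
    fix z assume "z \<in> (+) p ` h ` box 0 (Complex 1 1)"
    then obtain x where "x \<in> box 0 (Complex 1 1)" "z = p + Re x *\<^sub>R d + Im x *\<^sub>R e"
      by (auto simp: h_def)
    then show "z \<in> T" using r unfolding parallelogram_def in_box_complex_iff by fastforce
  qed
  moreover have "p + (1/2) *\<^sub>R d + (1/2) *\<^sub>R e \<in> (+) p ` h ` box 0 (Complex 1 1)"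
  proof -
    have "Complex (1/2) (1/2) \<in> box 0 (Complex 1 1)" by (simp add: in_box_complex_iff)
    moreover have "p + (1/2) *\<^sub>R d + (1/2) *\<^sub>R e = p + h (Complex (1/2) (1/2))"
      by (simp add: h_def)
    ultimately show ?thesis by blast
  qed
  ultimately show ?thesis using op by (meson interior_maximal subsetD)
qed

text \<open>
  A diagonal is no edge: its midpoint also lies inside the other diagonal, so a face containing the
  one diagonal would contain the end points of the other.
\<close>
lemma rhombus_at_edge_iff:
  assumes "rhombus_at T p d e"
  shows "closed_segment p q edge_of T \<longleftrightarrow> q = p + d \<or> q = p + e"
proof
  note r = assms[unfolded rhombus_at_def]
  have edge: "closed_segment p (p + d) edge_of T" if "rhombus_at T p d e" for d e
  proof -
    have "d \<noteq> 0" using that by (auto simp: rhombus_at_def)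
    then have "aff_dim (closed_segment p (p + d)) = 1"
      by (simp add: segment_convex_hull aff_dim_convex_hull)
    then show ?thesis using rhombus_at_side_face[OF that] by (simp add: edge_of_def)
  qed
  show "closed_segment p q edge_of T" if "q = p + d \<or> q = p + e"
    using that edge[OF assms] edge[OF rhombus_at_commute[OF assms]] by auto
  assume "closed_segment p q edge_of T"
  then have f: "closed_segment p q face_of T" and dim: "aff_dim (closed_segment p q) = 1"
    by (auto simp: edge_of_def)
  have "q extreme_point_of T"
    using extreme_point_of_face[OF f, of q] by (simp add: extreme_point_of_segment)
  then have q: "q \<in> {p, p + d, p + e, p + d + e}"
    using rhombus_at_extreme_iff[OF assms] by blast
  have "q \<noteq> p" using dim by auto
  moreover have "q \<noteq> p + d + e"
  proof
    assume q: "q = p + d + e"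
    define c where "c = p + (1/2) *\<^sub>R d + (1/2) *\<^sub>R e"
    have "c = midpoint p q"
      unfolding q c_def midpoint_def by (simp add: field_simps scaleR_conv_of_real)
    then have "c \<in> closed_segment p q" by simp
    moreover have "c = midpoint (p + d) (p + e)"
      unfolding q c_def midpoint_def by (simp add: field_simps scaleR_conv_of_real)
    then have "c \<in> open_segment (p + d) (p + e)" using r by simp
    ultimately have "p + d \<in> closed_segment p q"
      using f r parallelogram_corners unfolding face_of_def by blast
    then obtain u where "p + d = (1 - u) *\<^sub>R p + u *\<^sub>R q" by (auto simp: in_segment)
    then have "1 *\<^sub>R d + 0 *\<^sub>R e = u *\<^sub>R d + u *\<^sub>R e" unfolding q by (simp add: algebra_simps)
    from unit_coords_unique[OF _ _ _ _ this] r show False by auto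
  qed
  ultimately show "q = p + d \<or> q = p + e" using q by blast
qed

lemma rhombus_at_diameter:
  assumes "rhombus_at T p d e" "x \<in> T" "y \<in> T"
  shows "dist x y \<le> 2"
proof -
  note r = assms(1)[unfolded rhombus_at_def]
  from assms(2) r obtain s t where st: "x = p + s *\<^sub>R d + t *\<^sub>R e" "0 \<le> s" "s \<le> 1" "0 \<le> t" "t \<le> 1"
    unfolding parallelogram_def by blast
  from assms(3) r obtain s' t' where st': "y = p + s' *\<^sub>R d + t' *\<^sub>R e" "0 \<le> s'" "s' \<le> 1" "0 \<le> t'" "t' \<le> 1"
    unfolding parallelogram_def by blast
  have "x - y = (s - s') *\<^sub>R d + (t - t') *\<^sub>R e" by (simp add: st(1) st'(1) algebra_simps)
  then have "norm (x - y) \<le> \<bar>s - s'\<bar> + \<bar>t - t'\<bar>"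
    using norm_triangle_ineq[of "(s - s') *\<^sub>R d" "(t - t') *\<^sub>R e"] r by simp
  then show ?thesis using st st' by (simp add: dist_norm)
qed

lemma uniformly_discrete_bounded_finite:
  fixes C :: "complex set"
  assumes "bounded C" "r > 0" "\<And>x y. x \<in> C \<Longrightarrow> y \<in> C \<Longrightarrow> x \<noteq> y \<Longrightarrow> r \<le> dist x y"
  shows "finite C"
proof (rule ccontr)
  assume "infinite C"
  then obtain l where l: "l islimpt C"
    using assms(1) bounded_infinite_imp_islimpt by blast
  then obtain y where y: "y \<in> C" "y \<noteq> l" "dist y l < r / 2"
    using assms(2) by (meson half_gt_zero islimpt_approachable)
  obtain w where w: "w \<in> C" "w \<noteq> l" "dist w l < dist y l"
    using l y(2) by (meson islimpt_approachable zero_less_dist_iff)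
  have "dist y w < r" using y w dist_triangle_half_l[of y l r w] by (simp add: dist_commute)
  moreover have "y \<noteq> w" using w by auto
  ultimately show False using assms(3)[of y w] y w by auto
qed

section \<open>Rhombic tilings\<close>

locale rhombic_tiling =
  fixes \<Lambda> :: "complex set set"
  assumes tiling: "rhombic_lattice \<Lambda>"
begin

lemma tile_rhombus: "T \<in> \<Lambda> \<Longrightarrow> unit_rhombus T"
  and tiles_congruent: "T \<in> \<Lambda> \<Longrightarrow> T' \<in> \<Lambda> \<Longrightarrow> congruent_tiles T T'"
  and tiles_cover: "\<exists>T\<in>\<Lambda>. x \<in> T"
  and tiles_disjoint: "T \<in> \<Lambda> \<Longrightarrow> T' \<in> \<Lambda> \<Longrightarrow> T \<noteq> T' \<Longrightarrow> interior T \<inter> interior T' = {}"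
  and tiles_Int_face: "T \<in> \<Lambda> \<Longrightarrow> T' \<in> \<Lambda> \<Longrightarrow> T \<inter> T' face_of T"
  using tiling unfolding rhombic_lattice_def by auto

lemma tile_convex: "T \<in> \<Lambda> \<Longrightarrow> convex T"
  and tile_compact: "T \<in> \<Lambda> \<Longrightarrow> compact T"
  using tile_rhombus unit_rhombus_rhombus_at rhombus_at_convex rhombus_at_compact by blast+

lemma tile_corner:
  assumes "T \<in> \<Lambda>" "v extreme_point_of T"
  obtains d e where "rhombus_at T v d e"
  using rhombus_at_any_corner[OF tile_rhombus] assms by blast

text \<open>
  Congruent tiles contain disks of one common radius. Hence only finitely many tiles come near a
  given point.
\<close>
lemma tiles_inballs:
  obtains r c where "r > 0" "\<And>T. T \<in> \<Lambda> \<Longrightarrow> ball (c T) r \<subseteq> T"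
proof -
  obtain T0 where T0: "T0 \<in> \<Lambda>" using tiles_cover by blast
  then obtain p d e where "rhombus_at T0 p d e" using tile_rhombus unit_rhombus_rhombus_at by blast
  then obtain c0 where "c0 \<in> interior T0" using rhombus_at_centre_interior by blast
  then obtain r where r: "r > 0" "ball c0 r \<subseteq> T0" by (meson mem_interior)
  have "\<exists>c. ball c r \<subseteq> T" if T: "T \<in> \<Lambda>" for T
  proof -
    from tiles_congruent[OF T0 T] obtain h
      where h: "\<And>x y. dist (h x) (h y) = dist x y" "h ` T0 = T"
      unfolding congruent_tiles_def by blast
    \<comment> \<open>an isometry is an orthogonal map followed by a translation, so it maps disks onto disks\<close>
    define k where "k = (\<lambda>x. h x - h 0)"
    have "orthogonal_transformation k"
      unfolding orthogonal_transformation_isometry k_def using h(1) by (simp add: dist_norm)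
    then have "k ` ball c0 r = ball (k c0) r" by (rule image_orthogonal_transformation_ball)
    moreover have "h ` ball c0 r = (+) (h 0) ` k ` ball c0 r"
      by (simp add: image_image k_def)
    ultimately have "h ` ball c0 r = ball (h 0 + k c0) r"
      by (metis ball_translation)
    then show ?thesis using r(2) h(2) by blast
  qed
  then obtain c where "\<And>T. T \<in> \<Lambda> \<Longrightarrow> ball (c T) r \<subseteq> T" by metis
  with r(1) show ?thesis using that by blast
qed

lemma finite_tiles_near: "finite {T \<in> \<Lambda>. T \<inter> ball x 1 \<noteq> {}}"
proof -
  obtain r c where r: "r > 0" and c: "\<And>T. T \<in> \<Lambda> \<Longrightarrow> ball (c T) r \<subseteq> T"
    using tiles_inballs by blast
  define F where "F = {T \<in> \<Lambda>. T \<inter> ball x 1 \<noteq> {}}"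
  have sep: "r \<le> dist (c T) (c T')" if T: "T \<in> \<Lambda>" "T' \<in> \<Lambda>" "T \<noteq> T'" for T T'
  proof (rule ccontr)
    assume "\<not> r \<le> dist (c T) (c T')"
    then have "c T' \<in> ball (c T) r" by simp
    then have "c T' \<in> interior T" using c[OF T(1)] by (meson interior_maximal open_ball subsetD)
    moreover have "c T' \<in> interior T'"
      using c[OF T(2)] r by (meson interior_maximal open_ball subsetD centre_in_ball)
    ultimately show False using tiles_disjoint T by blast
  qed
  have "inj_on c F"
    using sep r unfolding F_def inj_on_def by fastforce
  moreover have "finite (c ` F)"
  proof (rule uniformly_discrete_bounded_finite[OF _ r])
    have "c T \<in> cball x 3" if "T \<in> F" for T
    proof -
      from that obtain y where y: "y \<in> T" "dist x y < 1" and T: "T \<in> \<Lambda>" by (auto simp: F_def)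
      have "c T \<in> T" using c[OF T] r by auto
      then have "dist y (c T) \<le> 2"
        using y T tile_rhombus unit_rhombus_rhombus_at rhombus_at_diameter by blast
      then show ?thesis using y dist_triangle[of x "c T" y] by simp
    qed
    then show "bounded (c ` F)" by (meson bounded_cball bounded_subset image_subsetI)
  qed (use sep F_def in auto)
  ultimately show ?thesis unfolding F_def using finite_imageD by blast
qed

lemma tiles_locally_finite:
  obtains \<delta> where "\<delta> > 0" "\<And>T. T \<in> \<Lambda> \<Longrightarrow> T \<inter> ball x \<delta> \<noteq> {} \<Longrightarrow> x \<in> T"
proof -
  define F where "F = {T \<in> \<Lambda>. T \<inter> ball x 1 \<noteq> {} \<and> x \<notin> T}"
  have "finite F"
    using finite_tiles_near[of x] by (rule rev_finite_subset) (auto simp: F_def)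
  then have "closed (\<Union>F)"
    using tile_compact by (intro closed_Union) (auto simp: F_def intro: compact_imp_closed)
  then have "open (ball x 1 - \<Union>F)" by (intro open_Diff) auto
  moreover have "x \<in> ball x 1 - \<Union>F" by (auto simp: F_def)
  ultimately obtain \<delta> where "\<delta> > 0" "ball x \<delta> \<subseteq> ball x 1 - \<Union>F" by (meson openE)
  moreover from this(2) have "x \<in> T" if "T \<in> \<Lambda>" "T \<inter> ball x \<delta> \<noteq> {}" for T
    using that by (fastforce simp: F_def)
  ultimately show ?thesis using that by blast
qed

text \<open>
  All tiles through a point \<open>x\<close> have a common vertex: any vertex of the smallest face containing
  \<open>x\<close> of one of these tiles.
\<close>
lemma common_vertex: "\<exists>v. \<forall>T\<in>\<Lambda>. x \<in> T \<longrightarrow> v extreme_point_of T"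
proof -
  obtain T where T: "T \<in> \<Lambda>" "x \<in> T" using tiles_cover by blast
  define F where "F = \<Inter>{G. G face_of T \<and> x \<in> G}"
  have "{G. G face_of T \<and> x \<in> G} \<noteq> {}"
    using face_of_refl[OF tile_convex[OF T(1)]] T(2) by blast
  then have F: "F face_of T" unfolding F_def by (rule face_of_Inter) auto
  have "x \<in> F" by (auto simp: F_def)
  moreover have "compact F" "convex F"
    using F T face_of_imp_compact face_of_imp_convex tile_compact tile_convex by blast+
  ultimately obtain v where v: "v extreme_point_of F"
    using extreme_point_exists_convex by blast
  have "v extreme_point_of T'" if T': "T' \<in> \<Lambda>" "x \<in> T'" for T'
  proof -
    have f: "T \<inter> T' face_of T" using T T' tiles_Int_face by blast
    then have "F \<subseteq> T \<inter> T'" unfolding F_def using T T' by blast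
    then have "v extreme_point_of (T \<inter> T')"
      using extreme_point_of_face[OF F] extreme_point_of_face[OF f] v by blast
    then show ?thesis
      using extreme_point_of_face[of "T \<inter> T'" T'] tiles_Int_face[of T' T] T T' by (simp add: Int_commute)
  qed
  then show ?thesis by blast
qed

text \<open>
  Two vertices common to distinct tiles bound an edge. Were they opposite corners, the common face
  would contain the centre of a tile and therefore be the whole tile.
\<close>
lemma shared_vertices_edge:
  assumes T: "T \<in> \<Lambda>" "T' \<in> \<Lambda>" "T \<noteq> T'"
    and v: "v extreme_point_of T" "v extreme_point_of T'" "w extreme_point_of T" "w extreme_point_of T'"
    and "v \<noteq> w"
  shows "closed_segment v w edge_of T"
proof -
  obtain d e where r: "rhombus_at T v d e" using T(1) v(1) by (rule tile_corner)
  have sub: "closed_segment v w \<subseteq> T \<inter> T'"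
    using v convex_Int[OF T(1,2)[THEN tile_convex]]
    by (intro closed_segment_subset) (auto simp: extreme_point_of_def)
  have "w \<noteq> v + d + e"
  proof
    assume w: "w = v + d + e"
    define c where "c = v + (1/2) *\<^sub>R d + (1/2) *\<^sub>R e"
    have "c = midpoint v w"
      unfolding w c_def midpoint_def by (simp add: field_simps scaleR_conv_of_real)
    then have "c \<in> T \<inter> T'" using sub by (metis midpoint_in_closed_segment subsetD)
    moreover have ci: "c \<in> interior T" unfolding c_def using r by (rule rhombus_at_centre_interior)
    ultimately have "T \<inter> T' = T"
      using face_of_disjoint_interior[OF tiles_Int_face[OF T(1,2)]] by blast
    then have "interior T \<subseteq> interior T'" by (metis inf_le2 interior_mono)
    then show False using tiles_disjoint T ci by blast
  qed
  moreover have "w \<in> {v, v + d, v + e, v + d + e}" using rhombus_at_extreme_iff[OF r] v by blast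
  ultimately show ?thesis using rhombus_at_edge_iff[OF r] \<open>v \<noteq> w\<close> by blast
qed

lemma edge_extreme:
  assumes "closed_segment v w edge_of T"
  shows "v extreme_point_of T" "w extreme_point_of T" "v \<noteq> w"
proof -
  have f: "closed_segment v w face_of T" and "aff_dim (closed_segment v w) = 1"
    using assms by (auto simp: edge_of_def)
  then show "v \<noteq> w" by auto
  show "v extreme_point_of T" "w extreme_point_of T"
    using extreme_point_of_face[OF f] by (auto simp: extreme_point_of_segment)
qed

abbreviation "V \<equiv> lattice_vertices \<Lambda>"
abbreviation "E \<equiv> lattice_edges \<Lambda>"

lemma edge_sym: "(a, b) \<in> E \<Longrightarrow> (b, a) \<in> E"
  by (auto simp: lattice_edges_def closed_segment_commute)

lemma edge_vertices: "(a, b) \<in> E \<Longrightarrow> a \<in> V \<and> b \<in> V \<and> a \<noteq> b"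
  unfolding lattice_edges_def lattice_vertices_def using edge_extreme by blast

lemma edge_tile:
  assumes "(a, b) \<in> E"
  obtains T where "T \<in> \<Lambda>" "a extreme_point_of T" "b extreme_point_of T"
  using assms unfolding lattice_edges_def using edge_extreme by blast

lemma edge_of_every_tile:
  assumes "T \<in> \<Lambda>" "v extreme_point_of T" "w extreme_point_of T" "(v, w) \<in> E"
  shows "closed_segment v w edge_of T"
proof -
  obtain T' where T': "T' \<in> \<Lambda>" "closed_segment v w edge_of T'"
    using assms(4) by (auto simp: lattice_edges_def)
  then show ?thesis
    using shared_vertices_edge[of T T' v w] edge_extreme[OF T'(2)] assms by blast
qed

lemma rhombus_edges:
  assumes "T \<in> \<Lambda>" "rhombus_at T p d e"
  shows "(p, p + d) \<in> E" "(p, p + e) \<in> E" "(p + d, p + d + e) \<in> E" "(p + e, p + d + e) \<in> E"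
proof -
  have e: "(p, p + d) \<in> E \<and> (p, p + e) \<in> E" if "rhombus_at T p d e" for p d e
    using that rhombus_at_edge_iff[OF that] assms(1) unfolding lattice_edges_def by blast
  from e[OF assms(2)] show "(p, p + d) \<in> E" "(p, p + e) \<in> E" by auto
  from e[OF rhombus_at_flip[OF assms(2)]] e[OF rhombus_at_flip2[OF assms(2)]]
  show "(p + d, p + d + e) \<in> E" "(p + e, p + d + e) \<in> E" by (auto simp: algebra_simps)
qed

lemma rhombus_edge_iff:
  assumes "T \<in> \<Lambda>" "rhombus_at T p d e" "q extreme_point_of T" "(p, q) \<in> E"
  shows "q = p + d \<or> q = p + e"
  using edge_of_every_tile[OF assms(1) rhombus_at_corner_extreme[OF assms(2)] assms(3,4)]
    rhombus_at_edge_iff[OF assms(2)] by blast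

end

section \<open>Flat transport along edges\<close>

text \<open>
  A transport assigns to each oriented edge \<open>(p, q)\<close> a bijection \<open>A p q\<close> of a fibre \<open>'x\<close>, inverse
  to \<open>A q p\<close>. It is flat if transporting from a corner of a tile to the opposite corner gives the
  same result along both sides of the tile. Since the plane is simply connected, a flat transport
  has a global section through any prescribed value (\<open>global_section\<close> below). The same
  statement serves for discrete integration, where \<open>A p q\<close> is a translation of the complex
  numbers, and for solving \<open>g - t Z_+ g = h\<close>, where it is an affine map.
\<close>

locale flat_transport = rhombic_tiling +
  fixes A :: "complex \<Rightarrow> complex \<Rightarrow> 'x \<Rightarrow> 'x"
  assumes transport_back: "(p, q) \<in> lattice_edges \<Lambda> \<Longrightarrow> A q p (A p q x) = x"
    and flat: "T \<in> \<Lambda> \<Longrightarrow> rhombus_at T p d e \<Longrightarrow>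
      A (p + d) (p + d + e) (A p (p + d) x) = A (p + e) (p + d + e) (A p (p + e) x)"
begin

text \<open>
  A section over a single tile is a family of values at its vertices compatible with the transport.
\<close>
definition tile_section :: "complex set \<Rightarrow> (complex \<Rightarrow> 'x) \<Rightarrow> bool" where
  "tile_section T s \<longleftrightarrow>
     (\<forall>p q. p extreme_point_of T \<and> q extreme_point_of T \<and> (p, q) \<in> E \<longrightarrow> s q = A p q (s p))"

lemma tile_section_exists:
  assumes T: "T \<in> \<Lambda>" and v: "v extreme_point_of T"
  obtains s where "tile_section T s" "s v = x"
proof -
  obtain d e where r: "rhombus_at T v d e" using T v by (rule tile_corner)
  have ne: "d \<noteq> 0" "e \<noteq> 0" "d \<noteq> e" "d + e \<noteq> 0" "d \<noteq> - e" "e + d \<noteq> 0"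
    using r by (auto simp: rhombus_at_def add_eq_0_iff2 add.commute)
  define s where "s = (\<lambda>w. if w = v then x else if w = v + d then A v (v + d) x
     else if w = v + e then A v (v + e) x else A (v + d) (v + d + e) (A v (v + d) x))"
  have s: "s v = x" "s (v + d) = A v (v + d) x" "s (v + e) = A v (v + e) x"
    "s (v + d + e) = A (v + d) (v + d + e) (A v (v + d) x)"
    using ne by (auto simp: s_def add.assoc)
  have s4: "s (v + d + e) = A (v + e) (v + d + e) (A v (v + e) x)"
    using s(4) flat[OF T r] by simp
  have rev_step: "s p = A q p (s q)" if "s q = A p q (s p)" "(p, q) \<in> E" for p q
    using that transport_back by simp
  note ed = rhombus_edges[OF T r]
  have "s q = A p q (s p)" if pq: "p extreme_point_of T" "q extreme_point_of T" "(p, q) \<in> E" for p q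
  proof -
    have p: "p \<in> {v, v + d, v + e, v + d + e}" using rhombus_at_extreme_iff[OF r] pq by blast
    moreover have "s q = A p q (s p)" if "p = v"
      using rhombus_edge_iff[OF T r pq(2)] pq(3) that s by auto
    moreover have "s q = A p q (s p)" if "p = v + d"
      using rhombus_edge_iff[OF T rhombus_at_flip[OF r] pq(2)] pq(3) that s rev_step[OF _ ed(1)] by auto
    moreover have "s q = A p q (s p)" if "p = v + e"
      using rhombus_edge_iff[OF T rhombus_at_flip2[OF r] pq(2)] pq(3) that s s4 rev_step[OF _ ed(2)]
      by (auto simp: add.assoc add.commute[of d e])
    moreover have "s q = A p q (s p)" if "p = v + d + e"
      using rhombus_edge_iff[OF T rhombus_at_flip3[OF r] pq(2)] pq(3) that s s4 rev_step[OF _ ed(3)]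
        rev_step[OF _ ed(4)] by (auto simp: add.assoc add.commute[of d e])
    ultimately show ?thesis by blast
  qed
  then have "tile_section T s" unfolding tile_section_def by blast
  then show ?thesis using that s(1) by blast
qed

lemma tile_section_unique:
  assumes T: "T \<in> \<Lambda>" and s: "tile_section T s" "tile_section T s'"
    and v: "v extreme_point_of T" "s v = s' v" and w: "w extreme_point_of T"
  shows "s w = s' w"
proof -
  obtain d e where r: "rhombus_at T v d e" using T v(1) by (rule tile_corner)
  note ext = rhombus_at_extreme_iff[OF r]
  note ed = rhombus_edges[OF T r]
  have step: "s q = s' q" if "s p = s' p" "p extreme_point_of T" "q extreme_point_of T" "(p, q) \<in> E" for p q
    using that s unfolding tile_section_def by metis
  have "s (v + d) = s' (v + d)" using step[of v "v + d"] v ed ext by blast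
  moreover have "s (v + e) = s' (v + e)" using step[of v "v + e"] v ed ext by blast
  moreover have "s (v + d + e) = s' (v + d + e)" using step[of "v + d" "v + d + e"] calculation ed ext by blast
  moreover have "w \<in> {v, v + d, v + e, v + d + e}" using w ext by blast
  ultimately show ?thesis using v(2) by auto
qed

lemma tile_sections_agree:
  assumes T: "T \<in> \<Lambda>" "T' \<in> \<Lambda>" and s: "tile_section T s" "tile_section T' s'"
    and v: "v extreme_point_of T" "v extreme_point_of T'" "s v = s' v"
    and w: "w extreme_point_of T" "w extreme_point_of T'"
  shows "s w = s' w"
proof (cases "T = T' \<or> v = w")
  case True
  then show ?thesis using tile_section_unique assms by blast
next
  case False
  then have "(v, w) \<in> E"
    using shared_vertices_edge[of T T' v w] T v w unfolding lattice_edges_def by blast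
  then show ?thesis using s v w unfolding tile_section_def by metis
qed

definition meets :: "complex set \<Rightarrow> complex set \<Rightarrow> bool" where
  "meets T R \<longleftrightarrow> T \<in> \<Lambda> \<and> T \<inter> R \<noteq> {}"

text \<open>
  A section over a set \<open>R\<close> of points of the plane assigns a tile section to each tile meeting \<open>R\<close>,
  such that tiles with a common point in \<open>R\<close> have the same values at their common vertices. The
  sections are indexed by tiles and not by vertices, because two tiles may share a vertex outside \<open>R\<close>
  without having a common point in \<open>R\<close>; sections over overlapping sets could then not be glued.
\<close>
definition section_on :: "complex set \<Rightarrow> (complex set \<Rightarrow> complex \<Rightarrow> 'x) \<Rightarrow> bool" where
  "section_on R s \<longleftrightarrow> (\<forall>T. meets T R \<longrightarrow> tile_section T (s T)) \<and>
     (\<forall>T\<in>\<Lambda>. \<forall>T'\<in>\<Lambda>. T \<inter> T' \<inter> R \<noteq> {} \<longrightarrow>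
        (\<forall>v. v extreme_point_of T \<and> v extreme_point_of T' \<longrightarrow> s T v = s T' v))"

lemma section_on_tile: "section_on R s \<Longrightarrow> T \<in> \<Lambda> \<Longrightarrow> x \<in> T \<Longrightarrow> x \<in> R \<Longrightarrow> tile_section T (s T)"
  unfolding section_on_def meets_def by blast

lemma section_on_agree:
  "section_on R s \<Longrightarrow> T \<in> \<Lambda> \<Longrightarrow> T' \<in> \<Lambda> \<Longrightarrow> x \<in> T \<Longrightarrow> x \<in> T' \<Longrightarrow> x \<in> R \<Longrightarrow>
    v extreme_point_of T \<Longrightarrow> v extreme_point_of T' \<Longrightarrow> s T v = s T' v"
  unfolding section_on_def by blast

lemma section_on_mono: "section_on R s \<Longrightarrow> R' \<subseteq> R \<Longrightarrow> section_on R' s"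
  unfolding section_on_def meets_def by blast

lemma section_on_unique:
  assumes "connected R" and s: "section_on R s" "section_on R s'"
    and T0: "meets T0 R" "v0 extreme_point_of T0" "s T0 v0 = s' T0 v0"
    and T: "meets T R" "v extreme_point_of T"
  shows "s T v = s' T v"
proof -
  \<comment> \<open>the two sections agree at all tiles through the point \<open>x\<close>; a locally constant property\<close>
  define agree where "agree x \<longleftrightarrow> (\<forall>T\<in>\<Lambda>. x \<in> T \<longrightarrow> (\<forall>v. v extreme_point_of T \<longrightarrow> s T v = s' T v))" for x
  have one: "agree x" if x: "x \<in> R" and T: "T \<in> \<Lambda>" "x \<in> T" "v extreme_point_of T" "s T v = s' T v" for x T v
  proof -
    obtain c where c: "\<And>T. T \<in> \<Lambda> \<Longrightarrow> x \<in> T \<Longrightarrow> c extreme_point_of T" using common_vertex by blast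
    have ts: "tile_section T (s T)" "tile_section T (s' T)" if "T \<in> \<Lambda>" "x \<in> T" for T
      using section_on_tile s x that by blast+
    have "s T c = s' T c" using tile_section_unique[OF T(1) ts[OF T(1,2)] T(3,4)] c T by blast
    then have "s T' c = s' T' c" if "T' \<in> \<Lambda>" "x \<in> T'" for T'
      using section_on_agree[OF s(1) T(1) that(1) T(2) that(2) x c c]
        section_on_agree[OF s(2) T(1) that(1) T(2) that(2) x c c] T that by simp
    then show ?thesis unfolding agree_def using tile_section_unique ts c by blast
  qed
  obtain x0 where x0: "x0 \<in> T0" "x0 \<in> R" using T0 by (auto simp: meets_def)
  obtain x where x: "x \<in> T" "x \<in> R" using T by (auto simp: meets_def)
  have "agree x"
  proof (rule connected_induction_simple[OF assms(1) x0(2) x(2)])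
    show "agree x0" using one x0 T0 by (auto simp: meets_def)
    fix a assume "a \<in> R"
    obtain \<delta> where d: "\<delta> > 0" "\<And>T. T \<in> \<Lambda> \<Longrightarrow> T \<inter> ball a \<delta> \<noteq> {} \<Longrightarrow> a \<in> T"
      using tiles_locally_finite by blast
    have iff: "agree y \<longleftrightarrow> agree a" if y: "y \<in> R \<inter> ball a \<delta>" for y
    proof -
      obtain T where T: "T \<in> \<Lambda>" "y \<in> T" using tiles_cover by blast
      have "a \<in> T" using d(2) T y by blast
      obtain v where "v extreme_point_of T" using T tile_compact tile_convex extreme_point_exists_convex
        by (metis empty_iff)
      then show ?thesis using one[of _ T v] T y \<open>a \<in> T\<close> \<open>a \<in> R\<close> unfolding agree_def by blast
    qed
    show "\<exists>U. openin (top_of_set R) U \<and> a \<in> U \<and> (\<forall>x\<in>U. \<forall>y\<in>U. agree x \<longrightarrow> agree y)"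
    proof (intro exI conjI ballI)
      show "openin (top_of_set R) (R \<inter> ball a \<delta>)" by (simp add: openin_open_Int)
      show "a \<in> R \<inter> ball a \<delta>" using \<open>a \<in> R\<close> d by simp
    qed (use iff in blast)
  qed
  then show ?thesis using x T unfolding agree_def meets_def by blast
qed

text \<open>
  \<open>R\<close> is sectionable if every value at a vertex of a tile meeting \<open>R\<close> extends to a section over \<open>R\<close>.
\<close>
definition sectionable :: "complex set \<Rightarrow> bool" where
  "sectionable R \<longleftrightarrow> (\<forall>T v x. meets T R \<and> v extreme_point_of T \<longrightarrow> (\<exists>s. section_on R s \<and> s T v = x))"

lemma sectionable_local:
  obtains \<delta> where "\<delta> > 0" "\<And>R. R \<subseteq> ball y \<delta> \<Longrightarrow> sectionable R"
proof -
  obtain \<delta> where d: "\<delta> > 0" "\<And>T. T \<in> \<Lambda> \<Longrightarrow> T \<inter> ball y \<delta> \<noteq> {} \<Longrightarrow> y \<in> T"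
    using tiles_locally_finite by blast
  obtain c where c: "\<And>T. T \<in> \<Lambda> \<Longrightarrow> y \<in> T \<Longrightarrow> c extreme_point_of T" using common_vertex by blast
  have "sectionable R" if R: "R \<subseteq> ball y \<delta>" for R
    unfolding sectionable_def
  proof (intro allI impI, elim conjE)
    fix T0 v x assume T0: "meets T0 R" and v: "v extreme_point_of T0"
    have near: "T \<in> \<Lambda> \<and> c extreme_point_of T" if "meets T R" for T
      using that d(2) c R unfolding meets_def by blast
    obtain s0 where s0: "tile_section T0 s0" "s0 v = x"
      using tile_section_exists v near[OF T0] by metis
    have "\<exists>s. tile_section T s \<and> s c = s0 c" if "meets T R" for T
      using tile_section_exists near[OF that] by metis
    then obtain s where s: "\<And>T. meets T R \<Longrightarrow> tile_section T (s T) \<and> s T c = s0 c" by metis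
    have "section_on R s"
      unfolding section_on_def
    proof (intro conjI allI impI ballI)
      show "tile_section T (s T)" if "meets T R" for T using s that by blast
      fix T T' w assume T: "T \<in> \<Lambda>" "T' \<in> \<Lambda>" "T \<inter> T' \<inter> R \<noteq> {}"
        and w: "w extreme_point_of T \<and> w extreme_point_of T'"
      have m: "meets T R" "meets T' R" using T unfolding meets_def by blast+
      show "s T w = s T' w"
        using tile_sections_agree[of T T' "s T" "s T'" c w] T s m near w by auto
    qed
    moreover have "s T0 v = x"
      using tile_section_unique[of T0 "s T0" s0 c v] s s0 T0 near v by auto
    ultimately show "\<exists>s. section_on R s \<and> s T0 v = x" by blast
  qed
  then show ?thesis using that d by blast
qed

text \<open>
  Gluing. By convexity a tile that meets both parts meets their intersection, where the two sections
  agree by uniqueness.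
\<close>
lemma sectionable_Un:
  assumes R: "sectionable R1" "sectionable R2" and cl: "closed R1" "closed R2"
    and conv: "convex (R1 \<union> R2)" and con: "connected (R1 \<inter> R2)" "R1 \<inter> R2 \<noteq> {}"
  shows "sectionable (R1 \<union> R2)"
proof -
  have ex: "\<exists>s. section_on (R1 \<union> R2) s \<and> s T0 v = x"
    if T0: "meets T0 R1" "v extreme_point_of T0"
      and R: "sectionable R1" "sectionable R2" and cl: "closed R1" "closed R2"
      and conv: "convex (R1 \<union> R2)" and con: "connected (R1 \<inter> R2)" "R1 \<inter> R2 \<noteq> {}"
    for T0 v x R1 R2
  proof -
    have both: "meets T (R1 \<inter> R2)" if "meets T R1" "meets T R2" for T
    proof (rule ccontr)
      assume n: "\<not> meets T (R1 \<inter> R2)"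
      have T: "T \<in> \<Lambda>" using that by (simp add: meets_def)
      have "connected (T \<inter> (R1 \<union> R2))"
        by (intro convex_connected convex_Int tile_convex T conv)
      moreover have "closed (T \<inter> R1)" "closed (T \<inter> R2)"
        using cl tile_compact[OF T] by (auto intro: compact_imp_closed)
      ultimately show False
        using n that T unfolding connected_closed meets_def by blast
    qed
    obtain s1 where s1: "section_on R1 s1" "s1 T0 v = x"
      using R(1) T0 unfolding sectionable_def by blast
    obtain y where y: "y \<in> R1" "y \<in> R2" using con by blast
    obtain T1 where T1: "T1 \<in> \<Lambda>" "y \<in> T1" using tiles_cover by blast
    obtain v1 where v1: "v1 extreme_point_of T1"
      using T1 tile_compact tile_convex extreme_point_exists_convex by (metis empty_iff)
    have m1: "meets T1 R1" "meets T1 R2" "meets T1 (R1 \<inter> R2)" using T1 y unfolding meets_def by blast+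
    obtain s2 where s2: "section_on R2 s2" "s2 T1 v1 = s1 T1 v1"
      using R(2) m1 v1 unfolding sectionable_def by blast
    have agree: "s1 T w = s2 T w" if "meets T R1" "meets T R2" "w extreme_point_of T" for T w
    proof (rule section_on_unique[OF con(1) _ _ m1(3) v1])
      show "section_on (R1 \<inter> R2) s1" "section_on (R1 \<inter> R2) s2"
        using s1 s2 section_on_mono by blast+
    qed (use s2 both that in auto)
    define s where "s T = (if meets T R1 then s1 T else s2 T)" for T
    have sv: "s T w = s2 T w" if "meets T R2" "w extreme_point_of T" for T w
      using agree that by (simp add: s_def)
    have "section_on (R1 \<union> R2) s"
      unfolding section_on_def
    proof (intro conjI allI impI ballI)
      show "tile_section T (s T)" if "meets T (R1 \<union> R2)" for T
        using that s1 s2 unfolding section_on_def s_def meets_def by auto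
      fix T T' w assume T: "T \<in> \<Lambda>" "T' \<in> \<Lambda>" "T \<inter> T' \<inter> (R1 \<union> R2) \<noteq> {}"
        and w: "w extreme_point_of T \<and> w extreme_point_of T'"
      then obtain z where z: "z \<in> T" "z \<in> T'" "z \<in> R1 \<or> z \<in> R2" by blast
      show "s T w = s T' w"
      proof (cases "z \<in> R1")
        case True
        then have "meets T R1" "meets T' R1" using T z unfolding meets_def by blast+
        then show ?thesis using section_on_agree[OF s1(1) T(1,2) z(1,2) True] w by (simp add: s_def)
      next
        case False
        with z have z2: "z \<in> R2" by blast
        then have "meets T R2" "meets T' R2" using T z unfolding meets_def by blast+
        then show ?thesis using section_on_agree[OF s2(1) T(1,2) z(1,2) z2] w sv by simp
      qed
    qed
    moreover have "s T0 v = x" using T0 s1 by (simp add: s_def)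
    ultimately show ?thesis by blast
  qed
  show ?thesis
    unfolding sectionable_def
  proof (intro allI impI, elim conjE)
    fix T v x assume T: "meets T (R1 \<union> R2)" and v: "v extreme_point_of T"
    then consider "meets T R1" | "meets T R2" unfolding meets_def by blast
    then show "\<exists>s. section_on (R1 \<union> R2) s \<and> s T v = x"
    proof cases
      case 1
      then show ?thesis using ex assms v by blast
    next
      case 2
      then show ?thesis using ex[of T R2 v R1 x] assms v by (simp add: Un_commute Int_commute)
    qed
  qed
qed

end

text \<open>
  The closed rectangle with sides \<open>[a, b]\<close> and \<open>[c, d]\<close>.
\<close>
definition rect :: "real \<Rightarrow> real \<Rightarrow> real \<Rightarrow> real \<Rightarrow> complex set" where
  "rect a b c d = cbox (Complex a c) (Complex b d)"

lemma in_rect: "z \<in> rect a b c d \<longleftrightarrow> a \<le> Re z \<and> Re z \<le> b \<and> c \<le> Im z \<and> Im z \<le> d"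
  by (auto simp: rect_def in_cbox_complex_iff)

lemma closed_rect: "closed (rect a b c d)" and convex_rect: "convex (rect a b c d)"
  by (simp_all add: rect_def closed_cbox convex_box)

lemma rect_Un_Re: "a \<le> m \<Longrightarrow> m \<le> b \<Longrightarrow> rect a m c d \<union> rect m b c d = rect a b c d"
  and rect_Int_Re: "a \<le> m \<Longrightarrow> m \<le> b \<Longrightarrow> rect a m c d \<inter> rect m b c d = rect m m c d"
  and rect_Un_Im: "c \<le> m \<Longrightarrow> m \<le> d \<Longrightarrow> rect a b c m \<union> rect a b m d = rect a b c d"
  and rect_Int_Im: "c \<le> m \<Longrightarrow> m \<le> d \<Longrightarrow> rect a b c m \<inter> rect a b m d = rect a b m m"
  by (auto simp: in_rect)

lemma rect_nonempty: "a \<le> b \<Longrightarrow> c \<le> d \<Longrightarrow> rect a b c d \<noteq> {}"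
  using in_rect[of "Complex a c" a b c d] by fastforce

context flat_transport
begin

lemma sectionable_rect_Re:
  assumes "a \<le> m" "m \<le> b" "c \<le> d" "sectionable (rect a m c d)" "sectionable (rect m b c d)"
  shows "sectionable (rect a b c d)"
  using sectionable_Un[OF assms(4,5)] assms(1-3)
  by (simp add: rect_Un_Re rect_Int_Re closed_rect convex_rect rect_nonempty convex_connected)

lemma sectionable_rect_Im:
  assumes "c \<le> m" "m \<le> d" "a \<le> b" "sectionable (rect a b c m)" "sectionable (rect a b m d)"
  shows "sectionable (rect a b c d)"
  using sectionable_Un[OF assms(4,5)] assms(1-3)
  by (simp add: rect_Un_Im rect_Int_Im closed_rect convex_rect rect_nonempty convex_connected)

text \<open>
  Thin strips and then rectangles are sectionable by a bisection argument, first in the horizontal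
  and then in the vertical direction.
\<close>
lemma sectionable_strip:
  assumes "a \<le> b"
  shows "\<exists>\<epsilon>>0. \<forall>c d. c \<le> y \<and> y \<le> d \<and> d - c < \<epsilon> \<longrightarrow> sectionable (rect a b c d)"
  using assms
proof (induction rule: Bolzano)
  case (trans a m b)
  then obtain \<epsilon> \<epsilon>' where e: "\<epsilon> > 0" "\<forall>c d. c \<le> y \<and> y \<le> d \<and> d - c < \<epsilon> \<longrightarrow> sectionable (rect a m c d)"
    "\<epsilon>' > 0" "\<forall>c d. c \<le> y \<and> y \<le> d \<and> d - c < \<epsilon>' \<longrightarrow> sectionable (rect m b c d)" by blast
  have "sectionable (rect a b c d)" if "c \<le> y" "y \<le> d" "d - c < min \<epsilon> \<epsilon>'" for c d
    using sectionable_rect_Re[of a m b c d] trans e that by auto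
  then show ?case using e by (intro exI[of _ "min \<epsilon> \<epsilon>'"]) auto
next
  case (local x)
  obtain \<delta> where d: "\<delta> > 0" "\<And>R. R \<subseteq> ball (Complex x y) \<delta> \<Longrightarrow> sectionable R"
    using sectionable_local[of "Complex x y"] by blast
  have "sectionable (rect a b c d)"
    if "a \<le> x" "x \<le> b" "b - a < \<delta> / 2" "c \<le> y" "y \<le> d" "d - c < \<delta> / 2" for a b c d
  proof (rule d(2), rule subsetI)
    fix z assume z: "z \<in> rect a b c d"
    have "norm (Complex x y - z) \<le> \<bar>x - Re z\<bar> + \<bar>y - Im z\<bar>"
      using cmod_le[of "Complex x y - z"] by simp
    also have "\<dots> < \<delta>" using z that by (auto simp: in_rect)
    finally show "z \<in> ball (Complex x y) \<delta>" by (simp add: dist_norm)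
  qed
  then have "\<exists>\<epsilon>>0. \<forall>c d. c \<le> y \<and> y \<le> d \<and> d - c < \<epsilon> \<longrightarrow> sectionable (rect a b c d)"
    if "a \<le> x" "x \<le> b" "b - a < \<delta> / 2" for a b
    using d(1) that by (meson half_gt_zero)
  then show ?case using d(1) by (meson half_gt_zero)
qed

lemma sectionable_rect:
  assumes "a \<le> b" "c \<le> d"
  shows "sectionable (rect a b c d)"
  using assms(2)
proof (induction rule: Bolzano)
  case (trans c m d)
  then show ?case using sectionable_rect_Im assms(1) by blast
next
  case (local y)
  then show ?case using sectionable_strip[OF assms(1), of y] by blast
qed

text \<open>
  The sections over an increasing sequence of squares extend each other by uniqueness, hence define a
  function on all vertices.
\<close>
theorem global_section:
  assumes "v0 \<in> V"
  obtains S where "\<And>p q. (p, q) \<in> E \<Longrightarrow> S q = A p q (S p)" "S v0 = x"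
proof -
  obtain T0 where T0: "T0 \<in> \<Lambda>" "v0 extreme_point_of T0"
    using assms by (auto simp: lattice_vertices_def)
  define k where "k = norm v0"
  define Q where "Q n = rect (- (k + real n)) (k + real n) (- (k + real n)) (k + real n)" for n
  have Qmono: "Q n \<subseteq> Q m" if "n \<le> m" for n m
    using that by (auto simp: Q_def in_rect)
  have inQ: "v \<in> Q n" if "norm v \<le> k + real n" for v n
    using that abs_Re_le_cmod[of v] abs_Im_le_cmod[of v] unfolding Q_def in_rect by linarith
  have v0Q: "v0 \<in> Q n" for n by (rule inQ) (simp add: k_def)
  have v0T: "v0 \<in> T0" using T0 by (simp add: extreme_point_of_def)
  have m0: "meets T0 (Q n)" for n using T0 v0Q v0T unfolding meets_def by blast
  have "sectionable (Q n)" for n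
    unfolding Q_def by (rule sectionable_rect) (auto simp: k_def)
  then have "\<exists>s. section_on (Q n) s \<and> s T0 v0 = x" for n
    using m0 T0 unfolding sectionable_def by blast
  then obtain s where s: "\<And>n. section_on (Q n) (s n)" "\<And>n. s n T0 v0 = x" by metis
  have coh: "s n T v = s m T v" if "meets T (Q n)" "n \<le> m" "v extreme_point_of T" for n m T v
    by (rule section_on_unique[OF _ s(1) section_on_mono[OF s(1) Qmono[OF that(2)]] m0 T0(2) _ that(1,3)])
      (auto simp: Q_def s(2) convex_rect convex_connected)
  \<comment> \<open>the vertex \<open>v\<close> lies in the square \<open>Q n\<close> as soon as \<open>N v \<le> n\<close>\<close>
  define N where "N v = nat \<lceil>norm v\<rceil>" for v :: complex
  have NQ: "v \<in> Q n" if "N v \<le> n" for v n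
  proof (rule inQ)
    have "norm v \<le> real (N v)" unfolding N_def by (rule real_nat_ceiling_ge)
    also have "\<dots> \<le> real n" using that by simp
    finally show "norm v \<le> k + real n" by (simp add: k_def add_increasing)
  qed
  define tl where "tl v = (SOME T. T \<in> \<Lambda> \<and> v extreme_point_of T)" for v
  define S where "S v = s (N v) (tl v) v" for v
  have S: "S v = s n T v" if T: "T \<in> \<Lambda>" "v extreme_point_of T" and n: "N v \<le> n" for v n T
  proof -
    have tl: "tl v \<in> \<Lambda>" "v extreme_point_of tl v"
      using someI[of "\<lambda>T. T \<in> \<Lambda> \<and> v extreme_point_of T" T] T unfolding tl_def by auto
    have in_tile: "v \<in> T" "v \<in> tl v" using T tl by (auto simp: extreme_point_of_def)
    have "meets (tl v) (Q (N v))" using tl in_tile NQ[of v "N v"] unfolding meets_def by blast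
    then have "S v = s n (tl v) v" unfolding S_def using coh n tl by blast
    also have "\<dots> = s n T v"
      by (rule section_on_agree[OF s(1) tl(1) T(1) in_tile(2,1) NQ[OF n] tl(2) T(2)])
    finally show ?thesis .
  qed
  have "S q = A p q (S p)" if pq: "(p, q) \<in> E" for p q
  proof -
    obtain T where T: "T \<in> \<Lambda>" "p extreme_point_of T" "q extreme_point_of T"
      using pq by (rule edge_tile)
    define n where "n = max (N p) (N q)"
    have "tile_section T (s n T)"
      using section_on_tile[OF s(1) T(1), of p n] T(2) NQ[of p n]
      by (auto simp: n_def extreme_point_of_def)
    then have "s n T q = A p q (s n T p)"
      using T pq unfolding tile_section_def by blast
    then show ?thesis using S[OF T(1,2), of n] S[OF T(1,3), of n] by (simp add: n_def)
  qed
  moreover have "S v0 = x" using S[OF T0, of "N v0"] s(2) by simp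
  ultimately show ?thesis using that by blast
qed

end

context rhombic_tiling
begin

text \<open>
  The edge graph is connected: for the trivial transport with fibre \<open>bool\<close>, the sections \<open>P\<close> and
  \<open>True\<close> agree everywhere as soon as they agree at one vertex.
\<close>
lemma lattice_connected:
  assumes "v0 \<in> V" "v \<in> V" and step: "\<And>p q. (p, q) \<in> E \<Longrightarrow> P p \<Longrightarrow> P q" and "P v0"
  shows "P v"
proof -
  interpret flat_transport \<Lambda> "\<lambda>p q (x::bool). x" by unfold_locales auto
  have "P p \<longleftrightarrow> P q" if "(p, q) \<in> E" for p q using step that edge_sym by blast
  then have "section_on UNIV (\<lambda>T. P)" "section_on UNIV (\<lambda>T v. True)"
    unfolding section_on_def tile_section_def by auto
  moreover obtain T0 where T0: "T0 \<in> \<Lambda>" "v0 extreme_point_of T0"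
    using assms by (auto simp: lattice_vertices_def)
  moreover obtain T where T: "T \<in> \<Lambda>" "v extreme_point_of T"
    using assms by (auto simp: lattice_vertices_def)
  moreover have "meets T0 UNIV" "meets T UNIV"
    using T T0 by (auto simp: meets_def extreme_point_of_def)
  ultimately show ?thesis
    using section_on_unique[OF connected_UNIV, of "\<lambda>T. P" "\<lambda>T v. True" T0 v0 T v] assms(4) by auto
qed

end

section \<open>Discrete analytic functions and the shift\<close>

lemma sum_telescope_pred: "(\<Sum>n\<in>{1..<Suc m}. g n - g (n - 1)) = g m - (g 0 :: 'a :: ab_group_add)"
  by (induction m) auto

lemma path_int_add: "path_int (\<lambda>z. f z + g z) zs = path_int f zs + path_int g zs"
  unfolding path_int_def sum.distrib[symmetric] by (intro sum.cong) (auto simp: field_simps)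

lemma path_int_cmult: "path_int (\<lambda>z. c * f z) zs = c * path_int f zs"
  unfolding path_int_def sum_distrib_left by (intro sum.cong) (auto simp: field_simps)

lemma Zplus_add: "Zplus \<Lambda> (\<lambda>z. f z + g z) = (\<lambda>z. Zplus \<Lambda> f z + Zplus \<Lambda> g z)"
  by (rule ext) (simp add: Zplus_def vertex_int_def path_int_add add_divide_distrib diff_divide_distrib)

lemma Zplus_cmult: "Zplus \<Lambda> (\<lambda>z. c * f z) = (\<lambda>z. c * Zplus \<Lambda> f z)"
  by (rule ext) (simp add: Zplus_def vertex_int_def path_int_cmult algebra_simps)

lemma Zplus_zero: "Zplus \<Lambda> (\<lambda>z. 0) = (\<lambda>z. 0)"
  using Zplus_cmult[of \<Lambda> 0 "\<lambda>z. 0"] by simp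

lemma Zplus_sum: "Zplus \<Lambda> (\<lambda>z. \<Sum>i\<in>I. f i z) = (\<lambda>z. \<Sum>i\<in>I. Zplus \<Lambda> (f i) z)"
  by (induction I rule: infinite_finite_induct) (simp_all add: Zplus_zero Zplus_add)

lemma Zplus_outside: "z \<notin> lattice_vertices \<Lambda> \<Longrightarrow> Zplus \<Lambda> f z = 0"
  by (simp add: Zplus_def)

lemma DA_outside: "f \<in> DA \<Lambda> \<Longrightarrow> z \<notin> lattice_vertices \<Lambda> \<Longrightarrow> f z = 0"
  by (simp add: DA_def)

lemma DA_add: "f \<in> DA \<Lambda> \<Longrightarrow> g \<in> DA \<Lambda> \<Longrightarrow> (\<lambda>z. f z + g z) \<in> DA \<Lambda>"
  by (simp add: DA_def path_int_add)

lemma DA_cmult: "f \<in> DA \<Lambda> \<Longrightarrow> (\<lambda>z. c * f z) \<in> DA \<Lambda>"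
  by (simp add: DA_def path_int_cmult)

lemma DA_zero: "(\<lambda>z. 0) \<in> DA \<Lambda>"
  by (simp add: DA_def path_int_def)

lemma DA_sum: "(\<And>i. i \<in> I \<Longrightarrow> f i \<in> DA \<Lambda>) \<Longrightarrow> (\<lambda>z. \<Sum>i\<in>I. f i z) \<in> DA \<Lambda>"
  by (induction I rule: infinite_finite_induct) (simp_all add: DA_zero DA_add)

text \<open>
  In the next three lemmas the indices 0, 1, 2, 12 stand for the corners \<open>p\<close>, \<open>p + d\<close>, \<open>p + e\<close> and
  \<open>p + d + e\<close> of a tile. They give the Cauchy-Riemann equation for \<open>Z_+ f\<close>, the flatness of the
  transport that solves \<open>g - t Z_+ g = h\<close>, and the Cauchy-Riemann equation for its solution.
\<close>
lemma cauchy_riemann_shift: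
  fixes f0 f1 f2 f12 F0 F1 F2 F12 d e :: complex
  assumes "(f1 - f2) * (d + e) = (f12 - f0) * (d - e)"
    and "2 * (F1 - F0) = f1 * (d - 1) + f0 * (d + 1)"
    and "2 * (F2 - F0) = f2 * (e - 1) + f0 * (e + 1)"
    and "2 * (F12 - F1) = f12 * (e - 1) + f1 * (e + 1)"
  shows "2 * ((F1 - F2) * (d + e)) = 2 * ((F12 - F0) * (d - e))"
proof -
  have "2 * ((F1 - F2) * (d + e)) - 2 * ((F12 - F0) * (d - e)) =
      (2 * (F1 - F0) - 2 * (F2 - F0)) * (d + e) - (2 * (F12 - F1) + 2 * (F1 - F0)) * (d - e)"
    by (simp add: algebra_simps)
  also have "\<dots> = (e - 1) * ((f1 - f2) * (d + e) - (f12 - f0) * (d - e))"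
    unfolding assms(2-4) by (simp add: algebra_simps)
  also have "\<dots> = 0" using assms(1) by simp
  finally show ?thesis by simp
qed

lemma cauchy_riemann_transport:
  fixes h0 h1 h2 h12 d e t :: complex
  assumes "(h1 - h2) * (d + e) = (h12 - h0) * (d - e)"
  shows "(2 + t * (1 + e)) * (h1 - h0) + (2 + t * (1 - d)) * (h12 - h1) =
    (2 + t * (1 + d)) * (h2 - h0) + (2 + t * (1 - e)) * (h12 - h2)" (is "?L = ?R")
proof -
  have "?L - ?R = t * ((h1 - h2) * (d + e) - (h12 - h0) * (d - e))"
    by (simp add: algebra_simps)
  then show ?thesis using assms by simp
qed

lemma transport_cauchy_riemann:
  fixes g0 g1 g2 g12 h0 h1 h2 h12 d e t :: complex
  assumes "(2 + t * (1 - d)) * g1 = (2 + t * (1 + d)) * g0 + 2 * (h1 - h0)"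
    and "(2 + t * (1 - e)) * g2 = (2 + t * (1 + e)) * g0 + 2 * (h2 - h0)"
    and "(2 + t * (1 - e)) * g12 = (2 + t * (1 + e)) * g1 + 2 * (h12 - h1)"
    and "(2 + t * (1 - d)) * g12 = (2 + t * (1 + d)) * g2 + 2 * (h12 - h2)"
  shows "t * ((g1 - g2) * (d + e)) = t * ((g12 - g0) * (d - e))"
proof -
  have "t * ((g12 - g0) * (d - e)) - t * ((g1 - g2) * (d + e)) =
      (2 + t * (1 - d)) * g1 + (2 + t * (1 - e)) * g12 - (2 + t * (1 - e)) * g2 - (2 + t * (1 - d)) * g12
      - (2 + t * (1 + d)) * g0 - (2 + t * (1 + e)) * g1 + (2 + t * (1 + e)) * g0 + (2 + t * (1 + d)) * g2"
    by (simp add: algebra_simps)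
  also have "\<dots> = 0" unfolding assms by (simp add: algebra_simps)
  finally show ?thesis by (simp only: right_minus_eq)
qed

locale admissible_tiling =
  fixes \<Lambda> :: "complex set set"
  assumes admissible: "admissible_lattice \<Lambda>"

sublocale admissible_tiling \<subseteq> rhombic_tiling \<Lambda>
  using admissible by unfold_locales (simp add: admissible_lattice_def)

context admissible_tiling
begin

lemma zero_vertex: "0 \<in> V"
  using admissible by (simp add: admissible_lattice_def)

text \<open>
  The vanishing of the discrete integral around a single tile, as a relation between the difference
  quotients along its two diagonals.
\<close>
definition cauchy_riemann :: "(complex \<Rightarrow> complex) \<Rightarrow> bool" where
  "cauchy_riemann f \<longleftrightarrow> (\<forall>T\<in>\<Lambda>. \<forall>p d e. rhombus_at T p d e \<longrightarrow>
     (f (p + d) - f (p + e)) * (d + e) = (f (p + d + e) - f p) * (d - e))"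

text \<open>
  \<open>F\<close> is a discrete primitive of \<open>f\<close>: its increment along each edge is the integral of \<open>f\<close> there.
\<close>
definition primitive :: "(complex \<Rightarrow> complex) \<Rightarrow> (complex \<Rightarrow> complex) \<Rightarrow> bool" where
  "primitive F f \<longleftrightarrow> (\<forall>a b. (a, b) \<in> E \<longrightarrow> F b - F a = (f a + f b) / 2 * (b - a))"

lemma path_int_primitive:
  assumes "primitive F f" "lattice_path \<Lambda> a b zs"
  shows "path_int f zs = F b - F a"
proof -
  have ne: "zs \<noteq> []" using assms(2) by (simp add: lattice_path_def)
  then obtain m where m: "length zs = Suc m" by (cases zs) auto
  have "path_int f zs = (\<Sum>n\<in>{1..<Suc m}. F (zs ! n) - F (zs ! (n - 1)))"
    unfolding path_int_def m using assms m
    by (intro sum.cong) (auto simp: lattice_path_def primitive_def)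
  also have "\<dots> = F (zs ! m) - F (zs ! 0)"
    using sum_telescope_pred[of "\<lambda>n. F (zs ! n)" m] by simp
  finally show ?thesis
    using assms(2) ne m by (auto simp: lattice_path_def last_conv_nth hd_conv_nth)
qed

lemma DA_cauchy_riemann:
  assumes "f \<in> DA \<Lambda>"
  shows "cauchy_riemann f"
  unfolding cauchy_riemann_def
proof (intro ballI allI impI)
  fix T p d e assume T: "T \<in> \<Lambda>" and r: "rhombus_at T p d e"
  note ed = rhombus_edges[OF T r]
  have v: "p \<in> V" "p + d \<in> V" "p + e \<in> V" "p + d + e \<in> V"
    using ed edge_vertices by blast+
  have idx: "{1..<5} = {1, 2, 3, 4::nat}" by auto
  let ?zs = "[p, p + d, p + d + e, p + e, p]"
  have len: "length ?zs = 5" by simp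
  have "\<forall>n\<in>{1..<length ?zs}. (?zs ! (n - 1), ?zs ! n) \<in> E"
    unfolding len idx using ed edge_sym by simp
  then have "lattice_path \<Lambda> p p ?zs"
    unfolding lattice_path_def using v by simp
  then have "path_int f ?zs = 0" using assms by (simp add: DA_def)
  moreover have "2 * path_int f ?zs = (f (p + d) - f (p + e)) * (d + e) - (f (p + d + e) - f p) * (d - e)"
    unfolding path_int_def len idx by (simp add: field_simps)
  ultimately show "(f (p + d) - f (p + e)) * (d + e) = (f (p + d + e) - f p) * (d - e)" by simp
qed

lemma cauchy_riemann_primitive:
  assumes cr: "cauchy_riemann f"
  obtains F where "primitive F f"
proof -
  interpret flat_transport \<Lambda> "\<lambda>p q x. x + (f p + f q) / 2 * (q - p)"
  proof unfold_locales
    fix p q x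
    show "x + (f p + f q) / 2 * (q - p) + (f q + f p) / 2 * (p - q) = x" by (simp add: field_simps)
  next
    fix T p d e x assume "T \<in> \<Lambda>" "rhombus_at T p d e"
    then have "(f (p + d) - f (p + e)) * (d + e) = (f (p + d + e) - f p) * (d - e)"
      using cr by (simp add: cauchy_riemann_def)
    moreover have "x + (f p + f (p + d)) / 2 * (p + d - p) +
        (f (p + d) + f (p + d + e)) / 2 * (p + d + e - (p + d)) -
        (x + (f p + f (p + e)) / 2 * (p + e - p) +
        (f (p + e) + f (p + d + e)) / 2 * (p + d + e - (p + e))) =
        ((f (p + d) - f (p + e)) * (d + e) - (f (p + d + e) - f p) * (d - e)) / 2"
      by (simp add: field_simps)
    ultimately show "x + (f p + f (p + d)) / 2 * (p + d - p) +
        (f (p + d) + f (p + d + e)) / 2 * (p + d + e - (p + d)) =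
        x + (f p + f (p + e)) / 2 * (p + e - p) +
        (f (p + e) + f (p + d + e)) / 2 * (p + d + e - (p + e))"
      by (metis diff_self div_0 eq_iff_diff_eq_0)
  qed
  obtain F where "\<And>p q. (p, q) \<in> E \<Longrightarrow> F q = F p + (f p + f q) / 2 * (q - p)"
    using global_section[OF zero_vertex] by metis
  then have "primitive F f" by (simp add: primitive_def)
  then show ?thesis using that by blast
qed

text \<open>
  Discrete analyticity is a local condition.
\<close>
lemma DA_iff: "f \<in> DA \<Lambda> \<longleftrightarrow> cauchy_riemann f \<and> (\<forall>z. z \<notin> V \<longrightarrow> f z = 0)"
proof
  assume "cauchy_riemann f \<and> (\<forall>z. z \<notin> V \<longrightarrow> f z = 0)"
  moreover from this obtain F where "primitive F f" using cauchy_riemann_primitive by blast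
  ultimately show "f \<in> DA \<Lambda>" using path_int_primitive by (fastforce simp: DA_def)
qed (use DA_cauchy_riemann DA_outside in blast)

lemma path_to_vertex:
  assumes "z \<in> V"
  shows "\<exists>zs. lattice_path \<Lambda> 0 z zs"
proof (rule lattice_connected[OF zero_vertex assms])
  have "lattice_path \<Lambda> 0 0 [0]" using zero_vertex by (simp add: lattice_path_def)
  then show "\<exists>zs. lattice_path \<Lambda> 0 0 zs" by blast
  fix p q assume pq: "(p, q) \<in> E" "\<exists>zs. lattice_path \<Lambda> 0 p zs"
  then obtain zs where zs: "lattice_path \<Lambda> 0 p zs" by blast
  have "((zs @ [q]) ! (n - 1), (zs @ [q]) ! n) \<in> E" if n: "n \<in> {1..<Suc (length zs)}" for n
  proof (cases "n = length zs")
    case True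
    then show ?thesis using zs pq by (auto simp: lattice_path_def nth_append last_conv_nth)
  next
    case False
    then show ?thesis using zs n by (auto simp: lattice_path_def nth_append)
  qed
  then have "lattice_path \<Lambda> 0 q (zs @ [q])"
    using zs edge_vertices[OF pq(1)] by (simp add: lattice_path_def)
  then show "\<exists>zs. lattice_path \<Lambda> 0 q zs" by blast
qed

lemma vertex_int_primitive:
  assumes "primitive F f" "z \<in> V"
  shows "vertex_int \<Lambda> 0 z f = F z - F 0"
  unfolding vertex_int_def
  by (rule path_int_primitive[OF assms(1)], rule someI_ex, rule path_to_vertex[OF assms(2)])

lemma Zplus_edge:
  assumes "f \<in> DA \<Lambda>" "(a, b) \<in> E"
  shows "Zplus \<Lambda> f b - Zplus \<Lambda> f a = (f b * (b - a - 1) + f a * (b - a + 1)) / 2"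
proof -
  obtain F where F: "primitive F f" using DA_cauchy_riemann[OF assms(1)] cauchy_riemann_primitive by blast
  have "a \<in> V" "b \<in> V" using edge_vertices[OF assms(2)] by auto
  then have "Zplus \<Lambda> f b - Zplus \<Lambda> f a = (f a - f b) / 2 + (F b - F a)"
    by (simp add: Zplus_def vertex_int_primitive[OF F] diff_divide_distrib)
  also have "F b - F a = (f a + f b) / 2 * (b - a)" using F assms(2) by (simp add: primitive_def)
  also have "(f a - f b) / 2 + (f a + f b) / 2 * (b - a) = (f b * (b - a - 1) + f a * (b - a + 1)) / 2"
    by (simp add: field_simps)
  finally show ?thesis .
qed

lemma Zplus_at_0:
  assumes "f \<in> DA \<Lambda>"
  shows "Zplus \<Lambda> f 0 = 0"
proof -
  obtain F where F: "primitive F f" using DA_cauchy_riemann[OF assms(1)] cauchy_riemann_primitive by blast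
  then show ?thesis by (simp add: Zplus_def zero_vertex vertex_int_primitive)
qed

lemma Zplus_DA:
  assumes f: "f \<in> DA \<Lambda>"
  shows "Zplus \<Lambda> f \<in> DA \<Lambda>"
  unfolding DA_iff
proof
  show "cauchy_riemann (Zplus \<Lambda> f)"
    unfolding cauchy_riemann_def
  proof (intro ballI allI impI)
    fix T p d e assume T: "T \<in> \<Lambda>" and r: "rhombus_at T p d e"
    define F where "F = Zplus \<Lambda> f"
    have cr: "(f (p + d) - f (p + e)) * (d + e) = (f (p + d + e) - f p) * (d - e)"
      using DA_cauchy_riemann[OF f] T r by (simp add: cauchy_riemann_def)
    note ed = rhombus_edges[OF T r]
    from Zplus_edge[OF f ed(1)] have 1: "2 * (F (p + d) - F p) = f (p + d) * (d - 1) + f p * (d + 1)"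
      by (simp add: F_def algebra_simps)
    from Zplus_edge[OF f ed(2)] have 2: "2 * (F (p + e) - F p) = f (p + e) * (e - 1) + f p * (e + 1)"
      by (simp add: F_def algebra_simps)
    from Zplus_edge[OF f ed(3)]
    have 3: "2 * (F (p + d + e) - F (p + d)) = f (p + d + e) * (e - 1) + f (p + d) * (e + 1)"
      by (simp add: F_def algebra_simps)
    have "2 * ((F (p + d) - F (p + e)) * (d + e)) = 2 * ((F (p + d + e) - F p) * (d - e))"
      by (rule cauchy_riemann_shift[OF cr 1 2 3])
    then show "(Zplus \<Lambda> f (p + d) - Zplus \<Lambda> f (p + e)) * (d + e) =
        (Zplus \<Lambda> f (p + d + e) - Zplus \<Lambda> f p) * (d - e)"
      by (simp add: F_def)
  qed
qed (auto simp: Zplus_outside)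

lemma Zplus_power_DA: "f \<in> DA \<Lambda> \<Longrightarrow> (Zplus \<Lambda> ^^ n) f \<in> DA \<Lambda>"
  by (induction n) (auto intro: Zplus_DA)

lemma vertex_fun_eqI:
  assumes "\<And>a b. (a, b) \<in> E \<Longrightarrow> F b - F a = G b - (G a :: complex)" "F 0 = G 0" "z \<in> V"
  shows "F z = G z"
proof (rule lattice_connected[OF zero_vertex assms(3), of "\<lambda>z. F z = G z"])
  show "F q = G q" if "(p, q) \<in> E" "F p = G p" for p q
    using assms(1)[OF that(1)] that(2) by simp
qed (rule assms(2))

lemma DA_one: "(\<lambda>z. if z \<in> V then 1 else 0) \<in> DA \<Lambda>"
  unfolding DA_iff cauchy_riemann_def
proof (intro conjI ballI allI impI)
  fix T p d e assume T: "T \<in> \<Lambda>" and r: "rhombus_at T p d e"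
  have "p \<in> V" "p + d \<in> V" "p + e \<in> V" "p + d + e \<in> V"
    using rhombus_edges[OF T r] edge_vertices by blast+
  then show "((if p + d \<in> V then 1 else 0) - (if p + e \<in> V then 1 else 0)) * (d + e) =
       ((if p + d + e \<in> V then 1 else 0) - (if p \<in> V then 1 else 0)) * (d - e)"
    by simp
qed simp

text \<open>
  Injectivity of \<open>Z_+\<close>. An edge with direction 1 determines the value at its first vertex, and along
  edges with direction different from -1 a value at the second vertex determines the one at the
  first; by the path condition on the lattice such edges lead back to every vertex.
\<close>
lemma Zplus_inj_zero:
  assumes f: "f \<in> DA \<Lambda>" and zero: "\<And>z. Zplus \<Lambda> f z = 0"
  shows "f z = 0"
proof (cases "z \<in> V")
  case False
  then show ?thesis using f DA_outside by blast
next
  case True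
  have edge: "f b * (b - a - 1) + f a * (b - a + 1) = 0" if "(a, b) \<in> E" for a b
    using Zplus_edge[OF f that] zero by simp
  obtain N w zs where N: "N \<ge> 1" and zs: "lattice_path \<Lambda> z w zs" "length zs = Suc N"
    and steps: "\<And>n. n \<in> {1..N - 1} \<Longrightarrow> zs ! n - zs ! (n - 1) \<noteq> - 1" and last: "zs ! N - zs ! (N - 1) = 1"
    using admissible True unfolding admissible_lattice_def by meson
  have ed: "(zs ! (n - 1), zs ! n) \<in> E" if "n \<in> {1..N}" for n
    using zs that by (auto simp: lattice_path_def)
  have "f (zs ! (N - 1 - k)) = 0" if "k \<le> N - 1" for k
    using that
  proof (induction k)
    case 0
    show ?case using edge[OF ed[of N]] last N by simp
  next
    case (Suc k)
    let ?n = "N - 1 - k"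
    have n: "?n \<in> {1..N - 1}" using Suc.prems by auto
    have "f (zs ! (?n - 1)) * (zs ! ?n - zs ! (?n - 1) + 1) = 0"
      using edge[OF ed[of ?n]] Suc n by auto
    moreover have "zs ! ?n - zs ! (?n - 1) + 1 \<noteq> 0"
      using steps[OF n] by (metis add.commute add_eq_0_iff)
    ultimately show ?case by (simp add: Suc.prems)
  qed
  from this[of "N - 1"] have "f (zs ! 0) = 0" by simp
  then show ?thesis using zs by (auto simp: lattice_path_def hd_conv_nth)
qed

text \<open>
  Along an edge \<open>(a, b)\<close> the equation \<open>g - t Z_+ g = h\<close> reads
  \<open>(2 + t (1 + a - b)) g(b) = (2 + t (1 + b - a)) g(a) + 2 (h(b) - h(a))\<close>. For \<open>t\<close> outside the
  exceptional set both coefficients are nonzero on every edge, so the value at one vertex determines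
  all the others, and a solution exists by flatness.
\<close>
lemma resolvent_inj:
  assumes t: "t \<notin> exceptional_set \<Lambda>" and g: "g \<in> DA \<Lambda>" and eq: "\<And>z. g z - t * Zplus \<Lambda> g z = 0"
  shows "g z = 0"
proof (cases "z \<in> V")
  case True
  show ?thesis
  proof (rule lattice_connected[OF zero_vertex True, of "\<lambda>z. g z = 0"])
    show "g 0 = 0" using eq[of 0] Zplus_at_0[OF g] by simp
    fix a b assume ab: "(a, b) \<in> E" "g a = 0"
    have "g b - g a = t * (Zplus \<Lambda> g b - Zplus \<Lambda> g a)"
      using eq[of a] eq[of b] by (simp add: algebra_simps)
    moreover have "2 * (Zplus \<Lambda> g b - Zplus \<Lambda> g a) = g b * (b - a - 1)"
      using Zplus_edge[OF g ab(1)] ab(2) by (simp add: algebra_simps)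
    ultimately have "2 * g b = t * (g b * (b - a - 1))"
      using ab(2) by (metis diff_zero mult.left_commute)
    then have "g b * (2 + t * (1 + a - b)) = 0"
      by (simp add: algebra_simps)
    moreover have "2 + t * (1 + a - b) \<noteq> 0"
      using t edge_sym[OF ab(1)] unfolding exceptional_set_def
      by (auto simp: add_eq_0_iff)
    ultimately show "g b = 0" by simp
  qed
qed (use g DA_outside in blast)

lemma parallelogram_transport:
  fixes ad ae bd be :: complex
  assumes "bd \<noteq> 0" "be \<noteq> 0"
    and "ae * (h1 - h0) + bd * (h12 - h1) = ad * (h2 - h0) + be * (h12 - h2)"
  shows "(ae * ((ad * x + 2 * (h1 - h0)) / bd) + 2 * (h12 - h1)) / be =
         (ad * ((ae * x + 2 * (h2 - h0)) / be) + 2 * (h12 - h2)) / bd"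
proof -
  have "(ae * ((ad * x + 2 * (h1 - h0)) / bd) + 2 * (h12 - h1)) / be =
      (ae * ad * x + 2 * (ae * (h1 - h0) + bd * (h12 - h1))) / (bd * be)"
    using assms(1,2) by (simp add: field_simps)
  also have "\<dots> = (ae * ad * x + 2 * (ad * (h2 - h0) + be * (h12 - h2))) / (bd * be)"
    by (simp only: assms(3))
  also have "\<dots> = (ad * ((ae * x + 2 * (h2 - h0)) / be) + 2 * (h12 - h2)) / bd"
    using assms(1,2) by (simp add: field_simps)
  finally show ?thesis .
qed

lemma resolvent_surj:
  assumes t: "t \<notin> exceptional_set \<Lambda>" and h: "h \<in> DA \<Lambda>"
  obtains g where "g \<in> DA \<Lambda>" "\<And>z. g z - t * Zplus \<Lambda> g z = h z"
proof (cases "t = 0")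
  case True
  then show ?thesis using that[OF h] by simp
next
  case False
  have nz: "2 + t * (1 + b - a) \<noteq> 0" if "(a, b) \<in> E" for a b
    using t that unfolding exceptional_set_def by (auto simp: add_eq_0_iff)
  have crh: "(h (p + d) - h (p + e)) * (d + e) = (h (p + d + e) - h p) * (d - e)"
    if "T \<in> \<Lambda>" "rhombus_at T p d e" for T p d e
    using DA_cauchy_riemann[OF h] that by (simp add: cauchy_riemann_def)
  interpret flat_transport \<Lambda>
    "\<lambda>p q x. ((2 + t * (1 + q - p)) * x + 2 * (h q - h p)) / (2 + t * (1 + p - q))"
  proof unfold_locales
    fix p q x assume "(p, q) \<in> E"
    then have "2 + t * (1 + p - q) \<noteq> 0" "2 + t * (1 + q - p) \<noteq> 0" using nz edge_sym by blast+
    then show "((2 + t * (1 + p - q)) * (((2 + t * (1 + q - p)) * x + 2 * (h q - h p)) / (2 + t * (1 + p - q)))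
        + 2 * (h p - h q)) / (2 + t * (1 + q - p)) = x"
      by simp
  next
    fix T p d e x assume T: "T \<in> \<Lambda>" and r: "rhombus_at T p d e"
    note ed = rhombus_edges[OF T r]
    have n: "2 + t * (1 - d) \<noteq> 0" "2 + t * (1 - e) \<noteq> 0"
      using nz[OF edge_sym[OF ed(1)]] nz[OF edge_sym[OF ed(2)]] by simp_all
    have "(2 + t * (1 + e)) * (h (p + d) - h p) + (2 + t * (1 - d)) * (h (p + d + e) - h (p + d)) =
      (2 + t * (1 + d)) * (h (p + e) - h p) + (2 + t * (1 - e)) * (h (p + d + e) - h (p + e))"
      by (rule cauchy_riemann_transport[OF crh[OF T r]])
    from parallelogram_transport[OF n this, of x]
    show "((2 + t * (1 + (p + d + e) - (p + d))) *
          (((2 + t * (1 + (p + d) - p)) * x + 2 * (h (p + d) - h p)) / (2 + t * (1 + p - (p + d)))) +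
          2 * (h (p + d + e) - h (p + d))) / (2 + t * (1 + (p + d) - (p + d + e))) =
        ((2 + t * (1 + (p + d + e) - (p + e))) *
          (((2 + t * (1 + (p + e) - p)) * x + 2 * (h (p + e) - h p)) / (2 + t * (1 + p - (p + e)))) +
          2 * (h (p + d + e) - h (p + e))) / (2 + t * (1 + (p + e) - (p + d + e)))"
      by (simp add: algebra_simps)
  qed
  obtain S where S: "\<And>p q. (p, q) \<in> E \<Longrightarrow>
      S q = ((2 + t * (1 + q - p)) * S p + 2 * (h q - h p)) / (2 + t * (1 + p - q))" "S 0 = h 0"
    using global_section[OF zero_vertex] by blast
  define g where "g z = (if z \<in> V then S z else 0)" for z
  have ge: "(2 + t * (1 + p - q)) * g q = (2 + t * (1 + q - p)) * g p + 2 * (h q - h p)"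
    if "(p, q) \<in> E" for p q
    using S(1)[OF that] nz[OF edge_sym[OF that]] edge_vertices[OF that] by (simp add: g_def)
  have "cauchy_riemann g"
    unfolding cauchy_riemann_def
  proof (intro ballI allI impI)
    fix T p d e assume T: "T \<in> \<Lambda>" and r: "rhombus_at T p d e"
    note ed = rhombus_edges[OF T r]
    have e1: "(2 + t * (1 - d)) * g (p + d) = (2 + t * (1 + d)) * g p + 2 * (h (p + d) - h p)"
      using ge[OF ed(1)] by simp
    have e2: "(2 + t * (1 - e)) * g (p + e) = (2 + t * (1 + e)) * g p + 2 * (h (p + e) - h p)"
      using ge[OF ed(2)] by simp
    have e3: "(2 + t * (1 - e)) * g (p + d + e) =
        (2 + t * (1 + e)) * g (p + d) + 2 * (h (p + d + e) - h (p + d))"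
      using ge[OF ed(3)] by (simp add: algebra_simps)
    have e4: "(2 + t * (1 - d)) * g (p + d + e) =
        (2 + t * (1 + d)) * g (p + e) + 2 * (h (p + d + e) - h (p + e))"
      using ge[OF ed(4)] by (simp add: algebra_simps)
    \<comment> \<open>the edge equations, summed around the tile\<close>
    have "t * ((g (p + d) - g (p + e)) * (d + e)) = t * ((g (p + d + e) - g p) * (d - e))"
      by (rule transport_cauchy_riemann[OF e1 e2 e3 e4])
    then show "(g (p + d) - g (p + e)) * (d + e) = (g (p + d + e) - g p) * (d - e)"
      using False by simp
  qed
  then have g: "g \<in> DA \<Lambda>" by (auto simp: DA_iff g_def)
  have "g z - t * Zplus \<Lambda> g z = h z" for z
  proof (cases "z \<in> V")
    case True
    show ?thesis
    proof (rule vertex_fun_eqI[OF _ _ True, of "\<lambda>z. g z - t * Zplus \<Lambda> g z" h])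
      show "g 0 - t * Zplus \<Lambda> g 0 = h 0" using S(2) zero_vertex Zplus_at_0[OF g] by (simp add: g_def)
      fix a b assume ab: "(a, b) \<in> E"
      have Z: "2 * (Zplus \<Lambda> g b - Zplus \<Lambda> g a) = g b * (b - a - 1) + g a * (b - a + 1)"
        using Zplus_edge[OF g ab] by (simp add: algebra_simps)
      have "2 * (g b - t * Zplus \<Lambda> g b - (g a - t * Zplus \<Lambda> g a)) =
          2 * (g b - g a) - t * (2 * (Zplus \<Lambda> g b - Zplus \<Lambda> g a))"
        by (simp add: algebra_simps)
      also have "\<dots> = 2 * (g b - g a) - t * (g b * (b - a - 1) + g a * (b - a + 1))"
        by (simp only: Z)
      also have "\<dots> = (2 + t * (1 + a - b)) * g b - (2 + t * (1 + b - a)) * g a"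
        by (simp add: algebra_simps)
      also have "\<dots> = 2 * (h b - h a)" using ge[OF ab] by simp
      finally have "2 * (g b - t * Zplus \<Lambda> g b - (g a - t * Zplus \<Lambda> g a)) = 2 * (h b - h a)" .
      then show "g b - t * Zplus \<Lambda> g b - (g a - t * Zplus \<Lambda> g a) = h b - h a"
        by (metis mult_cancel_left zero_neq_numeral)
    qed
  next
    case False
    then show ?thesis using g h by (simp add: DA_outside Zplus_outside)
  qed
  then show ?thesis using that g by blast
qed

text \<open>
  The definition of \<open>Z_-\<close> is met by the injectivity of \<open>Z_+\<close> alone: \<open>t f\<close> is a solution \<open>g\<close> of
  \<open>Z_+ g = f - f(0)\<close>, hence the unique one, which is \<open>Z_- f\<close>.
\<close>
lemma Zminus_eigenvalueI:
  assumes f: "f \<in> DA \<Lambda>" "f z0 \<noteq> 0" and eq: "\<And>z. z \<in> V \<Longrightarrow> f z - f 0 = t * Zplus \<Lambda> f z"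
  shows "Zminus_eigenvalue \<Lambda> t"
proof -
  have tf: "(\<lambda>z. t * f z) \<in> DA \<Lambda>" by (rule DA_cmult[OF f(1)])
  have "Zminus \<Lambda> f = (\<lambda>z. t * f z)"
    unfolding Zminus_def
  proof (rule the_equality)
    show "(\<lambda>z. t * f z) \<in> DA \<Lambda> \<and> (\<forall>z\<in>V. Zplus \<Lambda> (\<lambda>z. t * f z) z = f z - f 0)"
      using tf eq by (simp add: Zplus_cmult)
    fix g assume g: "g \<in> DA \<Lambda> \<and> (\<forall>z\<in>V. Zplus \<Lambda> g z = f z - f 0)"
    have d: "(\<lambda>z. g z + (-1) * (t * f z)) \<in> DA \<Lambda>"
      by (intro DA_add DA_cmult[OF tf]) (use g in blast)
    have "Zplus \<Lambda> (\<lambda>z. g z + (-1) * (t * f z)) z = 0" for z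
      unfolding Zplus_add Zplus_cmult using g eq by (cases "z \<in> V") (auto simp: Zplus_outside)
    then have "g z + (-1) * (t * f z) = 0" for z
      by (rule Zplus_inj_zero[OF d])
    then show "g = (\<lambda>z. t * f z)" by (simp add: fun_eq_iff)
  qed
  moreover have "z0 \<in> V" using f DA_outside by blast
  ultimately show ?thesis unfolding Zminus_eigenvalue_def using f by auto
qed

end

section \<open>Polynomials in the shift\<close>

abbreviation pcoeff :: "complex poly \<Rightarrow> nat \<Rightarrow> complex" where
  "pcoeff \<equiv> Polynomial.coeff"

text \<open>
  The operator \<open>p(Z_+)\<close>, applied to \<open>f\<close>. As \<open>Z_+\<close> is linear on all functions, this is an action of
  the polynomial ring (\<open>act_mult\<close>) that does not require discrete analyticity.
\<close>
definition act :: "complex set set \<Rightarrow> complex poly \<Rightarrow> (complex \<Rightarrow> complex) \<Rightarrow> complex \<Rightarrow> complex" where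
  "act \<Lambda> p f z = (\<Sum>k\<le>degree p. pcoeff p k * (Zplus \<Lambda> ^^ k) f z)"

lemma act_bound:
  assumes "degree p \<le> N"
  shows "act \<Lambda> p f z = (\<Sum>k\<le>N. pcoeff p k * (Zplus \<Lambda> ^^ k) f z)"
  unfolding act_def
  by (rule sum.mono_neutral_left) (use assms in \<open>auto simp: not_le intro: coeff_eq_0\<close>)

lemma act_0 [simp]: "act \<Lambda> 0 f = (\<lambda>z. 0)"
  by (rule ext) (simp add: act_def)

lemma act_pCons: "act \<Lambda> (pCons a p) f = (\<lambda>z. a * f z + Zplus \<Lambda> (act \<Lambda> p f) z)"
proof
  fix z
  have "degree (pCons a p) \<le> Suc (degree p)" by (rule degree_pCons_le)
  then have "act \<Lambda> (pCons a p) f z = (\<Sum>k\<le>Suc (degree p). pcoeff (pCons a p) k * (Zplus \<Lambda> ^^ k) f z)"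
    by (rule act_bound)
  also have "\<dots> = a * f z + (\<Sum>k\<le>degree p. pcoeff p k * Zplus \<Lambda> ((Zplus \<Lambda> ^^ k) f) z)"
    by (simp add: sum.atMost_Suc_shift del: sum.atMost_Suc)
  also have "(\<Sum>k\<le>degree p. pcoeff p k * Zplus \<Lambda> ((Zplus \<Lambda> ^^ k) f) z) = Zplus \<Lambda> (act \<Lambda> p f) z"
    unfolding act_def[abs_def] Zplus_sum Zplus_cmult ..
  finally show "act \<Lambda> (pCons a p) f z = a * f z + Zplus \<Lambda> (act \<Lambda> p f) z" .
qed

lemma act_const: "act \<Lambda> [:a:] f = (\<lambda>z. a * f z)"
  by (simp add: act_pCons Zplus_zero)

lemma act_add: "act \<Lambda> (p + q) f = (\<lambda>z. act \<Lambda> p f z + act \<Lambda> q f z)"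
proof
  fix z
  let ?N = "max (degree p) (degree q)"
  have "degree (p + q) \<le> ?N" by (rule degree_add_le_max)
  then show "act \<Lambda> (p + q) f z = act \<Lambda> p f z + act \<Lambda> q f z"
    by (simp add: act_bound[of _ ?N] sum.distrib algebra_simps)
qed

lemma act_smult: "act \<Lambda> (Polynomial.smult c p) f = (\<lambda>z. c * act \<Lambda> p f z)"
  by (rule ext) (simp add: act_bound[of _ "degree p"] degree_smult_le sum_distrib_left mult.assoc)

lemma act_sum: "act \<Lambda> (\<Sum>i\<in>I. p i) f = (\<lambda>z. \<Sum>i\<in>I. act \<Lambda> (p i) f z)"
  by (induction I rule: infinite_finite_induct) (simp_all add: act_add)

lemma act_fun_add: "act \<Lambda> p (\<lambda>z. f z + g z) = (\<lambda>z. act \<Lambda> p f z + act \<Lambda> p g z)"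
  by (induction p) (simp_all add: act_pCons Zplus_add algebra_simps)

lemma act_fun_cmult: "act \<Lambda> p (\<lambda>z. c * f z) = (\<lambda>z. c * act \<Lambda> p f z)"
  by (induction p) (simp_all add: act_pCons Zplus_cmult algebra_simps)

lemma act_fun_zero: "act \<Lambda> p (\<lambda>z. 0) = (\<lambda>z. 0)"
  using act_fun_cmult[of \<Lambda> p 0 "\<lambda>z. 0"] by simp

lemma act_fun_sum: "act \<Lambda> p (\<lambda>z. \<Sum>i\<in>I. f i z) = (\<lambda>z. \<Sum>i\<in>I. act \<Lambda> p (f i) z)"
  by (induction I rule: infinite_finite_induct) (simp_all add: act_fun_add act_fun_zero)

lemma act_mult: "act \<Lambda> (p * q) f = act \<Lambda> p (act \<Lambda> q f)"
  by (induction p) (simp_all add: act_pCons act_add act_smult)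

lemma act_commute: "act \<Lambda> p (act \<Lambda> q f) = act \<Lambda> q (act \<Lambda> p f)"
  by (metis act_mult mult.commute)

lemma Zplus_power_eq_act: "(Zplus \<Lambda> ^^ k) f = act \<Lambda> (monom 1 k) f"
proof (induction k)
  case 0
  then show ?case by (simp add: monom_0 act_const)
next
  case (Suc k)
  then show ?case by (simp add: monom_Suc act_pCons)
qed

lemma act_poly_sum:
  "act \<Lambda> (\<Sum>k\<in>K. monom (c k) k) f = (\<lambda>z. \<Sum>k\<in>K. c k * (Zplus \<Lambda> ^^ k) f z)"
proof -
  have "act \<Lambda> (monom a k) f = (\<lambda>z. a * (Zplus \<Lambda> ^^ k) f z)" for a k
    using act_smult[of \<Lambda> a "monom 1 k" f] by (simp add: Zplus_power_eq_act smult_monom)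
  then show ?thesis by (simp add: act_sum)
qed

context admissible_tiling
begin

text \<open>
  The constant function 1, extended by 0 to the plane.
\<close>
abbreviation one_V :: "complex \<Rightarrow> complex" where
  "one_V \<equiv> (\<lambda>z. if z \<in> V then 1 else 0)"

lemma act_DA: "f \<in> DA \<Lambda> \<Longrightarrow> act \<Lambda> p f \<in> DA \<Lambda>"
  by (induction p) (auto simp: act_pCons DA_zero intro!: DA_add DA_cmult Zplus_DA)

lemma act_at_0: "f \<in> DA \<Lambda> \<Longrightarrow> act \<Lambda> p f 0 = pcoeff p 0 * f 0"
  by (cases p) (simp add: act_pCons Zplus_at_0 act_DA)

lemma DA_poly_eq_act: "DA_poly \<Lambda> N c = act \<Lambda> (\<Sum>k\<le>N. monom (c k) k) one_V"
  by (rule ext) (simp add: DA_poly_def DA_power_def act_poly_sum)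

text \<open>
  The polynomials \<open>p\<close> for which \<open>p(Z_+)\<close> is shown to be bijective on discrete analytic functions:
  up to a nonzero constant they are products of factors \<open>1 - t s\<close> with \<open>t\<close> outside the exceptional set.
\<close>
definition regular :: "complex poly \<Rightarrow> bool" where
  "regular p \<longleftrightarrow> poly p 0 \<noteq> 0 \<and> (\<forall>s. poly p s = 0 \<longrightarrow> inverse s \<notin> exceptional_set \<Lambda>)"

lemma regular_act_bij:
  assumes "regular p"
  shows "(\<forall>h\<in>DA \<Lambda>. \<exists>g\<in>DA \<Lambda>. act \<Lambda> p g = h) \<and>
    (\<forall>g\<in>DA \<Lambda>. act \<Lambda> p g = (\<lambda>z. 0) \<longrightarrow> g = (\<lambda>z. 0))"
  using assms
proof (induction "degree p" arbitrary: p rule: less_induct)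
  case less
  show ?case
  proof (cases "degree p = 0")
    case True
    then obtain c where c: "p = [:c:]" by (meson degree_eq_zeroE)
    with less have "c \<noteq> 0" by (simp add: regular_def)
    then have "act \<Lambda> p (\<lambda>z. inverse c * h z) = h" for h
      by (simp add: c act_const fun_eq_iff)
    moreover have "g = (\<lambda>z. 0)" if "act \<Lambda> p g = (\<lambda>z. 0)" for g
      using that \<open>c \<noteq> 0\<close> by (simp add: c act_const fun_eq_iff)
    ultimately show ?thesis using DA_cmult by blast
  next
    case False
    then have "\<not> constant (poly p)" by (simp add: constant_degree)
    then obtain s where s: "poly p s = 0" using fundamental_theorem_of_algebra by blast
    with less have s0: "s \<noteq> 0" and t: "inverse s \<notin> exceptional_set \<Lambda>" by (auto simp: regular_def)
    from s obtain q where q: "p = [:- s, 1:] * q" by (auto simp: poly_eq_0_iff_dvd)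
    define r where "r = Polynomial.smult (- s) q"
    have p: "p = [:1, - inverse s:] * r"
      unfolding q r_def using s0 by (simp add: field_simps)
    have "q \<noteq> 0" using False q by auto
    then have "degree r < degree p" using s0 unfolding q r_def
      by (subst degree_mult_eq) auto
    moreover have "regular r"
      using less.prems unfolding regular_def p by auto
    ultimately have IH: "\<forall>h\<in>DA \<Lambda>. \<exists>g\<in>DA \<Lambda>. act \<Lambda> r g = h"
      "\<forall>g\<in>DA \<Lambda>. act \<Lambda> r g = (\<lambda>z. 0) \<longrightarrow> g = (\<lambda>z. 0)"
      using less.hyps by blast+
    have lin: "act \<Lambda> [:1, - inverse s:] g = (\<lambda>z. g z - inverse s * Zplus \<Lambda> g z)" for g
      using act_pCons[of \<Lambda> 1 "[:- inverse s:]" g] Zplus_cmult[of \<Lambda> "- inverse s" g]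
      by (simp add: act_const)
    have "\<exists>g\<in>DA \<Lambda>. act \<Lambda> p g = h" if h: "h \<in> DA \<Lambda>" for h
    proof -
      obtain g' where g': "g' \<in> DA \<Lambda>" "\<And>z. g' z - inverse s * Zplus \<Lambda> g' z = h z"
        using resolvent_surj[OF t h] by blast
      then have "act \<Lambda> [:1, - inverse s:] g' = h" by (simp add: lin fun_eq_iff)
      moreover obtain g where "g \<in> DA \<Lambda>" "act \<Lambda> r g = g'" using IH g' by blast
      ultimately show ?thesis unfolding p act_mult by blast
    qed
    moreover have "g = (\<lambda>z. 0)" if g: "g \<in> DA \<Lambda>" "act \<Lambda> p g = (\<lambda>z. 0)" for g
    proof -
      have "act \<Lambda> r g z - inverse s * Zplus \<Lambda> (act \<Lambda> r g) z = 0" for z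
        using fun_cong[OF g(2)[unfolded p act_mult lin], of z] by simp
      then have "act \<Lambda> r g = (\<lambda>z. 0)"
        using resolvent_inj[OF t act_DA[OF g(1)]] by blast
      then show ?thesis using IH g by blast
    qed
    ultimately show ?thesis by blast
  qed
qed

lemma regular_act_surj: "regular p \<Longrightarrow> h \<in> DA \<Lambda> \<Longrightarrow> \<exists>g\<in>DA \<Lambda>. act \<Lambda> p g = h"
  using regular_act_bij by blast

lemma regular_act_inj:
  assumes "regular p" "f \<in> DA \<Lambda>" "g \<in> DA \<Lambda>" "act \<Lambda> p f = act \<Lambda> p g"
  shows "f = g"
proof -
  have "act \<Lambda> p (\<lambda>z. f z + (-1) * g z) = (\<lambda>z. 0)"
    unfolding act_fun_add act_fun_cmult by (simp add: assms(4))
  moreover have "(\<lambda>z. f z + (-1) * g z) \<in> DA \<Lambda>" by (intro DA_add DA_cmult assms)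
  ultimately have "(\<lambda>z. f z + (-1) * g z) = (\<lambda>z. 0)" using regular_act_bij[OF assms(1)] by blast
  then show ?thesis by (simp add: fun_eq_iff)
qed

text \<open>
  A factor \<open>Z_+ - s\<close> violating regularity can be cancelled. Write the right-hand side as
  \<open>(Z_+ - s) q'(Z_+) 1 + c\<close> with a constant \<open>c\<close> and put \<open>w = h - q'(Z_+) 1\<close>, so that
  \<open>Z_+ w - s w = c\<close> is constant. For \<open>s = 0\<close> evaluation at 0 gives \<open>c = 0\<close>, and \<open>w = 0\<close> by
  injectivity of \<open>Z_+\<close>. For \<open>s \<noteq> 0\<close> a nonzero \<open>w\<close> would be an eigenfunction of \<open>Z_-\<close> for the
  eigenvalue \<open>1/s\<close>, which lies in the exceptional set.
\<close>
lemma cancel_irregular_factor: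
  assumes ev: "\<And>t. t \<in> exceptional_set \<Lambda> \<Longrightarrow> \<not> Zminus_eigenvalue \<Lambda> t"
    and s: "s = 0 \<or> inverse s \<in> exceptional_set \<Lambda>"
    and h: "h \<in> DA \<Lambda>" and eq: "act \<Lambda> [:- s, 1:] h = act \<Lambda> q one_V"
  shows "\<exists>q'. h = act \<Lambda> q' one_V"
proof -
  define q' where "q' = synthetic_div q s"
  have q: "q = [:- s, 1:] * q' + [:poly q s:]"
    using synthetic_div_correct'[of s q] by (simp add: q'_def)
  define w where "w = (\<lambda>z. h z + (-1) * act \<Lambda> q' one_V z)"
  have w: "w \<in> DA \<Lambda>" unfolding w_def by (intro DA_add DA_cmult act_DA h DA_one)
  have lin: "act \<Lambda> [:- s, 1:] g = (\<lambda>z. Zplus \<Lambda> g z - s * g z)" for g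
    using act_pCons[of \<Lambda> "- s" "[:1:]" g] by (simp add: act_const)
  have "act \<Lambda> [:- s, 1:] w = (\<lambda>z. act \<Lambda> q one_V z + (-1) * act \<Lambda> ([:- s, 1:] * q') one_V z)"
    unfolding w_def act_fun_add act_fun_cmult eq act_mult ..
  also have "\<dots> = (\<lambda>z. poly q s * one_V z)"
    by (subst q) (simp add: act_add act_const)
  finally have Zw: "Zplus \<Lambda> w z - s * w z = poly q s * one_V z" for z
    by (simp add: lin fun_eq_iff)
  from Zw[of 0] have c: "poly q s = - s * w 0" using zero_vertex Zplus_at_0[OF w] by simp
  have "w z = 0" for z
  proof (cases "s = 0")
    case True
    then show ?thesis using Zw c Zplus_inj_zero[OF w] by simp
  next
    case False
    show ?thesis
    proof (rule ccontr)
      assume "w z \<noteq> 0"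
      have "w z - w 0 = inverse s * Zplus \<Lambda> w z" if "z \<in> V" for z
      proof -
        have "Zplus \<Lambda> w z = s * (w z - w 0)" using Zw[of z] c that by (simp add: algebra_simps)
        then show ?thesis using False by simp
      qed
      then have "Zminus_eigenvalue \<Lambda> (inverse s)"
        using Zminus_eigenvalueI[OF w \<open>w z \<noteq> 0\<close>] by blast
      then show False using ev s False by blast
    qed
  qed
  then have "h = act \<Lambda> q' one_V" by (simp add: w_def fun_eq_iff)
  then show ?thesis by blast
qed

lemma reduce_to_regular:
  assumes ev: "\<And>t. t \<in> exceptional_set \<Lambda> \<Longrightarrow> \<not> Zminus_eigenvalue \<Lambda> t"
    and "p \<noteq> 0" and f: "\<And>i. i \<in> I \<Longrightarrow> f i \<in> DA \<Lambda>"
    and "\<And>i. i \<in> I \<Longrightarrow> \<exists>q. act \<Lambda> p (f i) = act \<Lambda> q one_V"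
  shows "\<exists>p'. regular p' \<and> (\<forall>i\<in>I. \<exists>q. act \<Lambda> p' (f i) = act \<Lambda> q one_V)"
  using assms(2,4)
proof (induction "degree p" arbitrary: p rule: less_induct)
  case less
  show ?case
  proof (cases "regular p")
    case True
    then show ?thesis using less.prems by blast
  next
    case False
    then obtain s where s: "poly p s = 0" "s = 0 \<or> inverse s \<in> exceptional_set \<Lambda>"
      by (auto simp: regular_def)
    from s obtain r where p: "p = [:- s, 1:] * r" by (auto simp: poly_eq_0_iff_dvd)
    then have "r \<noteq> 0" using less.prems by auto
    then have "degree r < degree p" unfolding p by (subst degree_mult_eq) auto
    moreover have "\<exists>q. act \<Lambda> r (f i) = act \<Lambda> q one_V" if i: "i \<in> I" for i
    proof -
      obtain q where "act \<Lambda> [:- s, 1:] (act \<Lambda> r (f i)) = act \<Lambda> q one_V"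
        using less.prems(2)[OF i] unfolding p act_mult by blast
      then show ?thesis
        using cancel_irregular_factor[OF ev s(2) act_DA[OF f[OF i]]] by blast
    qed
    ultimately show ?thesis using less.hyps \<open>r \<noteq> 0\<close> by blast
  qed
qed

text \<open>
  A matrix of polynomials in \<open>Z_+\<close> applied to a vector of functions.
\<close>
definition mact :: "nat \<Rightarrow> complex poly mat \<Rightarrow> (nat \<Rightarrow> complex \<Rightarrow> complex) \<Rightarrow> nat \<Rightarrow> complex \<Rightarrow> complex" where
  "mact l M x i = (\<lambda>z. \<Sum>j<l. act \<Lambda> (M $$ (i, j)) (x j) z)"

end

section \<open>The resolvent of a matrix\<close>

lemma mat_mult_entry:
  assumes "A \<in> carrier_mat m l" "B \<in> carrier_mat l n" "i < m" "j < n"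
  shows "(A * B) $$ (i, j) = (\<Sum>k<l. A $$ (i, k) * B $$ (k, j))"
  using assms by (auto simp: scalar_prod_def lessThan_atLeast0 intro!: sum.cong)

text \<open>
  The matrix \<open>I - s A\<close> over the polynomial ring in \<open>s\<close>.
\<close>
definition poly_pencil :: "nat \<Rightarrow> complex Matrix.mat \<Rightarrow> complex poly Matrix.mat" where
  "poly_pencil l A = Matrix.mat l l (\<lambda>(i, j). [:if i = j then 1 else 0, - (A $$ (i, j)):])"

lemma poly_pencil_carrier: "poly_pencil l A \<in> carrier_mat l l"
  by (simp add: poly_pencil_def)

context admissible_tiling
begin

lemma mact_mult:
  assumes "M \<in> carrier_mat l l" "N \<in> carrier_mat l l" "i < l"
  shows "mact l (M * N) x i = mact l M (mact l N x) i"
proof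
  fix z
  have "mact l M (mact l N x) i z = (\<Sum>k<l. \<Sum>j<l. act \<Lambda> (M $$ (i, k) * N $$ (k, j)) (x j) z)"
    by (simp add: mact_def act_fun_sum act_mult)
  also have "\<dots> = (\<Sum>j<l. \<Sum>k<l. act \<Lambda> (M $$ (i, k) * N $$ (k, j)) (x j) z)"
    by (rule sum.swap)
  also have "\<dots> = mact l (M * N) x i z"
    unfolding mact_def
  proof (intro sum.cong refl)
    fix j assume "j \<in> {..<l}"
    then have "(M * N) $$ (i, j) = (\<Sum>k<l. M $$ (i, k) * N $$ (k, j))"
      using assms by (intro mat_mult_entry) auto
    then show "(\<Sum>k<l. act \<Lambda> (M $$ (i, k) * N $$ (k, j)) (x j) z) = act \<Lambda> ((M * N) $$ (i, j)) (x j) z"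
      by (simp add: act_sum)
  qed
  finally show "mact l (M * N) x i z = mact l M (mact l N x) i z" by simp
qed

lemma mact_scalar:
  assumes "i < l"
  shows "mact l (p \<cdot>\<^sub>m 1\<^sub>m l) x i = act \<Lambda> p (x i)"
proof
  fix z
  have "mact l (p \<cdot>\<^sub>m 1\<^sub>m l) x i z = (\<Sum>j<l. if j = i then act \<Lambda> p (x i) z else 0)"
    unfolding mact_def using assms by (intro sum.cong) auto
  then show "mact l (p \<cdot>\<^sub>m 1\<^sub>m l) x i z = act \<Lambda> p (x i) z" using assms by simp
qed

lemma mact_cong: "(\<And>j. j < l \<Longrightarrow> x j = y j) \<Longrightarrow> mact l M x i = mact l M y i"
  unfolding mact_def by (intro ext sum.cong) auto

lemma mact_pencil:
  assumes "i < l"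
  shows "mact l (poly_pencil l A) x i = (\<lambda>z. x i z - (\<Sum>k<l. A $$ (i, k) * Zplus \<Lambda> (x k) z))"
proof
  fix z
  have "mact l (poly_pencil l A) x i z =
      (\<Sum>k<l. (if k = i then x i z else 0) - A $$ (i, k) * Zplus \<Lambda> (x k) z)"
    unfolding mact_def
  proof (intro sum.cong refl)
    fix k assume "k \<in> {..<l}"
    then have "poly_pencil l A $$ (i, k) = [:if i = k then 1 else 0, - (A $$ (i, k)):]"
      using assms by (simp add: poly_pencil_def)
    then show "act \<Lambda> (poly_pencil l A $$ (i, k)) (x k) z =
        (if k = i then x i z else 0) - A $$ (i, k) * Zplus \<Lambda> (x k) z"
      using Zplus_cmult[of \<Lambda> "- (A $$ (i, k))" "x k"]
      by (auto simp: act_pCons[of \<Lambda> _ "[:- (A $$ (i, k)):]"] act_const simp del: pCons_eq_0_iff)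
  qed
  also have "\<dots> = x i z - (\<Sum>k<l. A $$ (i, k) * Zplus \<Lambda> (x k) z)"
    using assms by (simp add: sum_subtractf)
  finally show "mact l (poly_pencil l A) x i z = x i z - (\<Sum>k<l. A $$ (i, k) * Zplus \<Lambda> (x k) z)" .
qed

text \<open>
  The polynomial \<open>det(I - s A)\<close>. It takes the value 1 at 0, and its roots are the reciprocals of the
  nonzero eigenvalues of \<open>A\<close>.
\<close>
definition pencil_det :: "nat \<Rightarrow> complex Matrix.mat \<Rightarrow> complex poly" where
  "pencil_det l A = Determinant.det (poly_pencil l A)"

lemma poly_pencil_det:
  assumes "A \<in> carrier_mat l l"
  shows "poly (pencil_det l A) s = Determinant.det (1\<^sub>m l - s \<cdot>\<^sub>m A)"
proof -
  have hom: "comm_ring_hom (\<lambda>p :: complex poly. poly p s)" by unfold_locales auto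
  have "map_mat (\<lambda>p. poly p s) (poly_pencil l A) = 1\<^sub>m l - s \<cdot>\<^sub>m A"
    using assms by (intro eq_matI) (auto simp: poly_pencil_def)
  then show ?thesis unfolding pencil_det_def using comm_ring_hom.hom_det[OF hom, of "poly_pencil l A"] by simp
qed

lemma pencil_det_regular:
  assumes A: "A \<in> carrier_mat l l" and spec: "exceptional_set \<Lambda> \<inter> spectrum A = {}"
  shows "regular (pencil_det l A)"
  unfolding regular_def
proof (intro conjI allI impI)
  have "1\<^sub>m l - 0 \<cdot>\<^sub>m A = 1\<^sub>m l" using A by (intro eq_matI) auto
  then show "poly (pencil_det l A) 0 \<noteq> 0" by (simp add: poly_pencil_det[OF A])
  then have n0: "poly (pencil_det l A) s = 0 \<Longrightarrow> s \<noteq> 0" for s by auto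
  fix s assume s: "poly (pencil_det l A) s = 0"
  have carr: "1\<^sub>m l - s \<cdot>\<^sub>m A \<in> carrier_mat l l"
    using A by (intro minus_carrier_mat smult_carrier_mat)
  have "Determinant.det (1\<^sub>m l - s \<cdot>\<^sub>m A) = 0" using s by (simp add: poly_pencil_det[OF A])
  then obtain v where v: "v \<in> carrier_vec l" "v \<noteq> 0\<^sub>v l" "(1\<^sub>m l - s \<cdot>\<^sub>m A) *\<^sub>v v = 0\<^sub>v l"
    using det_0_iff_vec_prod_zero_field[OF carr] by blast
  have "vec_index v i = s * vec_index (A *\<^sub>v v) i" if i: "i < l" for i
  proof -
    have "(1\<^sub>m l - s \<cdot>\<^sub>m A) *\<^sub>v v = 1\<^sub>m l *\<^sub>v v - (s \<cdot>\<^sub>m A) *\<^sub>v v"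
      using A v(1) by (intro minus_mult_distrib_mat_vec) auto
    also have "(s \<cdot>\<^sub>m A) *\<^sub>v v = s \<cdot>\<^sub>v (A *\<^sub>v v)"
      using A v(1) by (intro eq_vecI) (auto simp: scalar_prod_def sum_distrib_left mult.assoc)
    also have "1\<^sub>m l *\<^sub>v v = v" using v(1) by simp
    finally have "vec_index (v - s \<cdot>\<^sub>v (A *\<^sub>v v)) i = 0" using v(3) i by (metis index_zero_vec(1))
    then show ?thesis using i v(1) A by simp
  qed
  then have "A *\<^sub>v v = inverse s \<cdot>\<^sub>v v"
    using v(1) A n0[OF s] by (intro eq_vecI) (auto simp: field_simps)
  then have "inverse s \<in> spectrum A"
    unfolding spectrum_def eigenvalue_def eigenvector_def using v A by auto
  then show "inverse s \<notin> exceptional_set \<Lambda>" using spec by blast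
qed

text \<open>
  Multiplication by the adjugate turns \<open>I - Z_+ A\<close> into the scalar operator \<open>det(I - Z_+ A)\<close>, which
  is injective.
\<close>
lemma mact_pencil_inj:
  assumes A: "A \<in> carrier_mat l l" and spec: "exceptional_set \<Lambda> \<inter> spectrum A = {}"
    and x: "\<And>i. i < l \<Longrightarrow> x i \<in> DA \<Lambda>" "\<And>i. i < l \<Longrightarrow> y i \<in> DA \<Lambda>"
    and eq: "\<And>i. i < l \<Longrightarrow> mact l (poly_pencil l A) x i = mact l (poly_pencil l A) y i"
    and i: "i < l"
  shows "x i = y i"
proof (rule regular_act_inj[OF pencil_det_regular[OF A spec] x(1)[OF i] x(2)[OF i]])
  let ?P = "poly_pencil l A"
  note adj = adj_mat[OF poly_pencil_carrier, of l A]
  have "act \<Lambda> (pencil_det l A) (x i) = mact l (adj_mat ?P) (mact l ?P x) i" for x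
    unfolding mact_mult[OF adj(1) poly_pencil_carrier i, symmetric] adj(3) mact_scalar[OF i] pencil_det_def ..
  then show "act \<Lambda> (pencil_det l A) (x i) = act \<Lambda> (pencil_det l A) (y i)"
    using mact_cong[OF eq] by simp
qed

lemma Zplus_mat_power:
  assumes "\<And>z. f z \<in> carrier_mat m n"
  shows "(Zplus_mat \<Lambda> ^^ k) f z \<in> carrier_mat m n"
    and "i < m \<Longrightarrow> j < n \<Longrightarrow> (Zplus_mat \<Lambda> ^^ k) f z $$ (i, j) = (Zplus \<Lambda> ^^ k) (\<lambda>w. f w $$ (i, j)) z"
proof -
  have c: "(Zplus_mat \<Lambda> ^^ k) f z \<in> carrier_mat m n" for k z
  proof (induction k arbitrary: z)
    case (Suc k)
    from Suc[of z] show ?case by (simp add: Zplus_mat_def)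
  qed (simp add: assms)
  then show "(Zplus_mat \<Lambda> ^^ k) f z \<in> carrier_mat m n" .
  assume ij: "i < m" "j < n"
  show "(Zplus_mat \<Lambda> ^^ k) f z $$ (i, j) = (Zplus \<Lambda> ^^ k) (\<lambda>w. f w $$ (i, j)) z"
  proof (induction k arbitrary: z)
    case (Suc k)
    have "(Zplus_mat \<Lambda> ^^ Suc k) f z $$ (i, j) = Zplus \<Lambda> (\<lambda>w. (Zplus_mat \<Lambda> ^^ k) f w $$ (i, j)) z"
      using ij c[of k z] by (simp add: Zplus_mat_def)
    also have "(\<lambda>w. (Zplus_mat \<Lambda> ^^ k) f w $$ (i, j)) = (Zplus \<Lambda> ^^ k) (\<lambda>w. f w $$ (i, j))"
      using Suc by (intro ext)
    finally show ?case by simp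
  qed simp
qed

end

context admissible_tiling
begin

lemma conv_pencil_left_entry:
  assumes A: "A \<in> carrier_mat l l" and R: "\<And>z. R z \<in> carrier_mat l l" and ij: "i < l" "j < l"
  shows "conv_poly_left \<Lambda> l l 1 (pencil l A) R z $$ (i, j) =
    mact l (poly_pencil l A) (\<lambda>k w. R w $$ (k, j)) i z"
proof -
  have RZ: "Zplus_mat \<Lambda> R z \<in> carrier_mat l l"
    using Zplus_mat_power(1)[of R l l 1 z] R by simp
  have e: "Zplus_mat \<Lambda> R z $$ (k, j) = Zplus \<Lambda> (\<lambda>w. R w $$ (k, j)) z" if "k < l" for k
    using Zplus_mat_power(2)[of R l l k j 1 z] R that ij by simp
  have "conv_poly_left \<Lambda> l l 1 (pencil l A) R z $$ (i, j) =
      (1\<^sub>m l * R z) $$ (i, j) + ((- A) * Zplus_mat \<Lambda> R z) $$ (i, j)"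
    using ij by (simp add: conv_poly_left_def pencil_def)
  also have "1\<^sub>m l * R z = R z" using R by (intro left_mult_one_mat)
  also have "((- A) * Zplus_mat \<Lambda> R z) $$ (i, j) = (\<Sum>k<l. (- A) $$ (i, k) * Zplus_mat \<Lambda> R z $$ (k, j))"
    using A RZ ij by (intro mat_mult_entry) auto
  also have "\<dots> = (\<Sum>k<l. - (A $$ (i, k) * Zplus \<Lambda> (\<lambda>w. R w $$ (k, j)) z))"
    using A ij e by (intro sum.cong) auto
  finally show ?thesis by (simp add: mact_pencil[OF ij(1)] sum_negf)
qed

lemma conv_pencil_right_entry:
  assumes A: "A \<in> carrier_mat l l" and R: "\<And>z. R z \<in> carrier_mat l l" and ij: "i < l" "j < l"
  shows "conv_poly_right \<Lambda> l l 1 R (pencil l A) z $$ (i, j) =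
    (\<Sum>k<l. act \<Lambda> (poly_pencil l A $$ (k, j)) (\<lambda>w. R w $$ (i, k)) z)"
proof -
  have RZ: "Zplus_mat \<Lambda> R z \<in> carrier_mat l l"
    using Zplus_mat_power(1)[of R l l 1 z] R by simp
  have e: "Zplus_mat \<Lambda> R z $$ (i, k) = Zplus \<Lambda> (\<lambda>w. R w $$ (i, k)) z" if "k < l" for k
    using Zplus_mat_power(2)[of R l l i k 1 z] R that ij by simp
  have "conv_poly_right \<Lambda> l l 1 R (pencil l A) z $$ (i, j) =
      (R z * 1\<^sub>m l) $$ (i, j) + (Zplus_mat \<Lambda> R z * (- A)) $$ (i, j)"
    using ij by (simp add: conv_poly_right_def pencil_def)
  also have "R z * 1\<^sub>m l = R z" using R by (intro right_mult_one_mat)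
  also have "(Zplus_mat \<Lambda> R z * (- A)) $$ (i, j) = (\<Sum>k<l. Zplus_mat \<Lambda> R z $$ (i, k) * (- A) $$ (k, j))"
    using A RZ ij by (intro mat_mult_entry) auto
  also have "\<dots> = (\<Sum>k<l. - (A $$ (k, j) * Zplus \<Lambda> (\<lambda>w. R w $$ (i, k)) z))"
    using A ij e by (intro sum.cong) auto
  also have "R z $$ (i, j) + \<dots> =
      (\<Sum>k<l. (if k = j then R z $$ (i, k) else 0) - A $$ (k, j) * Zplus \<Lambda> (\<lambda>w. R w $$ (i, k)) z)"
    using ij by (simp add: sum_subtractf sum_negf)
  also have "\<dots> = (\<Sum>k<l. act \<Lambda> (poly_pencil l A $$ (k, j)) (\<lambda>w. R w $$ (i, k)) z)"
  proof (intro sum.cong refl)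
    fix k assume "k \<in> {..<l}"
    then have "poly_pencil l A $$ (k, j) = [:if k = j then 1 else 0, - (A $$ (k, j)):]"
      using ij by (simp add: poly_pencil_def)
    then show "(if k = j then R z $$ (i, k) else 0) - A $$ (k, j) * Zplus \<Lambda> (\<lambda>w. R w $$ (i, k)) z =
        act \<Lambda> (poly_pencil l A $$ (k, j)) (\<lambda>w. R w $$ (i, k)) z"
      using Zplus_cmult[of \<Lambda> "- (A $$ (k, j))" "\<lambda>w. R w $$ (i, k)"]
      by (auto simp: act_pCons[of \<Lambda> _ "[:- (A $$ (k, j)):]"] act_const simp del: pCons_eq_0_iff)
  qed
  finally show ?thesis .
qed

lemma unit_entry:
  assumes "i < l" "j < l"
  shows "DA_mat_poly \<Lambda> l l 0 (\<lambda>_. 1\<^sub>m l) z $$ (i, j) = (if i = j then one_V z else 0)"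
  using assms by (simp add: DA_mat_poly_def DA_power_def)

text \<open>
  The resolvent is \<open>adj(I - Z_+ A) \<phi>\<close>, where \<open>\<phi>\<close> is the preimage of the constant function 1 under
  \<open>det(I - Z_+ A)\<close>.
\<close>
lemma DA_resolvent_eq:
  assumes A: "A \<in> carrier_mat l l" and spec: "exceptional_set \<Lambda> \<inter> spectrum A = {}"
    and phi: "\<phi> \<in> DA \<Lambda>" "act \<Lambda> (pencil_det l A) \<phi> = one_V"
  shows "DA_resolvent \<Lambda> l A =
    (\<lambda>z. Matrix.mat l l (\<lambda>(i, j). act \<Lambda> (adj_mat (poly_pencil l A) $$ (i, j)) \<phi> z))" (is "_ = ?R")
  unfolding DA_resolvent_def
proof (rule the_equality)
  let ?P = "poly_pencil l A"
  note adj = adj_mat[OF poly_pencil_carrier, of l A]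
  have carr: "?R z \<in> carrier_mat l l" for z by simp
  have DA_R: "?R \<in> DA_mat \<Lambda> l l"
    unfolding DA_mat_def using act_DA[OF phi(1)] by simp
  have delta: "act \<Lambda> ((pencil_det l A \<cdot>\<^sub>m 1\<^sub>m l) $$ (i, j)) \<phi> z = (if i = j then one_V z else 0)"
    if "i < l" "j < l" for i j z
    using that by (simp add: phi(2))
  have left: "conv_poly_left \<Lambda> l l 1 (pencil l A) ?R = DA_mat_poly \<Lambda> l l 0 (\<lambda>_. 1\<^sub>m l)"
  proof (intro ext eq_matI)
    fix z i j
    assume "i < dim_row (DA_mat_poly \<Lambda> l l 0 (\<lambda>_. 1\<^sub>m l) z)" "j < dim_col (DA_mat_poly \<Lambda> l l 0 (\<lambda>_. 1\<^sub>m l) z)"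
    then have ij: "i < l" "j < l" by (simp_all add: DA_mat_poly_def)
    have "conv_poly_left \<Lambda> l l 1 (pencil l A) ?R z $$ (i, j) =
        mact l ?P (\<lambda>k w. ?R w $$ (k, j)) i z"
      by (rule conv_pencil_left_entry[OF A carr ij])
    also have "\<dots> = (\<Sum>k<l. act \<Lambda> (?P $$ (i, k) * adj_mat ?P $$ (k, j)) \<phi> z)"
      unfolding mact_def using ij by (intro sum.cong) (simp_all add: act_mult)
    also have "\<dots> = act \<Lambda> ((?P * adj_mat ?P) $$ (i, j)) \<phi> z"
      unfolding mat_mult_entry[OF poly_pencil_carrier adj(1) ij] act_sum ..
    also have "\<dots> = DA_mat_poly \<Lambda> l l 0 (\<lambda>_. 1\<^sub>m l) z $$ (i, j)"
      unfolding adj(2) using delta[OF ij] unit_entry[OF ij] by (simp add: pencil_det_def)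
    finally show "conv_poly_left \<Lambda> l l 1 (pencil l A) ?R z $$ (i, j) = DA_mat_poly \<Lambda> l l 0 (\<lambda>_. 1\<^sub>m l) z $$ (i, j)" .
  qed (simp_all add: conv_poly_left_def DA_mat_poly_def)
  have right: "conv_poly_right \<Lambda> l l 1 ?R (pencil l A) = DA_mat_poly \<Lambda> l l 0 (\<lambda>_. 1\<^sub>m l)"
  proof (intro ext eq_matI)
    fix z i j
    assume "i < dim_row (DA_mat_poly \<Lambda> l l 0 (\<lambda>_. 1\<^sub>m l) z)" "j < dim_col (DA_mat_poly \<Lambda> l l 0 (\<lambda>_. 1\<^sub>m l) z)"
    then have ij: "i < l" "j < l" by (simp_all add: DA_mat_poly_def)
    have "conv_poly_right \<Lambda> l l 1 ?R (pencil l A) z $$ (i, j) =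
        (\<Sum>k<l. act \<Lambda> (?P $$ (k, j)) (\<lambda>w. ?R w $$ (i, k)) z)"
      by (rule conv_pencil_right_entry[OF A carr ij])
    also have "\<dots> = (\<Sum>k<l. act \<Lambda> (adj_mat ?P $$ (i, k) * ?P $$ (k, j)) \<phi> z)"
      using ij by (intro sum.cong) (simp_all add: act_mult act_commute)
    also have "\<dots> = act \<Lambda> ((adj_mat ?P * ?P) $$ (i, j)) \<phi> z"
      unfolding mat_mult_entry[OF adj(1) poly_pencil_carrier ij] act_sum ..
    also have "\<dots> = DA_mat_poly \<Lambda> l l 0 (\<lambda>_. 1\<^sub>m l) z $$ (i, j)"
      unfolding adj(3) using delta[OF ij] unit_entry[OF ij] by (simp add: pencil_det_def)
    finally show "conv_poly_right \<Lambda> l l 1 ?R (pencil l A) z $$ (i, j) = DA_mat_poly \<Lambda> l l 0 (\<lambda>_. 1\<^sub>m l) z $$ (i, j)" .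
  qed (simp_all add: conv_poly_right_def DA_mat_poly_def)
  show "?R \<in> DA_mat \<Lambda> l l \<and>
     conv_poly_left \<Lambda> l l 1 (pencil l A) ?R = DA_mat_poly \<Lambda> l l 0 (\<lambda>_. 1\<^sub>m l) \<and>
     conv_poly_right \<Lambda> l l 1 ?R (pencil l A) = DA_mat_poly \<Lambda> l l 0 (\<lambda>_. 1\<^sub>m l)"
    using DA_R left right by blast
  fix R assume R: "R \<in> DA_mat \<Lambda> l l \<and>
     conv_poly_left \<Lambda> l l 1 (pencil l A) R = DA_mat_poly \<Lambda> l l 0 (\<lambda>_. 1\<^sub>m l) \<and>
     conv_poly_right \<Lambda> l l 1 R (pencil l A) = DA_mat_poly \<Lambda> l l 0 (\<lambda>_. 1\<^sub>m l)"
  then have Rc: "R z \<in> carrier_mat l l" for z by (simp add: DA_mat_def)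
  have entry: "(\<lambda>w. R w $$ (i, j)) = (\<lambda>w. ?R w $$ (i, j))" if ij: "i < l" "j < l" for i j
  proof (rule mact_pencil_inj[OF A spec, of "\<lambda>k w. R w $$ (k, j)" "\<lambda>k w. ?R w $$ (k, j)"])
    fix k assume k: "k < l"
    show "(\<lambda>w. R w $$ (k, j)) \<in> DA \<Lambda>" "(\<lambda>w. ?R w $$ (k, j)) \<in> DA \<Lambda>"
      using R DA_R k ij by (auto simp: DA_mat_def)
    show "mact l ?P (\<lambda>k w. R w $$ (k, j)) k = mact l ?P (\<lambda>k w. ?R w $$ (k, j)) k"
      using conv_pencil_left_entry[of A l R k j] conv_pencil_left_entry[of A l ?R k j] A Rc carr k ij R left
      by (metis (no_types, lifting) ext)
  qed (rule ij)
  show "R = ?R"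
  proof (intro ext eq_matI)
    fix z i j assume "i < dim_row (?R z)" "j < dim_col (?R z)"
    then show "R z $$ (i, j) = ?R z $$ (i, j)" using fun_cong[OF entry] by simp
  qed (use Rc in auto)
qed

lemma DA_resolvent_obtain:
  assumes A: "A \<in> carrier_mat l l" and spec: "exceptional_set \<Lambda> \<inter> spectrum A = {}"
  obtains \<phi> where "\<phi> \<in> DA \<Lambda>" "act \<Lambda> (pencil_det l A) \<phi> = one_V"
    "\<And>z. DA_resolvent \<Lambda> l A z \<in> carrier_mat l l"
    "\<And>i j. i < l \<Longrightarrow> j < l \<Longrightarrow>
       (\<lambda>z. DA_resolvent \<Lambda> l A z $$ (i, j)) = act \<Lambda> (adj_mat (poly_pencil l A) $$ (i, j)) \<phi>"
proof -
  obtain \<phi> where "\<phi> \<in> DA \<Lambda>" "act \<Lambda> (pencil_det l A) \<phi> = one_V"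
    using regular_act_surj[OF pencil_det_regular[OF A spec] DA_one] by blast
  then show ?thesis using that[of \<phi>] DA_resolvent_eq[OF A spec] by simp
qed

lemma resolvent_equation:
  assumes A: "A \<in> carrier_mat l l" and spec: "exceptional_set \<Lambda> \<inter> spectrum A = {}" and ij: "i < l" "j < l"
  shows "mact l (poly_pencil l A) (\<lambda>k w. DA_resolvent \<Lambda> l A w $$ (k, j)) i = (\<lambda>z. if i = j then one_V z else 0)"
proof -
  let ?P = "poly_pencil l A"
  obtain \<phi> where phi: "\<phi> \<in> DA \<Lambda>" "act \<Lambda> (pencil_det l A) \<phi> = one_V"
    and R: "\<And>i j. i < l \<Longrightarrow> j < l \<Longrightarrow> (\<lambda>z. DA_resolvent \<Lambda> l A z $$ (i, j)) = act \<Lambda> (adj_mat ?P $$ (i, j)) \<phi>"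
    using DA_resolvent_obtain[OF A spec] by metis
  note adj = adj_mat[OF poly_pencil_carrier, of l A]
  have "mact l ?P (\<lambda>k w. DA_resolvent \<Lambda> l A w $$ (k, j)) i =
      (\<lambda>z. \<Sum>k<l. act \<Lambda> (?P $$ (i, k) * adj_mat ?P $$ (k, j)) \<phi> z)"
    unfolding mact_def using ij by (intro ext sum.cong) (simp_all add: R act_mult)
  also have "\<dots> = act \<Lambda> ((?P * adj_mat ?P) $$ (i, j)) \<phi>"
    unfolding mat_mult_entry[OF poly_pencil_carrier adj(1) ij] act_sum ..
  also have "\<dots> = (\<lambda>z. if i = j then one_V z else 0)"
    unfolding adj(2) using ij phi(2) by (simp add: pencil_det_def)
  finally show ?thesis .
qed

lemma realization_entry:
  assumes A: "A \<in> carrier_mat l l" and B: "B \<in> carrier_mat l n" and C: "C \<in> carrier_mat m l"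
    and D: "D \<in> carrier_mat m n" and spec: "exceptional_set \<Lambda> \<inter> spectrum A = {}"
    and ij: "i < m" "j < n"
  shows "(D + C * Zplus_mat \<Lambda> (DA_resolvent \<Lambda> l A) z * B) $$ (i, j) = D $$ (i, j) +
    (\<Sum>b<l. \<Sum>a<l. C $$ (i, a) * B $$ (b, j) * Zplus \<Lambda> (\<lambda>w. DA_resolvent \<Lambda> l A w $$ (a, b)) z)"
proof -
  let ?R = "DA_resolvent \<Lambda> l A"
  have Rc: "\<And>z. ?R z \<in> carrier_mat l l" using DA_resolvent_obtain[OF A spec] by metis
  have ZR: "Zplus_mat \<Lambda> ?R z \<in> carrier_mat l l"
    using Zplus_mat_power(1)[of ?R l l 1 z] Rc by simp
  have e: "Zplus_mat \<Lambda> ?R z $$ (a, b) = Zplus \<Lambda> (\<lambda>w. ?R w $$ (a, b)) z" if "a < l" "b < l" for a b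
    using Zplus_mat_power(2)[of ?R l l a b 1 z] Rc that by simp
  have CR: "C * Zplus_mat \<Lambda> ?R z \<in> carrier_mat m l" using C ZR by simp
  have "(C * Zplus_mat \<Lambda> ?R z * B) $$ (i, j) = (\<Sum>b<l. (C * Zplus_mat \<Lambda> ?R z) $$ (i, b) * B $$ (b, j))"
    by (rule mat_mult_entry[OF CR B ij])
  also have "\<dots> = (\<Sum>b<l. \<Sum>a<l. C $$ (i, a) * B $$ (b, j) * Zplus \<Lambda> (\<lambda>w. ?R w $$ (a, b)) z)"
  proof (rule sum.cong[OF refl])
    fix b assume "b \<in> {..<l}"
    then have b: "b < l" by simp
    show "(C * Zplus_mat \<Lambda> ?R z) $$ (i, b) * B $$ (b, j) =
        (\<Sum>a<l. C $$ (i, a) * B $$ (b, j) * Zplus \<Lambda> (\<lambda>w. ?R w $$ (a, b)) z)"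
      unfolding mat_mult_entry[OF C ZR ij(1) b] sum_distrib_right
      using e b by (intro sum.cong) auto
  qed
  finally show ?thesis using ij B C D CR by simp
qed

text \<open>
  A matrix-valued function is a DA polynomial iff each of its entries is \<open>q(Z_+) 1\<close> for some \<open>q\<close>.
\<close>
lemma is_DA_mat_polyI:
  assumes "\<And>z. g z \<in> carrier_mat m n"
    and "\<And>i j. i < m \<Longrightarrow> j < n \<Longrightarrow> \<exists>q. (\<lambda>z. g z $$ (i, j)) = act \<Lambda> q one_V"
  shows "is_DA_mat_poly \<Lambda> m n g"
proof -
  obtain q where q: "\<And>i j. i < m \<Longrightarrow> j < n \<Longrightarrow> (\<lambda>z. g z $$ (i, j)) = act \<Lambda> (q i j) one_V"
    using assms(2) by metis
  define N where "N = (\<Sum>i<m. \<Sum>j<n. degree (q i j))"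
  have deg: "degree (q i j) \<le> N" if "i < m" "j < n" for i j
  proof -
    have "degree (q i j) \<le> (\<Sum>j<n. degree (q i j))" by (rule member_le_sum) (use that in auto)
    also have "\<dots> \<le> N" unfolding N_def by (rule member_le_sum) (use that in auto)
    finally show ?thesis .
  qed
  define A where "A k = Matrix.mat m n (\<lambda>(i, j). pcoeff (q i j) k)" for k
  have "g = DA_mat_poly \<Lambda> m n N A"
  proof (intro ext eq_matI)
    fix z i j assume "i < dim_row (DA_mat_poly \<Lambda> m n N A z)" "j < dim_col (DA_mat_poly \<Lambda> m n N A z)"
    then have ij: "i < m" "j < n" by (simp_all add: DA_mat_poly_def)
    then show "g z $$ (i, j) = DA_mat_poly \<Lambda> m n N A z $$ (i, j)"
      using fun_cong[OF q[OF ij], of z] act_bound[OF deg[OF ij], of \<Lambda> one_V z]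
      by (simp add: DA_mat_poly_def A_def DA_power_def)
  qed (use assms(1) in \<open>auto simp: DA_mat_poly_def\<close>)
  moreover have "\<forall>k\<le>N. A k \<in> carrier_mat m n" by (simp add: A_def)
  ultimately show ?thesis unfolding is_DA_mat_poly_def by blast
qed

lemma is_DA_mat_polyD:
  assumes "is_DA_mat_poly \<Lambda> m n g" "i < m" "j < n"
  shows "\<exists>q. (\<lambda>z. g z $$ (i, j)) = act \<Lambda> q one_V"
proof -
  obtain N A where "g = DA_mat_poly \<Lambda> m n N A" using assms by (auto simp: is_DA_mat_poly_def)
  then have "(\<lambda>z. g z $$ (i, j)) = act \<Lambda> (\<Sum>k\<le>N. monom (A k $$ (i, j)) k) one_V"
    using assms by (simp add: DA_mat_poly_def DA_power_def act_poly_sum)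
  then show ?thesis by blast
qed

lemma scalar_conv_entry:
  assumes "f \<in> DA_mat \<Lambda> m n" "i < m" "j < n"
  shows "(\<lambda>z. conv_poly_left \<Lambda> m n N (\<lambda>k. c k \<cdot>\<^sub>m 1\<^sub>m m) f z $$ (i, j)) =
    act \<Lambda> (\<Sum>k\<le>N. monom (c k) k) (\<lambda>z. f z $$ (i, j))"
proof
  fix z
  have f: "\<And>z. f z \<in> carrier_mat m n" using assms by (simp add: DA_mat_def)
  have "((c k \<cdot>\<^sub>m 1\<^sub>m m) * (Zplus_mat \<Lambda> ^^ k) f z) $$ (i, j) = c k * (Zplus \<Lambda> ^^ k) (\<lambda>z. f z $$ (i, j)) z" for k
  proof -
    have "(c k \<cdot>\<^sub>m 1\<^sub>m m) * (Zplus_mat \<Lambda> ^^ k) f z = c k \<cdot>\<^sub>m (1\<^sub>m m * (Zplus_mat \<Lambda> ^^ k) f z)"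
      using Zplus_mat_power(1)[of f m n k z, OF f] by (intro mult_smult_assoc_mat[of _ m m _ n]) auto
    also have "1\<^sub>m m * (Zplus_mat \<Lambda> ^^ k) f z = (Zplus_mat \<Lambda> ^^ k) f z"
      using Zplus_mat_power(1)[of f m n k z, OF f] by (rule left_mult_one_mat)
    finally show ?thesis
      using Zplus_mat_power(1)[of f m n k z, OF f] Zplus_mat_power(2)[of f m n i j k z, OF f] assms(2,3)
      by simp
  qed
  then show "conv_poly_left \<Lambda> m n N (\<lambda>k. c k \<cdot>\<^sub>m 1\<^sub>m m) f z $$ (i, j) =
    act \<Lambda> (\<Sum>k\<le>N. monom (c k) k) (\<lambda>z. f z $$ (i, j)) z"
    using assms by (simp add: conv_poly_left_def act_poly_sum)
qed

lemma poly_multiple_iff: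
  assumes f: "f \<in> DA_mat \<Lambda> m n"
  shows "(\<exists>N c. (\<exists>z\<in>V. DA_poly \<Lambda> N c z \<noteq> 0) \<and>
      is_DA_mat_poly \<Lambda> m n (conv_poly_left \<Lambda> m n N (\<lambda>k. c k \<cdot>\<^sub>m 1\<^sub>m m) f)) \<longleftrightarrow>
    (\<exists>p. act \<Lambda> p one_V \<noteq> (\<lambda>z. 0) \<and>
      (\<forall>i<m. \<forall>j<n. \<exists>q. act \<Lambda> p (\<lambda>z. f z $$ (i, j)) = act \<Lambda> q one_V))" (is "?L \<longleftrightarrow> ?R")
proof
  assume ?L
  then obtain N c z where c: "DA_poly \<Lambda> N c z \<noteq> 0"
    and P: "is_DA_mat_poly \<Lambda> m n (conv_poly_left \<Lambda> m n N (\<lambda>k. c k \<cdot>\<^sub>m 1\<^sub>m m) f)" by blast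
  have "act \<Lambda> (\<Sum>k\<le>N. monom (c k) k) one_V \<noteq> (\<lambda>z. 0)"
    using c unfolding DA_poly_eq_act by metis
  moreover have "\<exists>q. act \<Lambda> (\<Sum>k\<le>N. monom (c k) k) (\<lambda>z. f z $$ (i, j)) = act \<Lambda> q one_V"
    if "i < m" "j < n" for i j
    using is_DA_mat_polyD[OF P that] unfolding scalar_conv_entry[OF f that] .
  ultimately show ?R by blast
next
  assume ?R
  then obtain p where p: "act \<Lambda> p one_V \<noteq> (\<lambda>z. 0)"
    and q: "\<And>i j. i < m \<Longrightarrow> j < n \<Longrightarrow> \<exists>q. act \<Lambda> p (\<lambda>z. f z $$ (i, j)) = act \<Lambda> q one_V" by blast
  have eq: "(\<Sum>k\<le>degree p. monom (pcoeff p k) k) = p" by (rule poly_as_sum_of_monoms)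
  have "is_DA_mat_poly \<Lambda> m n (conv_poly_left \<Lambda> m n (degree p) (\<lambda>k. pcoeff p k \<cdot>\<^sub>m 1\<^sub>m m) f)"
  proof (rule is_DA_mat_polyI)
    show "conv_poly_left \<Lambda> m n (degree p) (\<lambda>k. pcoeff p k \<cdot>\<^sub>m 1\<^sub>m m) f z \<in> carrier_mat m n" for z
      by (simp add: conv_poly_left_def)
    show "\<exists>q. (\<lambda>z. conv_poly_left \<Lambda> m n (degree p) (\<lambda>k. pcoeff p k \<cdot>\<^sub>m 1\<^sub>m m) f z $$ (i, j)) = act \<Lambda> q one_V"
      if "i < m" "j < n" for i j
      unfolding scalar_conv_entry[OF f that] eq using q[OF that] .
  qed
  moreover have "\<exists>z\<in>V. DA_poly \<Lambda> (degree p) (pcoeff p) z \<noteq> 0"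
  proof -
    obtain z where z: "act \<Lambda> p one_V z \<noteq> 0" using p by blast
    then have "z \<in> V" using DA_outside[OF act_DA[OF DA_one]] by blast
    then show ?thesis unfolding DA_poly_eq_act eq using z by blast
  qed
  ultimately show ?L by blast
qed

lemma regular_act_nonzero: "regular p \<Longrightarrow> act \<Lambda> p one_V \<noteq> (\<lambda>z. 0)"
  using act_at_0[OF DA_one, of p] zero_vertex by (auto simp: regular_def poly_0_coeff_0 dest: fun_cong[of _ _ 0])

text \<open>
  The common denominator of the entries of a rational function is \<open>det(I - s A)\<close>.
\<close>
lemma rational_imp_poly_multiple:
  assumes "DA_rational \<Lambda> m n f"
  shows "\<exists>p. act \<Lambda> p one_V \<noteq> (\<lambda>z. 0) \<and>
      (\<forall>i<m. \<forall>j<n. \<exists>q. act \<Lambda> p (\<lambda>z. f z $$ (i, j)) = act \<Lambda> q one_V)"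
proof -
  from assms obtain l A B C D where f: "f \<in> DA_mat \<Lambda> m n" and A: "A \<in> carrier_mat l l"
    and B: "B \<in> carrier_mat l n" and C: "C \<in> carrier_mat m l" and D: "D \<in> carrier_mat m n"
    and spec: "exceptional_set \<Lambda> \<inter> spectrum A = {}"
    and fz: "\<And>z. z \<in> V \<Longrightarrow> f z = D + C * Zplus_mat \<Lambda> (DA_resolvent \<Lambda> l A) z * B"
    unfolding DA_rational_def by blast
  obtain \<phi> where phi: "\<phi> \<in> DA \<Lambda>" "act \<Lambda> (pencil_det l A) \<phi> = one_V"
    and R: "\<And>i j. i < l \<Longrightarrow> j < l \<Longrightarrow>
      (\<lambda>z. DA_resolvent \<Lambda> l A z $$ (i, j)) = act \<Lambda> (adj_mat (poly_pencil l A) $$ (i, j)) \<phi>"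
    using DA_resolvent_obtain[OF A spec] by metis
  define p where "p = pencil_det l A"
  define q where "q i j = Polynomial.smult (D $$ (i, j)) p +
    (\<Sum>b<l. \<Sum>a<l. Polynomial.smult (C $$ (i, a) * B $$ (b, j)) (pCons 0 (adj_mat (poly_pencil l A) $$ (a, b))))" for i j
  have "act \<Lambda> p (\<lambda>z. f z $$ (i, j)) = act \<Lambda> (q i j) one_V" if ij: "i < m" "j < n" for i j
  proof -
    have "f z $$ (i, j) = act \<Lambda> (q i j) \<phi> z" for z
    proof (cases "z \<in> V")
      case True
      have "f z $$ (i, j) = D $$ (i, j) * act \<Lambda> p \<phi> z +
          (\<Sum>b<l. \<Sum>a<l. C $$ (i, a) * B $$ (b, j) * Zplus \<Lambda> (\<lambda>w. DA_resolvent \<Lambda> l A w $$ (a, b)) z)"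
        using fz[OF True] realization_entry[OF A B C D spec ij] True phi(2) by (simp add: p_def)
      also have "\<dots> = act \<Lambda> (q i j) \<phi> z"
        unfolding q_def act_add act_sum act_smult act_pCons
        by (intro arg_cong2[where f = "(+)"] sum.cong refl) (simp_all add: R)
      finally show ?thesis .
    next
      case False
      have "(\<lambda>z. f z $$ (i, j)) \<in> DA \<Lambda>" using f ij by (simp add: DA_mat_def)
      from DA_outside[OF this False] have "f z $$ (i, j) = 0" .
      then show ?thesis using False DA_outside[OF act_DA[OF phi(1)]] by simp
    qed
    then have "act \<Lambda> p (\<lambda>z. f z $$ (i, j)) = act \<Lambda> p (act \<Lambda> (q i j) \<phi>)" by presburger
    also have "\<dots> = act \<Lambda> (q i j) (act \<Lambda> p \<phi>)" by (rule act_commute)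
    also have "\<dots> = act \<Lambda> (q i j) one_V" using phi(2) by (simp add: p_def)
    finally show ?thesis .
  qed
  moreover have "act \<Lambda> p one_V \<noteq> (\<lambda>z. 0)"
    unfolding p_def by (rule regular_act_nonzero[OF pencil_det_regular[OF A spec]])
  ultimately show ?thesis by blast
qed

end

section \<open>Realizations by companion matrices\<close>

lemma sum_blocks:
  fixes g :: "nat \<Rightarrow> nat \<Rightarrow> 'a :: comm_monoid_add"
  shows "(\<Sum>r<L * n. g (r div n) (r mod n)) = (\<Sum>k<L. \<Sum>j<n. g k j)"
proof -
  have "(\<Sum>r<L * n. g (r div n) (r mod n)) = (\<Sum>k<L. \<Sum>r = k * n..<k * n + n. g (r div n) (r mod n))"
    by (rule sum.nat_group[symmetric])
  moreover have "(\<Sum>r = k * n..<k * n + n. g (r div n) (r mod n)) = (\<Sum>j<n. g k j)" for k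
  proof -
    have "(\<Sum>r = k * n..<k * n + n. g (r div n) (r mod n)) =
        (\<Sum>j = 0..<n. g ((j + k * n) div n) ((j + k * n) mod n))"
      using sum.shift_bounds_nat_ivl[of "\<lambda>r. g (r div n) (r mod n)" 0 "k * n" n] by (simp add: add.commute)
    also have "\<dots> = (\<Sum>j<n. g k j)" by (rule sum.cong) auto
    finally show ?thesis .
  qed
  ultimately show ?thesis by simp
qed

text \<open>
  The companion matrix of size \<open>L\<close> of the reversed polynomial, for a polynomial \<open>p\<close> with constant
  coefficient 1 and degree at most \<open>L\<close>, tensored with the identity matrix of size \<open>n\<close>. The index
  \<open>r\<close> encodes the pair \<open>(r div n, r mod n)\<close>. If \<open>L > 0\<close>, \<open>a\<close> is the untensored matrix and \<open>e\<close> the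
  first unit vector, then \<open>(I - s a)\<close> maps the vector \<open>(1, s, ..., s^(L-1))\<close> to \<open>p(s) e\<close>.
\<close>
definition companion :: "nat \<Rightarrow> nat \<Rightarrow> complex poly \<Rightarrow> complex Matrix.mat" where
  "companion L n p = Matrix.mat (L * n) (L * n) (\<lambda>(r, r').
     if r mod n \<noteq> r' mod n then 0
     else if r div n = 0 then - pcoeff p (Suc (r' div n))
     else if r div n = Suc (r' div n) then 1 else 0)"

lemma companion_carrier: "companion L n p \<in> carrier_mat (L * n) (L * n)"
  by (simp add: companion_def)

lemma companion_row:
  assumes "k < L" "j < n"
  shows "(\<Sum>r<L * n. companion L n p $$ (k * n + j, r) * x r) =
    (if k = 0 then - (\<Sum>k'<L. pcoeff p (Suc k') * x (k' * n + j)) else x ((k - 1) * n + j))"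
proof -
  have "k * n + j < L * n"
  proof -
    have "k * n + j < Suc k * n" using assms by simp
    also have "\<dots> \<le> L * n" using assms by (intro mult_le_mono1) simp
    finally show ?thesis .
  qed
  moreover have "(k * n + j) div n = k" "(k * n + j) mod n = j" using assms by simp_all
  ultimately have "(\<Sum>r<L * n. companion L n p $$ (k * n + j, r) * x r) =
      (\<Sum>r<L * n. (if r mod n \<noteq> j then 0 else if k = 0 then - pcoeff p (Suc (r div n))
        else if k = Suc (r div n) then 1 else 0) * x (r div n * n + r mod n))"
    by (intro sum.cong refl) (auto simp: companion_def)
  also have "\<dots> = (\<Sum>k'<L. \<Sum>j'<n. (if j' \<noteq> j then 0 else if k = 0 then - pcoeff p (Suc k')
        else if k = Suc k' then 1 else 0) * x (k' * n + j'))"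
    by (rule sum_blocks)
  also have "\<dots> = (\<Sum>k'<L. \<Sum>j'<n. if j' = j then (if k = 0 then - pcoeff p (Suc k')
        else if k = Suc k' then 1 else 0) * x (k' * n + j) else 0)"
    by (intro sum.cong refl) auto
  also have "\<dots> = (\<Sum>k'<L. (if k = 0 then - pcoeff p (Suc k')
        else if k = Suc k' then 1 else 0) * x (k' * n + j))"
    using assms by simp
  also have "\<dots> = (if k = 0 then - (\<Sum>k'<L. pcoeff p (Suc k') * x (k' * n + j)) else x ((k - 1) * n + j))"
  proof (cases k)
    case (Suc k0)
    have "(\<Sum>k'<L. (if Suc k0 = Suc k' then 1 else 0) * x (k' * n + j)) = (\<Sum>k'<L. if k' = k0 then x (k0 * n + j) else 0)"
      by (intro sum.cong refl) auto
    then show ?thesis using Suc assms by simp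
  qed (simp add: sum_negf)
  finally show ?thesis .
qed

lemma companion_eigenvalue_root:
  assumes t: "eigenvalue (companion L n p) t" "t \<noteq> 0" and p: "pcoeff p 0 = 1" "degree p \<le> L"
  shows "poly p (inverse t) = 0"
proof (rule ccontr)
  assume nz: "poly p (inverse t) \<noteq> 0"
  from t obtain v where v: "v \<in> carrier_vec (L * n)" "v \<noteq> 0\<^sub>v (L * n)"
    and ev: "companion L n p *\<^sub>v v = t \<cdot>\<^sub>v v"
    unfolding eigenvalue_def eigenvector_def by (auto simp: companion_def)
  define x where "x r = vec_index v r" for r
  have row: "(\<Sum>r'<L * n. companion L n p $$ (r, r') * x r') = t * x r" if "r < L * n" for r
  proof -
    have "(\<Sum>r'<L * n. companion L n p $$ (r, r') * x r') = vec_index (companion L n p *\<^sub>v v) r"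
      using that v(1) companion_carrier[of L n p]
      by (auto simp: scalar_prod_def lessThan_atLeast0 x_def intro!: sum.cong)
    then show ?thesis using that v(1) by (simp add: ev x_def)
  qed
  have lt: "k * n + j < L * n" if "k < L" "j < n" for k j
  proof -
    have "k * n + j < Suc k * n" using that by simp
    also have "\<dots> \<le> L * n" using that by (intro mult_le_mono1) simp
    finally show ?thesis .
  qed
  let ?s = "inverse t"
  have powr: "x (k * n + j) = ?s ^ k * x j" if "k < L" "j < n" for k j
    using that(1)
  proof (induction k)
    case (Suc k)
    have "x (k * n + j) = t * x (Suc k * n + j)"
      using row[OF lt[OF Suc.prems that(2)]] companion_row[OF Suc.prems that(2), of p x] by simp
    then have "x (Suc k * n + j) = ?s * x (k * n + j)" using t(2) by simp
    then show ?case using Suc by simp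
  qed simp
  have zero: "x j = 0" if L: "0 < L" and j: "j < n" for j
  proof -
    have "- (\<Sum>k<L. pcoeff p (Suc k) * x (k * n + j)) = t * x j"
      using row[OF lt[OF L j]] companion_row[OF L j, of p x] by simp
    moreover have "(\<Sum>k<L. pcoeff p (Suc k) * x (k * n + j)) = (\<Sum>k<L. pcoeff p (Suc k) * ?s ^ k) * x j"
      unfolding sum_distrib_right using powr[OF _ j] by (intro sum.cong) auto
    ultimately have "t * x j = - ((\<Sum>k<L. pcoeff p (Suc k) * ?s ^ k) * x j)" by metis
    then have "(t + (\<Sum>k<L. pcoeff p (Suc k) * ?s ^ k)) * x j = 0"
      by (simp add: distrib_right)
    moreover have "poly p ?s = ?s * (t + (\<Sum>k<L. pcoeff p (Suc k) * ?s ^ k))"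
    proof -
      have "poly p ?s = (\<Sum>k\<le>L. pcoeff p k * ?s ^ k)"
        unfolding poly_altdef by (rule sum.mono_neutral_left) (use p(2) in \<open>auto simp: not_le intro: coeff_eq_0\<close>)
      also have "{..L} = {..<Suc L}" by auto
      also have "(\<Sum>k<Suc L. pcoeff p k * ?s ^ k) = 1 + (\<Sum>k<L. pcoeff p (Suc k) * ?s ^ Suc k)"
        by (simp add: sum.lessThan_Suc_shift p(1) del: sum.lessThan_Suc)
      also have "(\<Sum>k<L. pcoeff p (Suc k) * ?s ^ Suc k) = ?s * (\<Sum>k<L. pcoeff p (Suc k) * ?s ^ k)"
        by (simp add: sum_distrib_left mult.left_commute)
      finally show ?thesis using t(2) by (simp add: distrib_left)
    qed
    ultimately show ?thesis using nz by auto
  qed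
  have "vec_index v r = 0" if r: "r < L * n" for r
  proof -
    have n: "n > 0" using r by (cases n) auto
    have k: "r div n < L" using r by (simp add: less_mult_imp_div_less)
    have "x (r div n * n + r mod n) = ?s ^ (r div n) * x (r mod n)"
      by (rule powr[OF k]) (use n in simp)
    then show ?thesis using zero[of "r mod n"] k n by (simp add: x_def)
  qed
  then have "v = 0\<^sub>v (L * n)" using v(1) by (intro eq_vecI) auto
  then show False using v(2) by simp
qed

lemma act_shift:
  assumes "degree p \<le> L"
  shows "act \<Lambda> p f z = pcoeff p 0 * f z + (\<Sum>k<L. pcoeff p (Suc k) * (Zplus \<Lambda> ^^ Suc k) f z)"
proof -
  have "{..L} = {..<Suc L}" by auto
  then show ?thesis
    unfolding act_bound[OF assms] by (simp add: sum.lessThan_Suc_shift del: sum.lessThan_Suc)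
qed

context admissible_tiling
begin

lemma mact_lincomb:
  "mact l M (\<lambda>a z. \<Sum>b\<in>I. c b * Y b a z) i = (\<lambda>z. \<Sum>b\<in>I. c b * mact l M (Y b) i z)"
proof
  fix z
  have "mact l M (\<lambda>a z. \<Sum>b\<in>I. c b * Y b a z) i z =
      (\<Sum>a<l. \<Sum>b\<in>I. c b * act \<Lambda> (M $$ (i, a)) (Y b a) z)"
    by (simp add: mact_def act_fun_sum act_fun_cmult)
  also have "\<dots> = (\<Sum>b\<in>I. \<Sum>a<l. c b * act \<Lambda> (M $$ (i, a)) (Y b a) z)" by (rule sum.swap)
  finally show "mact l M (\<lambda>a z. \<Sum>b\<in>I. c b * Y b a z) i z = (\<Sum>b\<in>I. c b * mact l M (Y b) i z)"
    by (simp add: mact_def sum_distrib_left)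
qed

text \<open>
  With \<open>p(Z_+) \<phi> = 1\<close>, column \<open>j < n\<close> of the resolvent has the entries \<open>Z_+^k \<phi>\<close> at the indices
  \<open>(k, j)\<close> and 0 elsewhere.
\<close>
lemma companion_resolvent_column:
  assumes p: "regular p" "pcoeff p 0 = 1" "degree p \<le> L"
    and phi: "\<phi> \<in> DA \<Lambda>" "act \<Lambda> p \<phi> = one_V"
    and spec: "exceptional_set \<Lambda> \<inter> spectrum (companion L n p) = {}"
    and j: "j < n" and a: "a < L * n"
  shows "(\<lambda>z. \<Sum>b<L * n. (if b = j then 1 else 0) * DA_resolvent \<Lambda> (L * n) (companion L n p) z $$ (a, b)) =
    (\<lambda>z. if a mod n = j then (Zplus \<Lambda> ^^ (a div n)) \<phi> z else 0)"
proof -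
  let ?l = "L * n" and ?A = "companion L n p"
  let ?R = "DA_resolvent \<Lambda> ?l ?A"
  define Y where "Y = (\<lambda>b a z. ?R z $$ (a, b))"
  define x where "x = (\<lambda>a z. if a mod n = j then (Zplus \<Lambda> ^^ (a div n)) \<phi> z else 0)"
  define y where "y = (\<lambda>a z. \<Sum>b<?l. (if b = j then 1 else 0) * Y b a z)"
  obtain \<psi> where psi: "\<psi> \<in> DA \<Lambda>" "\<And>i k. i < ?l \<Longrightarrow> k < ?l \<Longrightarrow>
      (\<lambda>z. ?R z $$ (i, k)) = act \<Lambda> (adj_mat (poly_pencil ?l ?A) $$ (i, k)) \<psi>"
    using DA_resolvent_obtain[OF companion_carrier spec] by metis
  have YDA: "Y b a \<in> DA \<Lambda>" if "a < ?l" "b < ?l" for a b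
    unfolding Y_def using act_DA[OF psi(1)] psi(2) that by simp
  have Zx: "Zplus \<Lambda> (x r) z = (if r mod n = j then (Zplus \<Lambda> ^^ Suc (r div n)) \<phi> z else 0)" for r z
    by (cases "r mod n = j") (simp_all add: x_def Zplus_zero)
  have "y a = x a"
  proof (rule mact_pencil_inj[OF companion_carrier spec _ _ _ a])
    show "y i \<in> DA \<Lambda>" if "i < ?l" for i
      unfolding y_def by (intro DA_sum DA_cmult YDA that) simp
    show "x i \<in> DA \<Lambda>" if "i < ?l" for i
      using Zplus_power_DA[OF phi(1)] by (cases "i mod n = j") (simp_all add: x_def DA_zero)
    fix i assume i: "i < ?l"
    define k where "k = i div n"
    define j0 where "j0 = i mod n"
    have n: "n > 0" using j by simp
    have k: "k < L" using i by (simp add: k_def less_mult_imp_div_less)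
    have j0: "j0 < n" using n by (simp add: j0_def)
    have ikj: "i = k * n + j0" by (simp add: k_def j0_def)
    have eqj: "i = j \<longleftrightarrow> k = 0 \<and> j0 = j"
    proof
      show "i = j \<Longrightarrow> k = 0 \<and> j0 = j" using j by (simp add: k_def j0_def)
    qed (simp add: ikj)
    have xi: "x i z = (if j0 = j then (Zplus \<Lambda> ^^ k) \<phi> z else 0)" for z
      by (simp add: x_def j0_def k_def)
    show "mact ?l (poly_pencil ?l ?A) y i = mact ?l (poly_pencil ?l ?A) x i"
    proof
      fix z
      have "mact ?l (poly_pencil ?l ?A) y i z =
          (\<Sum>b<?l. (if b = j then 1 else 0) * mact ?l (poly_pencil ?l ?A) (Y b) i z)"
        unfolding y_def mact_lincomb ..
      also have "\<dots> = (\<Sum>b<?l. if b = j then (if i = b then one_V z else 0) else 0)"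
        unfolding Y_def using resolvent_equation[OF companion_carrier spec i] by (intro sum.cong) auto
      also have "\<dots> = (if i = j then one_V z else 0)"
        using i by (auto simp: sum.delta')
      finally have Py: "mact ?l (poly_pencil ?l ?A) y i z = (if i = j then one_V z else 0)" .
      have "mact ?l (poly_pencil ?l ?A) x i z = x i z - (\<Sum>r<?l. ?A $$ (k * n + j0, r) * Zplus \<Lambda> (x r) z)"
        using mact_pencil[OF i, of ?A x] by (simp add: ikj)
      also have "\<dots> = x i z - (if k = 0 then - (\<Sum>k'<L. pcoeff p (Suc k') * Zplus \<Lambda> (x (k' * n + j0)) z)
          else Zplus \<Lambda> (x ((k - 1) * n + j0)) z)"
        unfolding companion_row[OF k j0] ..
      also have "\<dots> = (if i = j then one_V z else 0)"
      proof (cases "j0 = j")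
        case False
        then show ?thesis using j0 by (simp add: Zx eqj xi)
      next
        case True
        show ?thesis
        proof (cases k)
          case 0
          have "one_V z = \<phi> z + (\<Sum>k<L. pcoeff p (Suc k) * (Zplus \<Lambda> ^^ Suc k) \<phi> z)"
            using act_shift[OF p(3), of \<Lambda> \<phi> z] p(2) phi(2) by simp
          then show ?thesis using 0 True j0 by (simp add: Zx eqj xi)
        next
          case (Suc k0)
          then show ?thesis using True j0 n by (simp add: Zx eqj xi)
        qed
      qed
      finally show "mact ?l (poly_pencil ?l ?A) y i z = mact ?l (poly_pencil ?l ?A) x i z"
        using Py by simp
    qed
  qed
  then show ?thesis unfolding y_def x_def Y_def .
qed

text \<open>
  After reduction to a regular \<open>p\<close> with constant coefficient 1, each entry of \<open>f\<close> is \<open>q(Z_+) \<phi>\<close> with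
  \<open>p(Z_+) \<phi> = 1\<close>. Subtracting \<open>q(0) p\<close> from \<open>q\<close> leaves a polynomial without constant term, whose
  coefficients form the matrix \<open>C\<close>; the constants \<open>q(0)\<close> form \<open>D\<close>.
\<close>
lemma poly_multiple_imp_rational:
  assumes ev: "\<And>t. t \<in> exceptional_set \<Lambda> \<Longrightarrow> \<not> Zminus_eigenvalue \<Lambda> t"
    and f: "f \<in> DA_mat \<Lambda> m n" and "act \<Lambda> p0 one_V \<noteq> (\<lambda>z. 0)"
    and q0: "\<forall>i<m. \<forall>j<n. \<exists>q. act \<Lambda> p0 (\<lambda>z. f z $$ (i, j)) = act \<Lambda> q one_V"
  shows "DA_rational \<Lambda> m n f"
proof -
  have fDA: "(\<lambda>z. f z $$ (i, j)) \<in> DA \<Lambda>" if "i < m" "j < n" for i j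
    using f that by (simp add: DA_mat_def)
  have "p0 \<noteq> 0" using assms(3) by auto
  then obtain p1 where p1: "regular p1"
    and q1: "\<And>i j. i < m \<Longrightarrow> j < n \<Longrightarrow> \<exists>q. act \<Lambda> p1 (\<lambda>z. f z $$ (i, j)) = act \<Lambda> q one_V"
    using reduce_to_regular[OF ev, of p0 "{..<m} \<times> {..<n}" "\<lambda>(i, j) z. f z $$ (i, j)"] fDA q0 by auto
  define c where "c = poly p1 0"
  have c: "c \<noteq> 0" using p1 by (simp add: c_def regular_def)
  define p where "p = Polynomial.smult (inverse c) p1"
  have p: "regular p" "pcoeff p 0 = 1"
    using p1 c by (auto simp: p_def regular_def c_def poly_0_coeff_0)
  have "\<exists>q. act \<Lambda> p (\<lambda>z. f z $$ (i, j)) = act \<Lambda> q one_V" if ij: "i < m" "j < n" for i j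
  proof -
    obtain q where "act \<Lambda> p1 (\<lambda>z. f z $$ (i, j)) = act \<Lambda> q one_V"
      using q1[OF ij] by blast
    then have "act \<Lambda> p (\<lambda>z. f z $$ (i, j)) = act \<Lambda> (Polynomial.smult (inverse c) q) one_V"
      by (simp add: p_def act_smult)
    then show ?thesis by blast
  qed
  then obtain q where q: "\<And>i j. i < m \<Longrightarrow> j < n \<Longrightarrow> act \<Lambda> p (\<lambda>z. f z $$ (i, j)) = act \<Lambda> (q i j) one_V"
    by metis
  obtain \<phi> where phi: "\<phi> \<in> DA \<Lambda>" "act \<Lambda> p \<phi> = one_V"
    using regular_act_surj[OF p(1) DA_one] by blast
  have fphi: "(\<lambda>z. f z $$ (i, j)) = act \<Lambda> (q i j) \<phi>" if "i < m" "j < n" for i j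
    by (rule regular_act_inj[OF p(1) fDA[OF that] act_DA[OF phi(1)]])
      (simp add: q[OF that] act_commute[of \<Lambda> p] phi(2))
  define L where "L = degree p + (\<Sum>i<m. \<Sum>j<n. degree (q i j))"
  have degp: "degree p \<le> L" by (simp add: L_def)
  have degq: "degree (q i j) \<le> L" if "i < m" "j < n" for i j
  proof -
    have "degree (q i j) \<le> (\<Sum>j<n. degree (q i j))" by (rule member_le_sum) (use that in auto)
    also have "\<dots> \<le> (\<Sum>i<m. \<Sum>j<n. degree (q i j))" by (rule member_le_sum) (use that in auto)
    finally show ?thesis by (simp add: L_def)
  qed
  let ?l = "L * n"
  define A where "A = companion L n p"
  define B :: "complex Matrix.mat" where "B = Matrix.mat ?l n (\<lambda>(r, j). if r = j then 1 else 0)"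
  define C where "C = Matrix.mat m ?l (\<lambda>(i, r). pcoeff (q i (r mod n)) (Suc (r div n)) -
    pcoeff (q i (r mod n)) 0 * pcoeff p (Suc (r div n)))"
  define D where "D = Matrix.mat m n (\<lambda>(i, j). pcoeff (q i j) 0)"
  have carr: "A \<in> carrier_mat ?l ?l" "B \<in> carrier_mat ?l n" "C \<in> carrier_mat m ?l" "D \<in> carrier_mat m n"
    by (simp_all add: A_def companion_carrier B_def C_def D_def)
  have spec: "exceptional_set \<Lambda> \<inter> spectrum A = {}"
  proof (rule ccontr)
    assume "exceptional_set \<Lambda> \<inter> spectrum A \<noteq> {}"
    then obtain t where t: "t \<in> exceptional_set \<Lambda>" "eigenvalue A t" by (auto simp: spectrum_def)
    have "t \<noteq> 0" using t(1) by (auto simp: exceptional_set_def)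
    then have "poly p (inverse t) = 0"
      using companion_eigenvalue_root t(2) p(2) degp unfolding A_def by blast
    then show False using p(1) t(1) by (auto simp: regular_def)
  qed
  let ?R = "DA_resolvent \<Lambda> ?l A"
  have entry: "(D + C * Zplus_mat \<Lambda> ?R z * B) $$ (i, j) = f z $$ (i, j)"
    if z: "z \<in> V" and ij: "i < m" "j < n" for z i j
  proof -
    have col: "Zplus \<Lambda> (\<lambda>z. \<Sum>b<?l. (if b = j then 1 else 0) * ?R z $$ (a, b)) z =
        (if a mod n = j then (Zplus \<Lambda> ^^ Suc (a div n)) \<phi> z else 0)" if a: "a < ?l" for a
    proof (cases "a mod n = j")
      case True
      then show ?thesis
        using companion_resolvent_column[OF p degp phi spec[unfolded A_def] ij(2) a] by (simp add: A_def)
    next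
      case False
      then show ?thesis
        using companion_resolvent_column[OF p degp phi spec[unfolded A_def] ij(2) a]
        by (simp add: A_def Zplus_zero)
    qed
    have "(D + C * Zplus_mat \<Lambda> ?R z * B) $$ (i, j) = D $$ (i, j) +
        (\<Sum>b<?l. \<Sum>a<?l. C $$ (i, a) * B $$ (b, j) * Zplus \<Lambda> (\<lambda>w. ?R w $$ (a, b)) z)"
      by (rule realization_entry[OF carr spec ij])
    also have "(\<Sum>b<?l. \<Sum>a<?l. C $$ (i, a) * B $$ (b, j) * Zplus \<Lambda> (\<lambda>w. ?R w $$ (a, b)) z) =
        (\<Sum>a<?l. \<Sum>b<?l. C $$ (i, a) * B $$ (b, j) * Zplus \<Lambda> (\<lambda>w. ?R w $$ (a, b)) z)"
      by (rule sum.swap)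
    also have "\<dots> = (\<Sum>a<?l. C $$ (i, a) *
        Zplus \<Lambda> (\<lambda>z. \<Sum>b<?l. (if b = j then 1 else 0) * ?R z $$ (a, b)) z)"
      unfolding Zplus_sum Zplus_cmult sum_distrib_left
      using ij by (intro sum.cong refl) (simp add: B_def)
    also have "\<dots> = (\<Sum>a<?l. C $$ (i, a) * (if a mod n = j then (Zplus \<Lambda> ^^ Suc (a div n)) \<phi> z else 0))"
      using col by (intro sum.cong refl) simp
    also have "\<dots> = (\<Sum>a<?l. (pcoeff (q i (a mod n)) (Suc (a div n)) -
        pcoeff (q i (a mod n)) 0 * pcoeff p (Suc (a div n))) *
        (if a mod n = j then (Zplus \<Lambda> ^^ Suc (a div n)) \<phi> z else 0))"
      using ij by (intro sum.cong refl) (simp add: C_def)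
    also have "\<dots> = (\<Sum>k<L. \<Sum>j'<n. (pcoeff (q i j') (Suc k) - pcoeff (q i j') 0 * pcoeff p (Suc k)) *
        (if j' = j then (Zplus \<Lambda> ^^ Suc k) \<phi> z else 0))"
      by (rule sum_blocks)
    also have "\<dots> = (\<Sum>k<L. \<Sum>j'<n. if j' = j then
        (pcoeff (q i j) (Suc k) - pcoeff (q i j) 0 * pcoeff p (Suc k)) * (Zplus \<Lambda> ^^ Suc k) \<phi> z else 0)"
      by (intro sum.cong refl) auto
    also have "\<dots> = (\<Sum>k<L. (pcoeff (q i j) (Suc k) - pcoeff (q i j) 0 * pcoeff p (Suc k)) *
        (Zplus \<Lambda> ^^ Suc k) \<phi> z)"
      using ij by simp
    also have "\<dots> = (\<Sum>k<L. pcoeff (q i j) (Suc k) * (Zplus \<Lambda> ^^ Suc k) \<phi> z) -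
        pcoeff (q i j) 0 * (\<Sum>k<L. pcoeff p (Suc k) * (Zplus \<Lambda> ^^ Suc k) \<phi> z)"
      by (simp only: left_diff_distrib sum_subtractf sum_distrib_left mult.assoc)
    also have "\<dots> = (act \<Lambda> (q i j) \<phi> z - pcoeff (q i j) 0 * \<phi> z) - pcoeff (q i j) 0 * (act \<Lambda> p \<phi> z - \<phi> z)"
      by (simp only: act_shift[OF degp] act_shift[OF degq[OF ij]] p(2) add_diff_cancel_left' mult_1_left)
    also have "\<dots> = act \<Lambda> (q i j) \<phi> z - pcoeff (q i j) 0"
      using z by (simp add: phi(2) algebra_simps)
    finally show ?thesis using ij fun_cong[OF fphi[OF ij], of z] by (simp add: D_def)
  qed
  have "f z = D + C * Zplus_mat \<Lambda> ?R z * B" if z: "z \<in> V" for z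
  proof (rule eq_matI)
    have "f z \<in> carrier_mat m n" using f by (simp add: DA_mat_def)
    then show "dim_row (f z) = dim_row (D + C * Zplus_mat \<Lambda> ?R z * B)"
      "dim_col (f z) = dim_col (D + C * Zplus_mat \<Lambda> ?R z * B)"
      by (auto simp: D_def B_def C_def)
    fix i j assume "i < dim_row (D + C * Zplus_mat \<Lambda> ?R z * B)" "j < dim_col (D + C * Zplus_mat \<Lambda> ?R z * B)"
    then have "i < m" "j < n" by (auto simp: C_def B_def)
    then show "f z $$ (i, j) = (D + C * Zplus_mat \<Lambda> ?R z * B) $$ (i, j)" using entry[OF z] by simp
  qed
  then show ?thesis unfolding DA_rational_def using f carr spec by blast
qed

end

theorem theorem5p11:
  fixes \<Lambda> :: "complex set set" and m n :: nat and f :: "complex \<Rightarrow> complex Matrix.mat"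
  assumes "admissible_lattice \<Lambda>"
    and "\<And>t. t \<in> exceptional_set \<Lambda> \<Longrightarrow> \<not> Zminus_eigenvalue \<Lambda> t"
    and "f \<in> DA_mat \<Lambda> m n"
  shows "DA_rational \<Lambda> m n f \<longleftrightarrow>
    (\<exists>N c. (\<exists>z\<in>lattice_vertices \<Lambda>. DA_poly \<Lambda> N c z \<noteq> 0) \<and>
      is_DA_mat_poly \<Lambda> m n (conv_poly_left \<Lambda> m n N (\<lambda>k. c k \<cdot>\<^sub>m 1\<^sub>m m) f))"
proof -
  interpret admissible_tiling \<Lambda> by unfold_locales (rule assms(1))
  show ?thesis
    unfolding poly_multiple_iff[OF assms(3)]
    using rational_imp_poly_multiple poly_multiple_imp_rational[OF assms(2,3)] by blast
qed

end
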